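(* Let $\rho\in\mathbb Q^\times$ with $\rho^{-1}\in\mathbb N$. The functor $V\mapsto\mathcal A(V)$ (the Frenkel-Zhu algebra) from truncated $\rho\mathbb Z$-graded associative unital vertex algebras to local associative algebras is fully faithful.
   Context: Conventions: $\mathbb K$ is a field of characteristic $0$. All vector spaces are super ($\mathbb Z/2$-graded), multiplications and morphisms of algebras are even, commutators are supercommutators, $\zeta^{ab}=(-1)^{p(a)p(b)}$; subsets contain the even and odd components of their elements. $x^{(n)}=x^n/n!$. All associative algebras and all (unbounded) vertex algebras are unital and morphisms preserve $1$. Gradings are indexed by $\rho\mathbb Z$. Vertex algebras: an unbounded $\lambda$-bracket on a vector space $V$ with even operator $T$ is an even linear map $V\otimes V\to V[[\lambda]]$, $[a_\lambda b]=\sum_{t\ge 0}a_tb\lambda^{(t)}$, with $T[a_\lambda b]=[Ta_\lambda b]+[a_\lambda Tb]$, $[Ta_\lambda b]=-\lambda[a_\lambda b]$. An unbounded vertex algebra is a (not necessarily associative) algebra $V$ with an even derivation $T$ and an unbounded $\lambda$-bracket; it is a vertex algebra if $[a_\lambda b]\in V[\lambda]$ always. An identity is a unit $1$ of the algebra with $[1_\lambda a]=[a_\lambda1]=0$. Put $a_{-1-t}b=(T^{(t)}a)b$ for $t\ge0$. A vertex algebra is associative if: (1) $[a,b]c=a(bc)-\zeta^{ab}b(ac)$ where $[a,b]=ab-\zeta^{ab}ba$; (2) $[[a_\lambda b]_\mu c]=[a_\lambda[b_{\mu-\lambda}c]]-\zeta^{ab}[b_{\mu-\lambda}[a_\lambda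 c]]$; (3) $[a_\lambda b]=-\zeta^{ab}[b_{-\lambda-T}a]$ where $[b_{-\lambda-T}a]=\sum_t(-\lambda-T)^{(t)}(b_ta)$; (4) $[a,b]=\sum_{i\ge0}(-1)^iT^{(i+1)}(a_ib)$; (5) $[a_\lambda bc]=[a_\lambda b]c+\zeta^{ab}b[a_\lambda c]+\int_0^\lambda d\mu\,[[a_\lambda b]_\mu c]$. A $\rho\mathbb Z$-grading is $V=\bigoplus V_h$ with $TV_h\subset V_{h+1}$ and $(V_h)_tV_k\subset V_{h+k-t-1}$ for all $t\in\mathbb Z$. $V$ is truncated if $V_h=0$ for $h\ll0$. Morphisms preserve degree. FZ-complete algebra: a $\rho\mathbb Z$-graded associative algebra $\mathcal A=\bigoplus\mathcal A_h$ with a topology on each $\mathcal A_h$ making it a topological vector space ($\mathbb K$ discrete) with $0$ having a neighbourhood basis of subspaces, such that multiplications $\mathcal A_h\times\mathcal A_{k}\to\mathcal A_{h+k}$ are continuous, each $\mathcal A_h$ is complete and Hausdorff, and the topology of $\mathcal A_h$ is coarser than (or equal to) the one for which the closures of $\sum_{l<k}\mathcal A_{h-l}\mathcal A_l$, $k\in\mathbb Z$, form a neighbourhood basis of $0$. Morphisms are degree-preserving, degreewise continuous unital algebra morphisms. It is an FZ-complete differential algebra if it has an even derivation $T$ with $T:\mathcal A_h\to\mathcal A_{h+1}$ continuous. Distributions: $\mathcal A[[z^\pm]]_h$ is the space of $a(z)=\sum_{t\in\mathbb Z}a_tz^{-t-1}$ with $a_t\in\mathcal A_{h-t-1}$; $\mathcal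 A[[z^\pm]]_H=\bigoplus_h\mathcal A[[z^\pm]]_h$. It is a graded unbounded vertex algebra with $T=\partial_z$, $[a(w)_\lambda b(w)]=\mathrm{res}_ze^{(z-w)\lambda}[a(z),b(w)]$ ($\mathrm{res}_z\sum c_tz^{-t-1}=c_0$), product the normal ordered product $\sum_{n<0}a_nz^{-n-1}b(z)+\zeta^{ab}\sum_{n\ge0}b(z)a_nz^{-n-1}$ (coefficients are convergent sums), and identity $1$. $\mathcal A[[z^\pm]]_{H,T}$ is the subspace of $a(z)$ with $Ta(z)=\partial_za(z)$ (coefficientwise $T$). A subset is local if for any two elements there is $n\ge0$ with $(z-w)^n[a(z),b(w)]=0$. $\langle S\rangle$ is the unital unbounded vertex subalgebra generated by $S$. Local associative algebra: an FZ-complete differential algebra $\mathcal A$ with a local subset $F_{\mathcal A}\subset\mathcal A[[z^\pm]]_{H,T}$ which is homogeneous (contains the graded components of its elements), such that the subalgebra generated by all coefficients $a_n$ of $a(z)\in F_{\mathcal A}$ is degreewise dense. A morphism $\mathcal A\to\mathcal A'$ is a morphism $\phi$ of FZ-complete algebras with $\phi F_{\mathcal A}\subset\langle F_{\mathcal A'}\rangle$. Frenkel-Zhu algebra: for a $\rho\mathbb Z$-graded associative vertex algebra $V$ there is an FZ-complete algebra $\mathcal A(V)$ with a morphism $Y:V\to\mathcal A(V)[[z^\pm]]_H$ of graded unbounded vertex algebras that is universal: every morphism $V\to\mathcal A[[z^\pm]]_H$ with $\mathcal A$ FZ-complete is $\phi\circ Y$ for a unique morphism $\phi:\mathcal A(V)\to\mathcal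 A$. Write $Y(a)=\sum a_tz^{-t-1}$. $\mathcal A(V)$ has a unique FZ-complete differential algebra structure with $T(a_t)=(Ta)_t=-t\,a_{t-1}$, and together with $F_{\mathcal A(V)}=Y(V)$ it is a local associative algebra. *)

theory Defs
  imports "HOL-Analysis.Analysis" "HOL-Library.Function_Algebras"
begin

section \<open>Graded super vector spaces\<close>

text \<open>
  Addition is that of the ambient type and the structures live on subspaces \<open>car\<close> of it, so
  that structures with different underlying spaces can be compared inside one type. Parities are
  booleans: \<open>False\<close> is even, \<open>True\<close> is odd. Degrees are rational numbers, and a grading by
  \<open>\<rho>\<int>\<close> is one whose homogeneous components vanish outside \<open>\<rho>\<int>\<close>.
\<close>

record ('k, 'a) super_space =
  scl :: "'k \<Rightarrow> 'a \<Rightarrow> 'a"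
  car :: "'a set"
  par :: "bool \<Rightarrow> 'a set"
  deg :: "rat \<Rightarrow> 'a set"

definition decomposes :: "('i \<Rightarrow> 'a::ab_group_add set) \<Rightarrow> 'a \<Rightarrow> ('i \<Rightarrow> 'a) \<Rightarrow> bool" where
  "decomposes G x c \<longleftrightarrow>
     finite {i. c i \<noteq> 0} \<and> (\<forall>i. c i \<in> G i) \<and> x = (\<Sum>i | c i \<noteq> 0. c i)"

definition component :: "('i \<Rightarrow> 'a::ab_group_add set) \<Rightarrow> 'a \<Rightarrow> 'i \<Rightarrow> 'a" where
  "component G x = (THE c. decomposes G x c)"

definition direct_sum_of ::
    "('k::field \<Rightarrow> 'a::ab_group_add \<Rightarrow> 'a) \<Rightarrow> 'a set \<Rightarrow> ('i \<Rightarrow> 'a set) \<Rightarrow> bool" where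
  "direct_sum_of s C G \<longleftrightarrow>
     (\<forall>i. module.subspace s (G i) \<and> G i \<subseteq> C) \<and> (\<forall>x\<in>C. \<exists>!c. decomposes G x c)"

definition super_subset ::
    "('k::field, 'a::ab_group_add, 'z) super_space_scheme \<Rightarrow> 'a set \<Rightarrow> bool" where
  "super_subset V S \<longleftrightarrow> S \<subseteq> car V \<and> (\<forall>x\<in>S. \<forall>p. component (par V) x p \<in> S)"

definition graded_subset ::
    "('k::field, 'a::ab_group_add, 'z) super_space_scheme \<Rightarrow> 'a set \<Rightarrow> bool" where
  "graded_subset V S \<longleftrightarrow> S \<subseteq> car V \<and> (\<forall>x\<in>S. \<forall>h. component (deg V) x h \<in> S)"

definition graded_super_space ::
    "rat \<Rightarrow> ('k::field, 'a::ab_group_add, 'z) super_space_scheme \<Rightarrow> bool" where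
  "graded_super_space \<rho> V \<longleftrightarrow>
     vector_space (scl V) \<and> module.subspace (scl V) (car V) \<and>
     direct_sum_of (scl V) (car V) (par V) \<and>
     direct_sum_of (scl V) (car V) (deg V) \<and>
     (\<forall>h. super_subset V (deg V h)) \<and>
     (\<forall>h. h \<notin> range (\<lambda>n::int. \<rho> * of_int n) \<longrightarrow> deg V h = {0})"

definition lin_map ::
    "('k::field, 'a::ab_group_add, 'z) super_space_scheme \<Rightarrow>
     ('k, 'b::ab_group_add, 'y) super_space_scheme \<Rightarrow> ('a \<Rightarrow> 'b) \<Rightarrow> bool" where
  "lin_map V W f \<longleftrightarrow>
     (\<forall>x\<in>car V. f x \<in> car W) \<and>
     (\<forall>x\<in>car V. \<forall>y\<in>car V. f (x + y) = f x + f y) \<and>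
     (\<forall>c. \<forall>x\<in>car V. f (scl V c x) = scl W c (f x))"

definition even_map ::
    "('k::field, 'a::ab_group_add, 'z) super_space_scheme \<Rightarrow>
     ('k, 'b::ab_group_add, 'y) super_space_scheme \<Rightarrow> ('a \<Rightarrow> 'b) \<Rightarrow> bool" where
  "even_map V W f \<longleftrightarrow> lin_map V W f \<and> (\<forall>p. \<forall>x\<in>par V p. f x \<in> par W p)"

definition even_bilin ::
    "('k::field, 'a::ab_group_add, 'z) super_space_scheme \<Rightarrow> ('a \<Rightarrow> 'a \<Rightarrow> 'a) \<Rightarrow> bool" where
  "even_bilin V m \<longleftrightarrow>
     (\<forall>x\<in>car V. lin_map V V (m x)) \<and> (\<forall>y\<in>car V. lin_map V V (\<lambda>x. m x y)) \<and>
     (\<forall>p q. \<forall>x\<in>par V p. \<forall>y\<in>par V q. m x y \<in> par V (p \<noteq> q))"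

definition preserves_degree ::
    "('k::field, 'a::ab_group_add, 'z) super_space_scheme \<Rightarrow>
     ('k, 'b::ab_group_add, 'y) super_space_scheme \<Rightarrow> ('a \<Rightarrow> 'b) \<Rightarrow> bool" where
  "preserves_degree V W f \<longleftrightarrow> (\<forall>h. \<forall>x\<in>deg V h. f x \<in> deg W h)"

definition koszul :: "bool \<Rightarrow> bool \<Rightarrow> 'a::ab_group_add \<Rightarrow> 'a" where
  "koszul p q x = (if p \<and> q then - x else x)"

section \<open>Algebras and vertex algebras\<close>

record ('k, 'a) super_alg = "('k, 'a) super_space" +
  mul :: "'a \<Rightarrow> 'a \<Rightarrow> 'a"
  one :: "'a"

definition is_unit ::
    "('k::field, 'a::ab_group_add, 'z) super_alg_scheme \<Rightarrow> bool" where
  "is_unit A \<longleftrightarrow> one A \<in> car A \<and> (\<forall>x\<in>car A. mul A (one A) x = x \<and> mul A x (one A) = x)"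

definition even_derivation ::
    "('k::field, 'a::ab_group_add, 'z) super_alg_scheme \<Rightarrow> ('a \<Rightarrow> 'a) \<Rightarrow> bool" where
  "even_derivation A D \<longleftrightarrow>
     even_map A A D \<and> (\<forall>x\<in>car A. \<forall>y\<in>car A. D (mul A x y) = mul A (D x) y + mul A x (D y))"

text \<open>
  The \<open>\<lambda>\<close>-bracket is given by its coefficients with respect to the divided powers of \<open>\<lambda>\<close>:
  \<open>lam V t a b\<close> is the coefficient of \<open>\<lambda>^t / t!\<close>.
\<close>

record ('k, 'a) vertex_alg = "('k, 'a) super_alg" +
  der :: "'a \<Rightarrow> 'a"
  lam :: "nat \<Rightarrow> 'a \<Rightarrow> 'a \<Rightarrow> 'a"

definition dpow ::
    "('k::field_char_0, 'a::ab_group_add, 'z) vertex_alg_scheme \<Rightarrow> nat \<Rightarrow> 'a \<Rightarrow> 'a" where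
  "dpow V t x = scl V (inverse (fact t)) ((der V ^^ t) x)"

definition nprod ::
    "('k::field_char_0, 'a::ab_group_add, 'z) vertex_alg_scheme \<Rightarrow> int \<Rightarrow> 'a \<Rightarrow> 'a \<Rightarrow> 'a" where
  "nprod V t a b = (if t \<ge> 0 then lam V (nat t) a b else mul V (dpow V (nat (- 1 - t)) a) b)"

definition graded_unbounded_vertex_algebra ::
    "rat \<Rightarrow> ('k::field_char_0, 'a::ab_group_add, 'z) vertex_alg_scheme \<Rightarrow> bool" where
  "graded_unbounded_vertex_algebra \<rho> V \<longleftrightarrow>
     graded_super_space \<rho> V \<and>
     even_bilin V (mul V) \<and> even_derivation V (der V) \<and>
     (\<forall>t. even_bilin V (lam V t)) \<and>
     (\<forall>a\<in>car V. \<forall>b\<in>car V. \<forall>t.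
        der V (lam V t a b) = lam V t (der V a) b + lam V t a (der V b)) \<and>
     (\<forall>a\<in>car V. \<forall>b\<in>car V. \<forall>t.
        lam V t (der V a) b = (if t = 0 then 0 else scl V (- of_nat t) (lam V (t - 1) a b))) \<and>
     is_unit V \<and>
     (\<forall>a\<in>car V. \<forall>t. lam V t (one V) a = 0 \<and> lam V t a (one V) = 0) \<and>
     (\<forall>h. \<forall>a\<in>deg V h. der V a \<in> deg V (h + 1)) \<and>
     (\<forall>h k t. \<forall>a\<in>deg V h. \<forall>b\<in>deg V k. nprod V t a b \<in> deg V (h + k - of_int t - 1))"

definition graded_vertex_algebra ::
    "rat \<Rightarrow> ('k::field_char_0, 'a::ab_group_add, 'z) vertex_alg_scheme \<Rightarrow> bool" where
  "graded_vertex_algebra \<rho> V \<longleftrightarrow>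
     graded_unbounded_vertex_algebra \<rho> V \<and>
     (\<forall>a\<in>car V. \<forall>b\<in>car V. \<exists>N. \<forall>t\<ge>N. lam V t a b = 0)"

definition comm_associativity ::
    "('k::field_char_0, 'a::ab_group_add, 'z) vertex_alg_scheme \<Rightarrow> bool" where
  "comm_associativity V \<longleftrightarrow>
     (\<forall>p q. \<forall>a\<in>par V p. \<forall>b\<in>par V q. \<forall>c\<in>car V.
        mul V (mul V a b - koszul p q (mul V b a)) c
        = mul V a (mul V b c) - koszul p q (mul V b (mul V a c)))"

text \<open>
  The coefficient of \<open>\<lambda>^t / t!\<close> times \<open>\<mu>^s / s!\<close> in
  \<open>[[a\<^sub>\<lambda> b]\<^sub>\<mu> c] = [a\<^sub>\<lambda> [b\<^sub>\<mu>\<^sub>-\<^sub>\<lambda> c]] - \<zeta> [b\<^sub>\<mu>\<^sub>-\<^sub>\<lambda> [a\<^sub>\<lambda> c]]\<close>.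
\<close>

definition lam_jacobi ::
    "('k::field_char_0, 'a::ab_group_add, 'z) vertex_alg_scheme \<Rightarrow> bool" where
  "lam_jacobi V \<longleftrightarrow>
     (\<forall>p q. \<forall>a\<in>par V p. \<forall>b\<in>par V q. \<forall>c\<in>car V. \<forall>t s.
        lam V s (lam V t a b) c
        = (\<Sum>i\<le>t. scl V ((- 1) ^ i * of_nat (t choose i))
             (lam V (t - i) a (lam V (s + i) b c)
              - koszul p q (lam V (s + i) b (lam V (t - i) a c)))))"

text \<open>
  The coefficient of \<open>\<lambda>^n / n!\<close> in \<open>[a\<^sub>\<lambda> b] = - \<zeta> (\<Sum>t. (-\<lambda>-T)^t / t! (b\<^sub>t a))\<close>, where
  \<open>(-\<lambda>-T)^t / t! = (-1)^t (\<Sum>n+j=t. \<lambda>^n / n! T^j / j!)\<close>.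
\<close>

definition lam_skew ::
    "('k::field_char_0, 'a::ab_group_add, 'z) vertex_alg_scheme \<Rightarrow> bool" where
  "lam_skew V \<longleftrightarrow>
     (\<forall>p q. \<forall>a\<in>par V p. \<forall>b\<in>par V q. \<forall>n.
        lam V n a b
        = - koszul p q (\<Sum>j | lam V (n + j) b a \<noteq> 0.
              scl V ((- 1) ^ (n + j)) (dpow V j (lam V (n + j) b a))))"

definition quasi_commutativity ::
    "('k::field_char_0, 'a::ab_group_add, 'z) vertex_alg_scheme \<Rightarrow> bool" where
  "quasi_commutativity V \<longleftrightarrow>
     (\<forall>p q. \<forall>a\<in>par V p. \<forall>b\<in>par V q.
        mul V a b - koszul p q (mul V b a)
        = (\<Sum>i | lam V i a b \<noteq> 0. scl V ((- 1) ^ i) (dpow V (i + 1) (lam V i a b))))"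

text \<open>
  The coefficient of \<open>\<lambda>^n / n!\<close> in the Wick formula. In the integral term the coefficient of
  \<open>\<lambda>^t / t!\<close> times \<open>\<mu>^s / s!\<close> contributes \<open>\<lambda>^t / t!\<close> times \<open>\<lambda>^(s+1) / (s+1)!\<close>, that is,
  \<open>t + s + 1\<close> over \<open>t\<close> times \<open>\<lambda>^n / n!\<close> for \<open>n = t + s + 1\<close>.
\<close>

definition wick_formula ::
    "('k::field_char_0, 'a::ab_group_add, 'z) vertex_alg_scheme \<Rightarrow> bool" where
  "wick_formula V \<longleftrightarrow>
     (\<forall>p q. \<forall>a\<in>par V p. \<forall>b\<in>par V q. \<forall>c\<in>car V. \<forall>n.
        lam V n a (mul V b c)
        = mul V (lam V n a b) c + koszul p q (mul V b (lam V n a c))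
          + (\<Sum>t<n. scl V (of_nat (n choose t)) (lam V (n - 1 - t) (lam V t a b) c)))"

definition associative_graded_vertex_algebra ::
    "rat \<Rightarrow> ('k::field_char_0, 'a::ab_group_add, 'z) vertex_alg_scheme \<Rightarrow> bool" where
  "associative_graded_vertex_algebra \<rho> V \<longleftrightarrow>
     graded_vertex_algebra \<rho> V \<and> comm_associativity V \<and> lam_jacobi V \<and> lam_skew V \<and>
     quasi_commutativity V \<and> wick_formula V"

definition truncated :: "('k::field, 'a::ab_group_add, 'z) super_space_scheme \<Rightarrow> bool" where
  "truncated V \<longleftrightarrow> (\<exists>H. \<forall>h<H. deg V h = {0})"

definition truncated_vertex_algebras ::
    "rat \<Rightarrow> ('k::field_char_0, 'a::ab_group_add) vertex_alg set" where
  "truncated_vertex_algebras \<rho> = {V. associative_graded_vertex_algebra \<rho> V \<and> truncated V}"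

text \<open>
  Morphisms are functions on the carrier; outside the carrier they are \<open>undefined\<close>, so that
  equality of morphisms is equality of functions.
\<close>

definition va_hom ::
    "('k::field_char_0, 'a::ab_group_add, 'z) vertex_alg_scheme \<Rightarrow>
     ('k, 'b::ab_group_add, 'y) vertex_alg_scheme \<Rightarrow> ('a \<Rightarrow> 'b) set" where
  "va_hom V W =
     {f \<in> extensional (car V).
        even_map V W f \<and> preserves_degree V W f \<and> f (one V) = one W \<and>
        (\<forall>a\<in>car V. f (der V a) = der W (f a)) \<and>
        (\<forall>a\<in>car V. \<forall>b\<in>car V. f (mul V a b) = mul W (f a) (f b)) \<and>
        (\<forall>a\<in>car V. \<forall>b\<in>car V. \<forall>t. f (lam V t a b) = lam W t (f a) (f b))}"

definition va_generated ::
    "('k::field_char_0, 'a::ab_group_add, 'z) vertex_alg_scheme \<Rightarrow> 'a set \<Rightarrow> 'a set" where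
  "va_generated V S =
     \<Inter> {U. S \<subseteq> U \<and> U \<subseteq> car V \<and> module.subspace (scl V) U \<and> one V \<in> U \<and>
           (\<forall>a\<in>U. der V a \<in> U) \<and>
           (\<forall>a\<in>U. \<forall>b\<in>U. mul V a b \<in> U \<and> (\<forall>t. lam V t a b \<in> U))}"

section \<open>FZ-complete algebras\<close>

record ('k, 'a) fz_alg = "('k, 'a) super_alg" +
  topo :: "rat \<Rightarrow> 'a topology"

definition graded_associative_algebra ::
    "rat \<Rightarrow> ('k::field, 'a::ab_group_add, 'z) super_alg_scheme \<Rightarrow> bool" where
  "graded_associative_algebra \<rho> A \<longleftrightarrow>
     graded_super_space \<rho> A \<and> even_bilin A (mul A) \<and> is_unit A \<and>
     (\<forall>x\<in>car A. \<forall>y\<in>car A. \<forall>z\<in>car A. mul A (mul A x y) z = mul A x (mul A y z)) \<and>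
     (\<forall>h k. \<forall>x\<in>deg A h. \<forall>y\<in>deg A k. mul A x y \<in> deg A (h + k))"

text \<open>
  Subsets of super vector spaces are understood to contain the even and odd components of their
  elements. Hence the basic neighbourhoods are required to be super subspaces.
\<close>

definition linear_topologies ::
    "('k::field, 'a::ab_group_add, 'z) fz_alg_scheme \<Rightarrow> bool" where
  "linear_topologies A \<longleftrightarrow>
     (\<forall>h. topspace (topo A h) = deg A h \<and>
        continuous_map (prod_topology (topo A h) (topo A h)) (topo A h) (\<lambda>(x, y). x + y) \<and>
        continuous_map (prod_topology (discrete_topology UNIV) (topo A h)) (topo A h)
          (\<lambda>(c, x). scl A c x) \<and>
        (\<forall>U. openin (topo A h) U \<and> 0 \<in> U \<longrightarrow>
           (\<exists>N. openin (topo A h) N \<and> N \<subseteq> U \<and> module.subspace (scl A) N \<and> super_subset A N)))"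

definition cauchy_filter ::
    "('k::field, 'a::ab_group_add, 'z) fz_alg_scheme \<Rightarrow> rat \<Rightarrow> 'a filter \<Rightarrow> bool" where
  "cauchy_filter A h F \<longleftrightarrow>
     F \<noteq> bot \<and> eventually (\<lambda>x. x \<in> deg A h) F \<and>
     (\<forall>U. openin (topo A h) U \<and> 0 \<in> U \<longrightarrow>
        eventually (\<lambda>(x, y). x - y \<in> U) (prod_filter F F))"

definition complete_degreewise ::
    "('k::field, 'a::ab_group_add, 'z) fz_alg_scheme \<Rightarrow> bool" where
  "complete_degreewise A \<longleftrightarrow>
     (\<forall>h F. cauchy_filter A h F \<longrightarrow> (\<exists>x. limitin (topo A h) (\<lambda>y. y) x F))"

text \<open>
  The last condition says that the topology of each homogeneous component is coarser than or
  equal to the one with the given neighbourhood basis of \<open>0\<close>; as both are translation invariant,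
  it suffices to compare neighbourhoods of \<open>0\<close>.
\<close>

definition fz_complete ::
    "rat \<Rightarrow> ('k::field, 'a::ab_group_add, 'z) fz_alg_scheme \<Rightarrow> bool" where
  "fz_complete \<rho> A \<longleftrightarrow>
     graded_associative_algebra \<rho> A \<and> linear_topologies A \<and>
     (\<forall>h k. continuous_map (prod_topology (topo A h) (topo A k)) (topo A (h + k))
              (\<lambda>(x, y). mul A x y)) \<and>
     complete_degreewise A \<and> (\<forall>h. Hausdorff_space (topo A h)) \<and>
     (\<forall>h U. openin (topo A h) U \<and> 0 \<in> U \<longrightarrow>
        (\<exists>k::int. topo A h closure_of
           module.span (scl A) {mul A x y | x y l. l < of_int k \<and> x \<in> deg A (h - l) \<and> y \<in> deg A l}
           \<subseteq> U))"

definition fz_hom ::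
    "('k::field, 'a::ab_group_add, 'z) fz_alg_scheme \<Rightarrow>
     ('k, 'b::ab_group_add, 'y) fz_alg_scheme \<Rightarrow> ('a \<Rightarrow> 'b) set" where
  "fz_hom A B =
     {\<phi> \<in> extensional (car A).
        even_map A B \<phi> \<and> preserves_degree A B \<phi> \<and> \<phi> (one A) = one B \<and>
        (\<forall>x\<in>car A. \<forall>y\<in>car A. \<phi> (mul A x y) = mul B (\<phi> x) (\<phi> y)) \<and>
        (\<forall>h. continuous_map (topo A h) (topo B h) \<phi>)}"

definition alg_generated ::
    "('k::field, 'a::ab_group_add, 'z) super_alg_scheme \<Rightarrow> 'a set \<Rightarrow> 'a set" where
  "alg_generated A S =
     \<Inter> {B. S \<subseteq> B \<and> B \<subseteq> car A \<and> module.subspace (scl A) B \<and> one A \<in> B \<and>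
           (\<forall>x\<in>B. \<forall>y\<in>B. mul A x y \<in> B)}"

section \<open>Distributions\<close>

text \<open>
  A distribution \<open>a(z) = (\<Sum>t. a\<^sub>t z^(-t-1))\<close> is the function \<open>t \<mapsto> a\<^sub>t\<close>.

  \<open>sopp A x y\<close> is the bilinear extension of \<open>\<zeta> y x\<close> from parity-homogeneous elements.
\<close>

definition sopp ::
    "('k::field, 'a::ab_group_add, 'z) super_alg_scheme \<Rightarrow> 'a \<Rightarrow> 'a \<Rightarrow> 'a" where
  "sopp A x y =
     (\<Sum>p\<in>UNIV. \<Sum>q\<in>UNIV.
        koszul p q (mul A (component (par A) y q) (component (par A) x p)))"

definition scomm ::
    "('k::field, 'a::ab_group_add, 'z) super_alg_scheme \<Rightarrow> 'a \<Rightarrow> 'a \<Rightarrow> 'a" where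
  "scomm A x y = mul A x y - sopp A x y"

text \<open>
  A convergent sum in \<open>A = \<Oplus>A\<^sub>h\<close>: the partial sums of the components of degree \<open>h\<close> converge in
  \<open>A\<^sub>h\<close>, for every \<open>h\<close>.
\<close>

definition fz_suminf ::
    "('k::field, 'a::ab_group_add, 'z) fz_alg_scheme \<Rightarrow> (nat \<Rightarrow> 'a) \<Rightarrow> 'a" where
  "fz_suminf A x =
     (THE l. l \<in> car A \<and>
        (\<forall>h. limitin (topo A h) (\<lambda>N. \<Sum>j<N. component (deg A) (x j) h)
               (component (deg A) l h) sequentially))"

definition homogeneous_dist ::
    "('k::field, 'a::ab_group_add, 'z) super_space_scheme \<Rightarrow> rat \<Rightarrow> (int \<Rightarrow> 'a) set" where
  "homogeneous_dist A h = {a. \<forall>t. a t \<in> deg A (h - of_int t - 1)}"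

definition dist_scl ::
    "('k::field, 'a::ab_group_add, 'z) super_space_scheme \<Rightarrow> 'k \<Rightarrow> (int \<Rightarrow> 'a) \<Rightarrow> int \<Rightarrow> 'a" where
  "dist_scl A c a = (\<lambda>t. scl A c (a t))"

definition dist_carrier ::
    "('k::field, 'a::ab_group_add, 'z) super_space_scheme \<Rightarrow> (int \<Rightarrow> 'a) set" where
  "dist_carrier A = module.span (dist_scl A) (\<Union>h. homogeneous_dist A h)"

definition normal_ordered ::
    "('k::field, 'a::ab_group_add, 'z) fz_alg_scheme \<Rightarrow> (int \<Rightarrow> 'a) \<Rightarrow> (int \<Rightarrow> 'a) \<Rightarrow> int \<Rightarrow> 'a" where
  "normal_ordered A a b =
     (\<lambda>m. fz_suminf A (\<lambda>j. mul A (a (- 1 - int j)) (b (m + int j)))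
        + fz_suminf A (\<lambda>j. sopp A (a (int j)) (b (m - 1 - int j))))"

text \<open>
  \<open>dist A\<close> is the graded unbounded vertex algebra \<open>A[[z\<^sup>\<plusminus>]]\<^sub>H\<close>. The coefficient of \<open>\<lambda>^n / n!\<close> in
  the \<open>\<lambda>\<close>-bracket is \<open>res\<^sub>z (z-w)^n [a(z), b(w)]\<close>, and \<open>dist_lam A n a b m\<close> is the coefficient of
  \<open>w^(-m-1)\<close> therein.
\<close>

definition dist_lam ::
    "('k::field, 'a::ab_group_add, 'z) super_alg_scheme \<Rightarrow> nat \<Rightarrow> (int \<Rightarrow> 'a) \<Rightarrow> (int \<Rightarrow> 'a) \<Rightarrow>
     int \<Rightarrow> 'a" where
  "dist_lam A n a b =
     (\<lambda>m. \<Sum>i\<le>n. scl A ((- 1) ^ i * of_nat (n choose i))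
             (scomm A (a (int n - int i)) (b (m + int i))))"

definition dist ::
    "('k::field, 'a::ab_group_add, 'z) fz_alg_scheme \<Rightarrow> ('k, int \<Rightarrow> 'a) vertex_alg" where
  "dist A =
     \<lparr> scl = dist_scl A,
       car = dist_carrier A,
       par = (\<lambda>p. {a \<in> dist_carrier A. \<forall>t. a t \<in> par A p}),
       deg = homogeneous_dist A,
       mul = normal_ordered A,
       one = (\<lambda>t. if t = - 1 then one A else 0),
       der = (\<lambda>a t. scl A (- of_int t) (a (t - 1))),
       lam = dist_lam A \<rparr>"

text \<open>The coefficients of \<open>z^(-r-1) w^(-m-1)\<close> in \<open>(z-w)^n [a(z), b(w)] = 0\<close>.\<close>

definition mutually_local ::
    "('k::field, 'a::ab_group_add, 'z) super_alg_scheme \<Rightarrow> (int \<Rightarrow> 'a) \<Rightarrow> (int \<Rightarrow> 'a) \<Rightarrow> bool" where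
  "mutually_local A a b \<longleftrightarrow>
     (\<exists>n::nat. \<forall>r m. (\<Sum>i\<le>n. scl A ((- 1) ^ i * of_nat (n choose i))
                        (scomm A (a (r + int n - int i)) (b (m + int i)))) = 0)"

section \<open>Local associative algebras\<close>

record ('k, 'a) local_alg = "('k, 'a) fz_alg" +
  tder :: "'a \<Rightarrow> 'a"
  flds :: "(int \<Rightarrow> 'a) set"

definition fz_complete_differential ::
    "rat \<Rightarrow> ('k::field, 'a::ab_group_add, 'z) local_alg_scheme \<Rightarrow> bool" where
  "fz_complete_differential \<rho> A \<longleftrightarrow>
     fz_complete \<rho> A \<and> even_derivation A (tder A) \<and>
     (\<forall>h. continuous_map (topo A h) (topo A (h + 1)) (tder A))"

definition invariant_dist ::
    "('k::field, 'a::ab_group_add, 'z) local_alg_scheme \<Rightarrow> (int \<Rightarrow> 'a) set" where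
  "invariant_dist A = {a \<in> car (dist A). \<forall>t. tder A (a t) = der (dist A) a t}"

definition local_algebras ::
    "rat \<Rightarrow> ('k::field_char_0, 'a::ab_group_add) local_alg set" where
  "local_algebras \<rho> =
     {A. fz_complete_differential \<rho> A \<and>
         flds A \<subseteq> invariant_dist A \<and>
         super_subset (dist A) (flds A) \<and> graded_subset (dist A) (flds A) \<and>
         (\<forall>a\<in>flds A. \<forall>b\<in>flds A. mutually_local A a b) \<and>
         (\<forall>h. topo A h closure_of
                (alg_generated A {a t | a t. a \<in> flds A} \<inter> deg A h) = deg A h)}"

definition local_hom ::
    "('k::field_char_0, 'a::ab_group_add) local_alg \<Rightarrow> ('k, 'b::ab_group_add) local_alg \<Rightarrow>
     ('a \<Rightarrow> 'b) set" where
  "local_hom A B =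
     {\<phi> \<in> fz_hom A B. \<forall>a\<in>flds A. (\<lambda>t. \<phi> (a t)) \<in> va_generated (dist B) (flds B)}"

section \<open>Frenkel-Zhu algebras\<close>

text \<open>
  \<open>A\<close> with the universal morphism \<open>Y\<close> is the Frenkel-Zhu algebra of \<open>V\<close>, viewed as a local
  associative algebra with derivation \<open>T a\<^sub>t = (T a)\<^sub>t\<close> and fields \<open>Y(V)\<close>.

  Since one cannot quantify over types inside a formula, the test algebras \<open>B\<close> range over all
  FZ-complete algebras on subspaces of the ambient type \<open>'u\<close>. This is no restriction as soon as
  \<open>'u\<close> is large enough: a morphism to distributions over \<open>B\<close> takes its values in distributions
  over the closed subalgebra generated by all coefficients, and each homogeneous component of the
  latter is a Hausdorff space with a dense subset of cardinality at most that of \<open>'k \<times> 'v\<close>.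
  Hence its cardinality is bounded by that of \<open>('k \<times> 'v) set set\<close>, and it suffices that \<open>'u\<close>
  contains a linearly independent family indexed by that type.
\<close>

definition frenkel_zhu ::
    "rat \<Rightarrow> ('k::field_char_0, 'v::ab_group_add) vertex_alg \<Rightarrow>
     ('k, 'u::ab_group_add) local_alg \<Rightarrow> ('v \<Rightarrow> int \<Rightarrow> 'u) \<Rightarrow> bool" where
  "frenkel_zhu \<rho> V A Y \<longleftrightarrow>
     A \<in> local_algebras \<rho> \<and> Y \<in> va_hom V (dist A) \<and>
     (\<forall>B :: ('k, 'u) fz_alg. fz_complete \<rho> B \<longrightarrow>
        (\<forall>y \<in> va_hom V (dist B).
           \<exists>!\<phi>. \<phi> \<in> fz_hom A B \<and> (\<forall>a\<in>car V. \<forall>t. \<phi> (Y a t) = y a t))) \<and>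
     (\<forall>a\<in>car V. \<forall>t. tder A (Y a t) = Y (der V a) t) \<and>
     flds A = Y ` car V"

definition frenkel_zhu_map ::
    "('k::field_char_0, 'v::ab_group_add) vertex_alg \<Rightarrow>
     ('k, 'u::ab_group_add) local_alg \<Rightarrow> ('v \<Rightarrow> int \<Rightarrow> 'u) \<Rightarrow>
     ('k, 'u) local_alg \<Rightarrow> ('v \<Rightarrow> int \<Rightarrow> 'u) \<Rightarrow> ('v \<Rightarrow> 'v) \<Rightarrow> 'u \<Rightarrow> 'u" where
  "frenkel_zhu_map V A Y A' Y' f =
     (THE \<phi>. \<phi> \<in> fz_hom A A' \<and> (\<forall>a\<in>car V. \<forall>t. \<phi> (Y a t) = Y' (f a) t))"

section \<open>Functors between concrete categories\<close>

text \<open>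
  A concrete category is given by its objects \<open>Ob\<close>, the underlying sets \<open>C\<close>, and hom-sets \<open>hom\<close>
  consisting of extensional functions; a functor by its object map \<open>F\<close> and morphism maps \<open>Fm\<close>.
\<close>

definition concrete_functor ::
    "'o set \<Rightarrow> ('o \<Rightarrow> 'a set) \<Rightarrow> ('o \<Rightarrow> 'o \<Rightarrow> ('a \<Rightarrow> 'a) set) \<Rightarrow>
     'p set \<Rightarrow> ('p \<Rightarrow> 'b set) \<Rightarrow> ('p \<Rightarrow> 'p \<Rightarrow> ('b \<Rightarrow> 'b) set) \<Rightarrow>
     ('o \<Rightarrow> 'p) \<Rightarrow> ('o \<Rightarrow> 'o \<Rightarrow> ('a \<Rightarrow> 'a) \<Rightarrow> 'b \<Rightarrow> 'b) \<Rightarrow> bool" where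
  "concrete_functor Ob C hom Ob' C' hom' F Fm \<longleftrightarrow>
     (\<forall>V\<in>Ob. F V \<in> Ob') \<and>
     (\<forall>V\<in>Ob. \<forall>W\<in>Ob. \<forall>f\<in>hom V W. Fm V W f \<in> hom' (F V) (F W)) \<and>
     (\<forall>V\<in>Ob. Fm V V (\<lambda>x\<in>C V. x) = (\<lambda>x\<in>C' (F V). x)) \<and>
     (\<forall>U\<in>Ob. \<forall>V\<in>Ob. \<forall>W\<in>Ob. \<forall>f\<in>hom U V. \<forall>g\<in>hom V W.
        Fm U W (compose (C U) g f) = compose (C' (F U)) (Fm V W g) (Fm U V f))"

definition fully_faithful ::
    "'o set \<Rightarrow> ('o \<Rightarrow> 'o \<Rightarrow> ('a \<Rightarrow> 'a) set) \<Rightarrow> ('p \<Rightarrow> 'p \<Rightarrow> ('b \<Rightarrow> 'b) set) \<Rightarrow>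
     ('o \<Rightarrow> 'p) \<Rightarrow> ('o \<Rightarrow> 'o \<Rightarrow> ('a \<Rightarrow> 'a) \<Rightarrow> 'b \<Rightarrow> 'b) \<Rightarrow> bool" where
  "fully_faithful Ob hom hom' F Fm \<longleftrightarrow>
     (\<forall>V\<in>Ob. \<forall>W\<in>Ob. bij_betw (Fm V W) (hom V W) (hom' (F V) (F W)))"

end

theory Submission
  imports Defs
begin

text \<open>
  Functoriality is uniqueness in the universal property. Faithfulness and fullness rest on the
  injectivity of \<open>Y : V \<rightarrow> A(V)[[z\<^sup>\<plusminus>]]\<close>. For this it suffices to find one FZ-complete algebra \<open>B\<close>
  with an injective morphism from \<open>V\<close> to its distributions. Take for \<open>B\<close> the graded endomorphisms of
  \<open>V\<close>, where the basic neighbourhoods of \<open>0\<close> consist of the endomorphisms vanishing on \<open>V\<^sub>k\<close> for all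
  \<open>k \<le> K\<close>: as \<open>V\<close> is truncated, a product \<open>f g\<close> with \<open>g\<close> of sufficiently negative degree vanishes
  there, so \<open>B\<close> is FZ-complete. The morphism sends \<open>a\<close> to the series of its modes \<open>a\<^sub>t\<close>; it is
  injective as \<open>a\<^sub>-\<^sub>1 1 = a\<close>. That it is a morphism amounts to formulas for \<open>(a\<^sub>n b)\<^sub>m\<close>, \<open>n \<ge> 0\<close>,
  and \<open>(a b)\<^sub>m\<close> for all integers \<open>m\<close>. The first is the Jacobi identity for \<open>m \<ge> 0\<close>, follows from it
  and the Wick formula by binomial inversion for \<open>m = -1\<close>, and propagates to \<open>m < -1\<close> by replacing
  \<open>b\<close> by \<open>T b\<close>. The second comes from skew symmetry and the formula for the commutator of \<open>a\<^sub>-\<^sub>1\<close>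
  and \<open>c\<^sub>m\<close>.

  For fullness, a morphism \<open>\<phi> : A(V) \<rightarrow> A(W)\<close> maps \<open>Y(V)\<close> into the vertex algebra generated by
  \<open>Y(W)\<close>, which is \<open>Y(W)\<close> itself, and it preserves normal ordered products by continuity. Hence
  \<open>Y\<^sub>W\<^sup>-\<^sup>1 \<phi> Y\<^sub>V\<close> is a morphism \<open>V \<rightarrow> W\<close> that induces \<open>\<phi>\<close>.
\<close>

section \<open>Internal direct sums\<close>

text \<open>The axioms of \<open>V\<close> concern \<open>lam\<close> and \<open>mul\<close> only,
  whereas a morphism to distributions needs identities between modes of all integer indices. The
  derivation is the bridge: replacing an argument by its \<open>T\<close>-image turns an identity at
  index m into m times, up to sign, the one at m - 1, which in characteristic 0 yields a descent
  unless m = 0. Because of this barrier the three basic formulas (modes of x_k y for k >= 0, skew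
  symmetry, commutators with x_(-1)) each need an argument for m >= 0, one at m = -1, and a descent
  below -1.

  A second obstacle is that the universal property only tests algebras inside the type
  \<open>'u\<close>, while endomorphisms are functions \<open>'v \<Rightarrow> 'v\<close>. They are
  copied into \<open>'u\<close> along a linear injection \<open>j\<close>, built from the
  independent family \<open>\<iota>\<close>.

  For fullness, membership in the image of \<open>Y\<close> is only a statement about sets. That the
  lift respects parity and degree is a separate point: an injective map that commutes with taking
  components also reflects homogeneity.\<close>

locale internal_direct_sum = vector_space s
  for s :: "'k::field \<Rightarrow> 'a::ab_group_add \<Rightarrow> 'a" +
  fixes C :: "'a set" and G :: "'i \<Rightarrow> 'a set"
  assumes subspace_C: "subspace C" and direct_sum: "direct_sum_of s C G"
begin

lemma subspace_G: "subspace (G i)" and G_subset: "G i \<subseteq> C"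
  using direct_sum by (auto simp: direct_sum_of_def)

lemma zero_G [simp]: "0 \<in> G i"
  using subspace_G subspace_0 by blast

lemma decomposes_component: "x \<in> C \<Longrightarrow> decomposes G x (component G x)"
  using direct_sum unfolding direct_sum_of_def component_def by (metis (mono_tags, lifting) theI')

lemma component_eqI: "x \<in> C \<Longrightarrow> decomposes G x c \<Longrightarrow> component G x = c"
  using direct_sum decomposes_component unfolding direct_sum_of_def by metis

lemma component_in: "x \<in> C \<Longrightarrow> component G x i \<in> G i"
  and finite_component: "x \<in> C \<Longrightarrow> finite {i. component G x i \<noteq> 0}"
  and sum_component: "x \<in> C \<Longrightarrow> (\<Sum>i | component G x i \<noteq> 0. component G x i) = x"
  using decomposes_component by (auto simp: decomposes_def)

lemma decomposesI:
  assumes "finite I" "\<And>i. i \<in> I \<Longrightarrow> c i \<in> G i" "\<And>i. i \<notin> I \<Longrightarrow> c i = 0" "x = (\<Sum>i\<in>I. c i)"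
  shows "decomposes G x c"
  unfolding decomposes_def
proof (intro conjI allI)
  have *: "{i. c i \<noteq> 0} \<subseteq> I" using assms by auto
  show "finite {i. c i \<noteq> 0}" using * assms(1) by (rule finite_subset)
  show "x = (\<Sum>i | c i \<noteq> 0. c i)"
    unfolding assms(4) by (rule sum.mono_neutral_right) (use assms * in auto)
  show "c i \<in> G i" for i using assms by (cases "i \<in> I") auto
qed

lemma sum_in_C: "(\<And>i. i \<in> I \<Longrightarrow> c i \<in> G (f i)) \<Longrightarrow> (\<Sum>i\<in>I. c i) \<in> C"
  by (rule subspace_sum[OF subspace_C]) (use G_subset in blast)

lemma component_sum_eq:
  assumes "finite I" "\<And>i. i \<in> I \<Longrightarrow> c i \<in> G i"
  shows "component G (\<Sum>i\<in>I. c i) = (\<lambda>i. if i \<in> I then c i else 0)"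
  by (rule component_eqI[OF sum_in_C[where f = "\<lambda>i. i"] decomposesI[OF assms(1)]])
    (use assms in \<open>auto intro: sum.cong\<close>)

lemma component_homogeneous: "x \<in> G i \<Longrightarrow> component G x = (\<lambda>j. if j = i then x else 0)"
  using component_sum_eq[of "{i}" "\<lambda>_. x"] by (auto simp: fun_eq_iff)

lemma component_zero: "component G 0 i = 0"
  using component_homogeneous[of 0] by (auto simp: fun_eq_iff)

lemma sum_component_superset:
  assumes "x \<in> C" "finite I" "{i. component G x i \<noteq> 0} \<subseteq> I"
  shows "(\<Sum>i\<in>I. component G x i) = x"
proof -
  have "(\<Sum>i\<in>I. component G x i) = (\<Sum>i | component G x i \<noteq> 0. component G x i)"
    by (rule sum.mono_neutral_right) (use assms in auto)
  then show ?thesis by (simp add: sum_component assms)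
qed

lemma component_add:
  assumes "x \<in> C" "y \<in> C"
  shows "component G (x + y) i = component G x i + component G y i"
proof -
  let ?I = "{i. component G x i \<noteq> 0} \<union> {i. component G y i \<noteq> 0}"
  have "finite ?I" using assms finite_component by auto
  then have "decomposes G (x + y) (\<lambda>i. component G x i + component G y i)"
    by (rule decomposesI)
      (use assms in \<open>auto simp: sum.distrib sum_component_superset finite_component component_in
        subspace_G subspace_add\<close>)
  then show ?thesis using component_eqI assms subspace_C subspace_add by metis
qed

lemma component_scale:
  assumes "x \<in> C"
  shows "component G (s c x) i = s c (component G x i)"
proof -
  have "decomposes G (s c x) (\<lambda>i. s c (component G x i))"
    by (rule decomposesI[OF finite_component[OF assms]])
      (use assms in \<open>auto simp: sum_component component_in subspace_G subspace_scale simp flip: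
        scale_sum_right\<close>)
  then show ?thesis using component_eqI assms subspace_C subspace_scale by metis
qed

lemma component_sum:
  "(\<And>i. i \<in> I \<Longrightarrow> f i \<in> C) \<Longrightarrow> component G (\<Sum>i\<in>I. f i) j = (\<Sum>i\<in>I. component G (f i) j)"
proof (induction I rule: infinite_finite_induct)
  case (insert x F)
  then show ?case by (simp add: component_add subspace_sum subspace_C)
qed (simp_all add: component_zero)

lemma eq_by_components:
  assumes "x \<in> C" "y \<in> C" "\<And>i. component G x i = component G y i"
  shows "x = y"
  using assms sum_component by (metis (no_types, lifting) Collect_cong sum.cong)

lemma in_G_by_components:
  assumes "x \<in> C" "\<And>j. j \<noteq> i \<Longrightarrow> component G x j = 0"
  shows "x \<in> G i"
proof -
  have "(\<Sum>j\<in>{i}. component G x j) = x"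
    by (rule sum_component_superset) (use assms in auto)
  then show ?thesis using component_in[OF assms(1), of i] by simp
qed

end

text \<open>The index map \<open>\<tau>\<close> accommodates maps that shift degrees, such as
  evaluation of an endomorphism at a homogeneous vector or extraction of a coefficient of a field.
  Its injectivity keeps different components of x from meeting in one component of f x.\<close>

lemma component_map:
  assumes V: "internal_direct_sum s C G" and W: "internal_direct_sum s' C' G'"
    and add: "\<And>x y. x \<in> C \<Longrightarrow> y \<in> C \<Longrightarrow> f (x + y) = f x + f y"
    and "inj \<tau>" and G: "\<And>i x. x \<in> G i \<Longrightarrow> f x \<in> G' (\<tau> i)" and x: "x \<in> C"
  shows "component G' (f x) (\<tau> i) = f (component G x i)"
proof -
  interpret V: internal_direct_sum s C G by fact
  interpret W: internal_direct_sum s' C' G' by fact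
  have zero: "f 0 = 0" using add[of 0 0] V.subspace_C V.subspace_0 by simp
  have sum: "f (\<Sum>i\<in>I. c i) = (\<Sum>i\<in>I. f (c i))" if "finite I" "\<And>i. i \<in> I \<Longrightarrow> c i \<in> C" for I and c :: "_ \<Rightarrow> 'b"
    using that by (induction I) (simp_all add: zero add V.subspace_sum V.subspace_C)
  let ?I = "{i. component G x i \<noteq> 0}"
  have "f x = f (\<Sum>i\<in>?I. component G x i)"
    by (simp only: V.sum_component[OF x])
  also have "\<dots> = (\<Sum>i\<in>?I. f (component G x i))"
    by (rule sum[OF V.finite_component[OF x]]) (use V.component_in[OF x] V.G_subset in blast)
  also have "\<dots> = (\<Sum>j\<in>\<tau> ` ?I. f (component G x (inv \<tau> j)))"
    using \<open>inj \<tau>\<close> by (subst sum.reindex) (auto simp: inj_on_def)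
  finally have fx: "f x = (\<Sum>j\<in>\<tau> ` ?I. f (component G x (inv \<tau> j)))" .
  have "f (component G x (inv \<tau> j)) \<in> G' j" if "j \<in> \<tau> ` ?I" for j
    using that G[OF V.component_in[OF x]] \<open>inj \<tau>\<close> by auto
  then have "component G' (f x) = (\<lambda>j. if j \<in> \<tau> ` ?I then f (component G x (inv \<tau> j)) else 0)"
    unfolding fx by (intro W.component_sum_eq finite_imageI V.finite_component[OF x])
  then show ?thesis
    using \<open>inj \<tau>\<close> zero by (auto simp: inj_image_mem_iff)
qed

text \<open>Uniqueness of a decomposition reduces to independence of the pieces: subtract two
  decompositions over the union of their supports.\<close>

lemma internal_direct_sumI:
  assumes "vector_space s" and C: "module.subspace s C"
    and G: "\<And>i. module.subspace s (G i)" "\<And>i. G i \<subseteq> C"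
    and ex: "\<And>x. x \<in> C \<Longrightarrow> \<exists>c. decomposes G x c"
    and indep: "\<And>I c i. finite I \<Longrightarrow> (\<And>i. i \<in> I \<Longrightarrow> c i \<in> G i) \<Longrightarrow> (\<Sum>i\<in>I. c i) = 0 \<Longrightarrow> i \<in> I \<Longrightarrow> c i = 0"
  shows "internal_direct_sum s C G"
proof -
  interpret vector_space s by fact
  have "c = d" if c: "decomposes G x c" and d: "decomposes G x d" for x c d
  proof
    fix i
    let ?I = "{i. c i \<noteq> 0} \<union> {i. d i \<noteq> 0}"
    have fin: "finite ?I" using c d by (auto simp: decomposes_def)
    have sums: "(\<Sum>i\<in>?I. c i) = x" "(\<Sum>i\<in>?I. d i) = x"
    proof -
      have "(\<Sum>i\<in>?I. c i) = (\<Sum>i | c i \<noteq> 0. c i)" "(\<Sum>i\<in>?I. d i) = (\<Sum>i | d i \<noteq> 0. d i)"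
        by (rule sum.mono_neutral_right[OF fin]; auto)+
      then show "(\<Sum>i\<in>?I. c i) = x" "(\<Sum>i\<in>?I. d i) = x" using c d by (auto simp: decomposes_def)
    qed
    show "c i = d i"
    proof (cases "i \<in> ?I")
      case True
      have "c i - d i = 0"
        by (rule indep[OF fin _ _ True])
          (use c d in \<open>simp_all add: decomposes_def sum_subtractf subspace_diff G sums\<close>)
      then show ?thesis by simp
    qed auto
  qed
  then show ?thesis
    by unfold_locales (use C G ex in \<open>auto simp: direct_sum_of_def\<close>)
qed

section \<open>Consequences of the axioms of an associative vertex algebra\<close>

text \<open>The same formula as \<open>dpow\<close>, but for a bare operator: the locale below has
  no vertex algebra record at hand.\<close>

definition divpow :: "('k::field_char_0 \<Rightarrow> 'v \<Rightarrow> 'v) \<Rightarrow> ('v \<Rightarrow> 'v) \<Rightarrow> nat \<Rightarrow> 'v \<Rightarrow> 'v" where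
  "divpow s T j x = s (inverse (fact j)) ((T ^^ j) x)"

definition koszul_sign :: "bool \<Rightarrow> bool \<Rightarrow> 'k::field" where
  "koszul_sign p q = (if p \<and> q then - 1 else 1)"

text \<open>The axioms of an associative vertex algebra with total operations on the ambient type,
  so that the calculus runs without carrier conditions. \<open>P n\<close> is the n-th product for
  every integer n, with \<open>P (- 1)\<close> the multiplication. Sums over j < N replace the sums
  over supports in the axioms; any N beyond which the terms vanish is admissible.\<close>

locale vertex_products = vector_space s
  for s :: "'k::field_char_0 \<Rightarrow> 'v::ab_group_add \<Rightarrow> 'v" +
  fixes T :: "'v \<Rightarrow> 'v" and P :: "int \<Rightarrow> 'v \<Rightarrow> 'v \<Rightarrow> 'v" and par :: "bool \<Rightarrow> 'v set"
  assumes T_add: "T (x + y) = T x + T y" and T_scale: "T (s c x) = s c (T x)"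
    and P_add_left: "P n (x + x') y = P n x y + P n x' y"
    and P_add_right: "P n x (y + y') = P n x y + P n x y'"
    and P_scale_left: "P n (s c x) y = s c (P n x y)"
    and P_scale_right: "P n x (s c y) = s c (P n x y)"
    and P_neg: "P (- 1 - int t) x y = P (- 1) (divpow s T t x) y"
    and T_P_nonneg: "T (P (int t) x y) = P (int t) (T x) y + P (int t) x (T y)"
    and T_P_minus_one: "T (P (- 1) x y) = P (- 1) (T x) y + P (- 1) x (T y)"
    and P_T_nonneg: "P (int t) (T x) y = s (- of_nat t) (P (int t - 1) x y)"
    and bounded: "\<exists>N. \<forall>t\<ge>N. P (int t) x y = 0"
    and par_T: "x \<in> par p \<Longrightarrow> T x \<in> par p"
    and par_P: "x \<in> par p \<Longrightarrow> y \<in> par q \<Longrightarrow> P n x y \<in> par (p \<noteq> q)"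
    and comm: "x \<in> par p \<Longrightarrow> y \<in> par q \<Longrightarrow>
      P (- 1) (P (- 1) x y - s (koszul_sign p q) (P (- 1) y x)) z
      = P (- 1) x (P (- 1) y z) - s (koszul_sign p q) (P (- 1) y (P (- 1) x z))"
    and jacobi: "x \<in> par p \<Longrightarrow> y \<in> par q \<Longrightarrow>
      P (int l) (P (int k) x y) z
      = (\<Sum>i\<le>k. s ((- 1) ^ i * of_nat (k choose i))
           (P (int (k - i)) x (P (int (l + i)) y z)
            - s (koszul_sign p q) (P (int (l + i)) y (P (int (k - i)) x z))))"
    and skew_nonneg: "x \<in> par p \<Longrightarrow> y \<in> par q \<Longrightarrow> \<forall>j\<ge>N. P (int (k + j)) y x = 0 \<Longrightarrow>
      P (int k) x y = - s (koszul_sign p q) (\<Sum>j<N. s ((- 1) ^ (k + j)) (divpow s T j (P (int (k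
        + j)) y x)))"
    and quasi_comm: "x \<in> par p \<Longrightarrow> y \<in> par q \<Longrightarrow> \<forall>j\<ge>N. P (int j) x y = 0 \<Longrightarrow>
      P (- 1) x y - s (koszul_sign p q) (P (- 1) y x) = (\<Sum>j<N. s ((- 1) ^ j) (divpow s T (j
        + 1) (P (int j) x y)))"
    and wick: "x \<in> par p \<Longrightarrow> y \<in> par q \<Longrightarrow>
      P (int k) x (P (- 1) y z)
      = P (- 1) (P (int k) x y) z + s (koszul_sign p q) (P (- 1) y (P (int k) x z))
        + (\<Sum>t<k. s (of_nat (k choose t)) (P (int (k - 1 - t)) (P (int t) x y) z))"
begin

section \<open>Linearity, and the behaviour of the products under the derivation\<close>

abbreviation D :: "nat \<Rightarrow> 'v \<Rightarrow> 'v" where "D \<equiv> divpow s T"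

abbreviation \<kappa> :: "bool \<Rightarrow> bool \<Rightarrow> 'k" where "\<kappa> \<equiv> koszul_sign"

lemma kappa_square [simp]: "\<kappa> p q * \<kappa> p q = 1" "\<kappa> p q * (\<kappa> p q * c) = c"
  by (auto simp: koszul_sign_def)

lemma kappa_commute: "\<kappa> p q = \<kappa> q p"
  by (auto simp: koszul_sign_def)

lemma kappa_nonzero [simp]: "\<kappa> p q \<noteq> 0"
  by (simp add: koszul_sign_def)

lemma kappa_xor:
  "\<kappa> (p = (\<not> q)) r = \<kappa> p r * \<kappa> q r" "\<kappa> r (p = (\<not> q)) = \<kappa> r p * \<kappa> r q"
  by (auto simp: koszul_sign_def)

lemma P_zero [simp]: "P n 0 y = 0" "P n x 0 = 0"
  using P_scale_left[of n 0 0 y] P_scale_right[of n x 0 0] by simp_all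

lemma T_zero [simp]: "T 0 = 0"
  using T_scale[of 0 0] by simp

lemma P_diff_left: "P n (x - x') y = P n x y - P n x' y"
  by (metis P_add_left add_diff_cancel_right' diff_add_cancel)

lemma P_diff_right: "P n x (y - y') = P n x y - P n x y'"
  by (metis P_add_right add_diff_cancel_right' diff_add_cancel)

lemma P_minus [simp]: "P n (- x) y = - P n x y" "P n x (- y) = - P n x y"
  using P_diff_left[of n 0 x y] P_diff_right[of n x 0 y] by simp_all

lemma P_sum_left: "P n (\<Sum>i\<in>I. f i) y = (\<Sum>i\<in>I. P n (f i) y)"
  by (induction I rule: infinite_finite_induct) (simp_all add: P_add_left)

lemma P_sum_right: "P n x (\<Sum>i\<in>I. f i) = (\<Sum>i\<in>I. P n x (f i))"
  by (induction I rule: infinite_finite_induct) (simp_all add: P_add_right)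

lemma D_0 [simp]: "D 0 x = x"
  by (simp add: divpow_def)

lemma T_pow_add: "(T ^^ j) (x + y) = (T ^^ j) x + (T ^^ j) y"
  by (induction j) (simp_all add: T_add)

lemma T_pow_scale: "(T ^^ j) (s c x) = s c ((T ^^ j) x)"
  by (induction j) (simp_all add: T_scale)

lemma D_add: "D j (x + y) = D j x + D j y"
  by (simp add: divpow_def T_pow_add scale_right_distrib)

lemma D_scale: "D j (s c x) = s c (D j x)"
  by (simp add: divpow_def T_pow_scale mult.commute)

lemma D_zero [simp]: "D j 0 = 0"
  using D_scale[of j 0 0] by simp

lemma D_diff: "D j (x - y) = D j x - D j y"
  by (metis D_add add_diff_cancel_right' diff_add_cancel)

lemma D_sum: "D j (\<Sum>i\<in>I. f i) = (\<Sum>i\<in>I. D j (f i))"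
  by (induction I rule: infinite_finite_induct) (simp_all add: D_add)

lemma T_D: "T (D j x) = s (of_nat (Suc j)) (D (Suc j) x)"
  by (simp add: divpow_def T_scale field_simps del: of_nat_Suc)

lemma D_T: "D j (T x) = s (of_nat (Suc j)) (D (Suc j) x)"
  by (simp add: divpow_def funpow_swap1 field_simps del: of_nat_Suc)

lemma P_D_minus_one: "P (- 1) (D t x) y = P (- 1 - int t) x y"
  by (simp add: P_neg)

text \<open>Sesquilinearity of the bracket and the definition of negative products merge into one
  rule: for n = -1 - t the factor t + 1 of \<open>D_T\<close> is -n. All descents in the index rest
  on this rule.\<close>

lemma P_T: "P n (T x) y = s (- of_int n) (P (n - 1) x y)"
proof (cases "n \<ge> 0")
  case True
  then show ?thesis using P_T_nonneg[of "nat n" x y] by simp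
next
  case False
  define t where "t = nat (- 1 - n)"
  have t: "n = - 1 - int t" using False by (simp add: t_def)
  have "P n (T x) y = P (- 1) (D t (T x)) y" by (simp add: t P_neg)
  also have "\<dots> = s (of_nat (Suc t)) (P (- 1 - int (Suc t)) x y)"
    by (simp only: D_T P_scale_left P_neg)
  also have "\<dots> = s (- of_int n) (P (n - 1) x y)"
    by (simp add: t algebra_simps)
  finally show ?thesis .
qed

lemma T_P: "T (P n x y) = P n (T x) y + P n x (T y)"
proof (cases "n \<ge> 0")
  case True
  then show ?thesis using T_P_nonneg[of "nat n" x y] by simp
next
  case False
  define t where "t = nat (- 1 - n)"
  have t: "n = - 1 - int t" using False by (simp add: t_def)
  show ?thesis
    by (simp add: t P_neg T_P_minus_one T_D D_T)
qed

lemma P_right_T: "P n x (T y) = T (P n x y) + s (of_int n) (P (n - 1) x y)"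
  by (simp add: T_P P_T)

lemma T_sum: "T (\<Sum>i\<in>I. f i) = (\<Sum>i\<in>I. T (f i))"
  by (induction I rule: infinite_finite_induct) (simp_all add: T_add)

lemma D_P: "D j (P n x y) = (\<Sum>i\<le>j. P n (D i x) (D (j - i) y))"
proof (induction j)
  case 0
  then show ?case by simp
next
  case (Suc j)
  \<comment> \<open>The identity is shown after multiplication by j + 1, which is cancelled at the
    end. The two Leibniz terms carry the weights i and j + 1 - i.\<close>
  have "s (of_nat (Suc j)) (D (Suc j) (P n x y)) = T (D j (P n x y))"
    by (simp only: T_D)
  also have "\<dots> = (\<Sum>i\<le>j. P n (T (D i x)) (D (j - i) y)) + (\<Sum>i\<le>j. P n (D i x) (T (D (j - i) y)))"
    by (simp add: Suc T_sum T_P sum.distrib)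
  also have "(\<Sum>i\<le>j. P n (T (D i x)) (D (j - i) y))
      = (\<Sum>i\<le>Suc j. s (of_nat i) (P n (D i x) (D (Suc j - i) y)))"
    by (subst sum.atMost_Suc_shift) (simp add: T_D P_scale_left del: of_nat_Suc)
  also have "(\<Sum>i\<le>j. P n (D i x) (T (D (j - i) y)))
      = (\<Sum>i\<le>Suc j. s (of_nat (Suc j - i)) (P n (D i x) (D (Suc j - i) y)))"
    by (simp add: T_D P_scale_right P_add_right P_diff_right Suc_diff_le algebra_simps)
  also have "(\<Sum>i\<le>Suc j. s (of_nat i) (P n (D i x) (D (Suc j - i) y))) + \<dots>
     = (\<Sum>i\<le>Suc j. s (of_nat (Suc j)) (P n (D i x) (D (Suc j - i) y)))"
    unfolding sum.distrib[symmetric]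
  proof (rule sum.cong[OF refl])
    fix i assume "i \<in> {..Suc j}"
    then have "of_nat i + of_nat (Suc j - i) = (of_nat (Suc j) :: 'k)"
      by (metis atMost_iff le_add_diff_inverse of_nat_add)
    then show "s (of_nat i) (P n (D i x) (D (Suc j - i) y))
      + s (of_nat (Suc j - i)) (P n (D i x) (D (Suc j - i) y))
      = s (of_nat (Suc j)) (P n (D i x) (D (Suc j - i) y))"
      by (metis scale_left_distrib)
  qed
  also have "\<dots> = s (of_nat (Suc j)) (\<Sum>i\<le>Suc j. P n (D i x) (D (Suc j - i) y))"
    by (simp only: scale_sum_right)
  finally show ?case
    by (metis of_nat_eq_0_iff old.nat.distinct(2) scale_cancel_left)
qed

text \<open>Iterating \<open>P_T\<close> gives the factors -n, -(n - 1), ..., which together with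
  1/j! form a signed generalized binomial coefficient.\<close>

lemma P_D: "P n (D j x) y = s ((- 1) ^ j * (of_int n gchoose j)) (P (n - int j) x y)"
proof (induction j arbitrary: n)
  case 0
  then show ?case by simp
next
  case (Suc j)
  have "s (of_nat (Suc j)) (P n (D (Suc j) x) y) = P n (T (D j x)) y"
    by (simp only: T_D P_scale_left)
  also have "\<dots> = s (- of_int n * ((- 1) ^ j * (of_int (n - 1) gchoose j))) (P (n - int (Suc j)) x y)"
    by (simp add: P_T Suc algebra_simps)
  also have "- of_int n * ((- 1) ^ j * (of_int (n - 1) gchoose j))
      = of_nat (Suc j) * ((- 1) ^ Suc j * ((of_int n :: 'k) gchoose Suc j))"
    using gbinomial_absorption[of j "of_int n :: 'k"] by (simp del: of_nat_Suc)
  also have "s \<dots> (P (n - int (Suc j)) x y) = s (of_nat (Suc j))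
     (s ((- 1) ^ Suc j * (of_int n gchoose Suc j)) (P (n - int (Suc j)) x y))"
    by (simp only: scale_scale)
  finally show ?case
    by (metis of_nat_eq_0_iff old.nat.distinct(2) scale_cancel_left)
qed


section \<open>The supercommutator of two modes (\<open>bracket\<close>, with \<open>e\<close> the
  Koszul sign) and the modes of x_k y for k >= 0\<close>

definition bracket :: "'k \<Rightarrow> int \<Rightarrow> 'v \<Rightarrow> int \<Rightarrow> 'v \<Rightarrow> 'v \<Rightarrow> 'v" where
  "bracket e m x n y z = P m x (P n y z) - s e (P n y (P m x z))"

text \<open>Pascal's matrix and its signed version are inverse to each other: pulling out
  \<open>k choose u\<close> leaves the alternating sum of a row of binomial coefficients.\<close>

lemma alternating_choose_choose:
  assumes "u \<le> k"
  shows "(\<Sum>t\<le>k. of_nat (k choose t) * ((- 1) ^ (t - u) * of_nat (t choose u)))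
    = (if u = k then 1 else 0 :: 'k)"
    (is "(\<Sum>t\<le>k. ?f t) = _")
proof -
  have "(\<Sum>t\<le>k. ?f t) = (\<Sum>t\<in>{u..k}. ?f t)"
    by (rule sum.mono_neutral_right) (auto simp: not_le)
  also have "\<dots> = (\<Sum>t\<in>{u..k}. of_nat (k choose u) * ((- 1) ^ (t - u) * of_nat ((k - u) choose (t - u))))"
    by (rule sum.cong[OF refl])
      (metis (no_types, opaque_lifting) atLeastAtMost_iff choose_mult mult.left_commute of_nat_mult)
  also have "\<dots> = (\<Sum>i\<le>k - u. of_nat (k choose u) * ((- 1) ^ i * of_nat ((k - u) choose i)))"
    by (rule sum.reindex_bij_witness[of _ "\<lambda>i. i + u" "\<lambda>t. t - u"]) (use assms in auto)
  also have "\<dots> = of_nat (k choose u) * (\<Sum>i\<le>k - u. (- 1) ^ i * of_nat ((k - u) choose i))"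
    by (simp add: sum_distrib_left)
  also have "\<dots> = (if u = k then 1 else 0)"
    using assms choose_alternating_sum[of "k - u", where 'a = 'k] by auto
  finally show ?thesis .
qed

lemma binomial_inversion:
  "(\<Sum>t\<le>k. s (of_nat (k choose t)) (\<Sum>u\<le>t. s ((- 1) ^ (t - u) * of_nat (t choose u)) (B u))) = B k"
proof -
  have "(\<Sum>t\<le>k. s (of_nat (k choose t)) (\<Sum>u\<le>t. s ((- 1) ^ (t - u) * of_nat (t choose u)) (B u)))
    = (\<Sum>t\<le>k. s (of_nat (k choose t)) (\<Sum>u\<le>k. s ((- 1) ^ (t - u) * of_nat (t choose u)) (B u)))"
    by (intro sum.cong refl arg_cong[where f = "s _"] sum.mono_neutral_left) (auto simp: not_le)
  also have "\<dots> = (\<Sum>u\<le>k. \<Sum>t\<le>k. s (of_nat (k choose t) * ((- 1) ^ (t - u) * of_nat (t choose u))) (B u))"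
    by (simp add: scale_sum_right) (rule sum.swap)
  also have "\<dots> = (\<Sum>u\<le>k. s (if u = k then 1 else 0) (B u))"
    by (intro sum.cong refl) (simp only: scale_sum_left[symmetric] alternating_choose_choose atMost_iff)
  also have "\<dots> = B k"
    by (subst sum.remove[of _ k]) (auto intro: sum.neutral)
  finally show ?thesis .
qed

lemma reverse_binomial_sum:
  "(\<Sum>i\<le>k. s ((- 1) ^ i * of_nat (k choose i)) (B (k - i)))
    = (\<Sum>u\<le>k. s ((- 1) ^ (k - u) * of_nat (k choose u)) (B u))"
  by (rule sum.reindex_bij_witness[of _ "\<lambda>u. k - u" "\<lambda>i. k - i"])
    (auto simp: binomial_symmetric[symmetric])

text \<open>Let B u = [x_u, y_(k-1-u)] z, and let R t be its alternating binomial sum over u <= t.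
  The Jacobi identity evaluates (x_t y)_(k-1-t) z as R t for t < k. The Wick formula writes B k as
  the sum of (k choose t) R t over t < k plus the unknown (x_k y)_(-1) z; binomial inversion writes
  B k as the same sum over t <= k. Hence the unknown is R k.\<close>

lemma iterate_minus_one:
  assumes x: "x \<in> par p" and y: "y \<in> par q"
  shows "P (- 1) (P (int k) x y) z
    = (\<Sum>i\<le>k. s ((- 1) ^ i * of_nat (k choose i))
         (bracket (\<kappa> p q) (int k - int i) x (- 1 + int i) y z))"
proof -
  define B where "B u = bracket (\<kappa> p q) (int u) x (int k - 1 - int u) y z" for u
  define R where "R t = (\<Sum>u\<le>t. s ((- 1) ^ (t - u) * of_nat (t choose u)) (B u))" for t
  have "P (int (k - 1 - t)) (P (int t) x y) z = R t" if "t < k" for t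
  proof -
    have "P (int (k - 1 - t)) (P (int t) x y) z
      = (\<Sum>i\<le>t. s ((- 1) ^ i * of_nat (t choose i)) (B (t - i)))"
      unfolding jacobi[OF x y] B_def bracket_def using that
      by (intro sum.cong refl) (auto simp: of_nat_diff algebra_simps)
    then show ?thesis by (simp only: reverse_binomial_sum R_def)
  qed
  then have "bracket (\<kappa> p q) (int k) x (- 1) y z
      = P (- 1) (P (int k) x y) z + (\<Sum>t<k. s (of_nat (k choose t)) (R t))"
    by (simp add: bracket_def wick[OF x y])
  moreover have "(\<Sum>t\<le>k. s (of_nat (k choose t)) (R t)) = B k"
    unfolding R_def by (rule binomial_inversion)
  moreover have "B k = bracket (\<kappa> p q) (int k) x (- 1) y z"
    by (simp add: B_def)
  ultimately have "P (- 1) (P (int k) x y) z = R k"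
    by (simp add: lessThan_Suc_atMost[symmetric])
  also have "\<dots> = (\<Sum>i\<le>k. s ((- 1) ^ i * of_nat (k choose i)) (B (k - i)))"
    by (simp only: reverse_binomial_sum R_def)
  also have "\<dots> = (\<Sum>i\<le>k. s ((- 1) ^ i * of_nat (k choose i))
         (bracket (\<kappa> p q) (int k - int i) x (- 1 + int i) y z))"
    unfolding B_def by (intro sum.cong refl) (auto simp: of_nat_diff)
  finally show ?thesis .
qed

lemma bracket_T_right: "bracket e m x n (T y) z = s (- of_int n) (bracket e m x (n - 1) y z)"
  by (simp add: bracket_def P_T P_scale_right scale_right_diff_distrib mult.commute)

text \<open>Insert T y for y. As x_k (T y) = T (x_k y) + k x_(k-1) y, the left side becomes -m (x_k
  y)_(m-1) z plus k (x_(k-1) y)_m z. The latter is known from the hypothesis at k - 1 and accounts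
  for the part -i of the coefficients -(m + i) on the right.\<close>

lemma iterate_step:
  assumes hyp: "\<And>k y. y \<in> par q \<Longrightarrow> P m (P (int k) x y) z
      = (\<Sum>i\<le>k. s ((- 1) ^ i * of_nat (k choose i)) (bracket e (int k - int i) x (m + int i) y z))"
    and "m \<noteq> 0" and y: "y \<in> par q"
  shows "P (m - 1) (P (int k) x y) z
      = (\<Sum>i\<le>k. s ((- 1) ^ i * of_nat (k choose i)) (bracket e (int k - int i) x (m - 1 + int i) y z))"
    (is "_ = ?R")
proof -
  define G where "G i = bracket e (int k - int i) x (m - 1 + int i) y z" for i
  have low: "s (of_nat k) (P m (P (int k - 1) x y) z)
      = (\<Sum>i\<le>k. s (- (of_nat i) * ((- 1) ^ i * of_nat (k choose i))) (G i))"
  \<comment> \<open>For k = 0 the product of index -1 on the left is multiplied by 0.\<close>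
  proof (cases k)
    case (Suc l)
    have "s (of_nat k) (P m (P (int k - 1) x y) z)
      = (\<Sum>i\<le>l. s (of_nat (Suc l) * ((- 1) ^ i * of_nat (l choose i))) (G (Suc i)))"
      using hyp[OF y, of l] by (simp add: Suc scale_sum_right G_def algebra_simps)
    also have "\<dots> = (\<Sum>i\<le>l. s (- of_nat (Suc i) * ((- 1) ^ Suc i * of_nat (Suc l choose Suc i))) (G
      (Suc i)))"
    proof (intro sum.cong refl arg_cong2[where f = s])
      fix i
      have "of_nat (Suc i) * of_nat (Suc l choose Suc i) = (of_nat (Suc l) * of_nat (l choose i) :: 'k)"
        by (metis Suc_times_binomial_eq mult.commute of_nat_mult)
      then show "of_nat (Suc l) * ((- 1) ^ i * of_nat (l choose i))
        = - of_nat (Suc i) * ((- 1) ^ Suc i * of_nat (Suc l choose Suc i) :: 'k)"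
        by (simp add: algebra_simps del: of_nat_Suc binomial_Suc_Suc)
    qed
    also have "\<dots> = (\<Sum>i\<le>k. s (- (of_nat i) * ((- 1) ^ i * of_nat (k choose i))) (G i))"
      unfolding Suc by (subst sum.atMost_Suc_shift) simp
    finally show ?thesis .
  qed simp
  have "s (- of_int m) (P (m - 1) (P (int k) x y) z) + s (of_nat k) (P m (P (int k - 1) x y) z)
      = P m (P (int k) x (T y)) z"
    by (simp add: P_right_T P_add_left P_scale_left P_T)
  also have "\<dots> = (\<Sum>i\<le>k. s ((- 1) ^ i * of_nat (k choose i) * - of_int (m + int i)) (G i))"
    unfolding hyp[OF par_T[OF y]] bracket_T_right G_def
    by (simp add: algebra_simps)
  also have "\<dots> = (\<Sum>i\<le>k. s (- of_int m * ((- 1) ^ i * of_nat (k choose i))) (G i))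
      + (\<Sum>i\<le>k. s (- (of_nat i) * ((- 1) ^ i * of_nat (k choose i))) (G i))"
    unfolding sum.distrib[symmetric] scale_left_distrib[symmetric]
    by (intro sum.cong refl arg_cong2[where f = s]) (simp add: algebra_simps)
  finally have "s (- of_int m) (P (m - 1) (P (int k) x y) z)
      = (\<Sum>i\<le>k. s (- of_int m * ((- 1) ^ i * of_nat (k choose i))) (G i))"
    by (simp add: low)
  also have "\<dots> = s (- of_int m) ?R"
    by (simp add: scale_sum_right G_def)
  finally show ?thesis
    using \<open>m \<noteq> 0\<close> by simp
qed

lemma iterate_nonneg:
  assumes x: "x \<in> par p" and y: "y \<in> par q"
  shows "P m (P (int k) x y) z
    = (\<Sum>i\<le>k. s ((- 1) ^ i * of_nat (k choose i)) (bracket (\<kappa> p q) (int k - int i) x (m + int i) y z))"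
proof (cases "m \<ge> 0")
  case True
  then obtain l where "m = int l" using nonneg_int_cases by blast
  then show ?thesis
    using jacobi[OF x y, of l k z] by (simp add: bracket_def of_nat_diff)
next
  case False
  then have "m \<le> - 1" by simp
  then show ?thesis using y
  proof (induction m arbitrary: y k rule: int_le_induct)
    case base
    then show ?case by (rule iterate_minus_one[OF x])
  next
    case (step m)
    show ?case
      by (rule iterate_step[where q = q]) (use step in auto)
  qed
qed

section \<open>Skew symmetry at all integer indices\<close>

definition sg :: "int \<Rightarrow> 'k" where
  "sg m = (if even m then 1 else - 1)"

lemma sg_of_nat: "sg (int j) = (- 1) ^ j"
  by (simp add: sg_def minus_one_power_iff)

lemma sg_add: "sg (m + n) = sg m * sg n"
  by (simp add: sg_def)

lemma sg_simps [simp]: "sg 0 = 1" "sg 1 = - 1" "sg (- m) = sg m" "sg m * sg m = 1"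
  by (simp_all add: sg_def)

lemma sg_diff: "sg (m - n) = sg m * sg n"
  by (simp add: sg_def)

text \<open>Quasi-commutativity is skew symmetry at index -1: the summand j = 0 is the product in
  the opposite order, and the summand j + 1 is the term of the j-th product.\<close>

lemma skew_minus_one:
  assumes x: "x \<in> par p" and y: "y \<in> par q" and N: "\<forall>j\<ge>N. P (- 1 + int j) y x = 0"
  shows "P (- 1) x y = s (- \<kappa> p q) (\<Sum>j<N. s (sg (- 1 + int j)) (D j (P (- 1 + int j) y x)))"
proof -
  show ?thesis
  proof (cases N)
    \<comment> \<open>Here the vanishing assumption includes y_(-1) x = 0, which is why the empty
      sum is the right value.\<close>
    case 0
    have "\<forall>j\<ge>0. P (int j) y x = 0"
      using N 0 by (metis add_diff_cancel_left' le0 of_nat_Suc uminus_add_conv_diff)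
    with quasi_comm[OF y x this] have "P (- 1) y x = s (\<kappa> p q) (P (- 1) x y)"
      by (simp add: kappa_commute[of p q])
    moreover have "P (- 1) y x = 0"
      using N 0 by (metis add.right_neutral le0 of_nat_0)
    ultimately have "s (\<kappa> p q) (s (\<kappa> p q) (P (- 1) x y)) = 0" by simp
    then show ?thesis using 0 by simp
  next
    case (Suc M)
    have M: "\<forall>j\<ge>M. P (int j) y x = 0"
      using N Suc by (metis Suc_le_mono add_diff_cancel_left' of_nat_Suc uminus_add_conv_diff)
    have "s (\<kappa> p q) (P (- 1) y x - s (\<kappa> p q) (P (- 1) x y))
      = s (\<kappa> p q) (\<Sum>j<M. s ((- 1) ^ j) (D (Suc j) (P (int j) y x)))"
      using quasi_comm[OF y x M] by (simp add: kappa_commute[of p q])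
    then have "P (- 1) x y = s (\<kappa> p q) (P (- 1) y x)
        - s (\<kappa> p q) (\<Sum>j<M. s ((- 1) ^ j) (D (Suc j) (P (int j) y x)))"
      by (simp add: scale_right_diff_distrib algebra_simps)
    also have "(\<Sum>j<M. s ((- 1) ^ j) (D (Suc j) (P (int j) y x)))
        = (\<Sum>j<M. s (sg (- 1 + int (Suc j))) (D (Suc j) (P (- 1 + int (Suc j)) y x)))"
      by (simp add: sg_of_nat)
    also have "s (\<kappa> p q) (P (- 1) y x) - s (\<kappa> p q) \<dots>
        = s (- \<kappa> p q) (\<Sum>j<N. s (sg (- 1 + int j)) (D j (P (- 1 + int j) y x)))"
      unfolding Suc sum.lessThan_Suc_shift by (simp add: scale_right_diff_distrib)
    finally show ?thesis .
  qed
qed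

text \<open>Insert T x for x: the left side becomes -m x_(m-1) y, and y_(m+j) (T x) splits into T
  (y_(m+j) x) and a multiple of y_(m+j-1) x. Once the index of the first part is shifted, the
  weights j and -(m + j) add up to -m.\<close>

lemma skew_step:
  assumes hyp: "\<And>x. x \<in> par p \<Longrightarrow> \<forall>j\<ge>N. P (m + int j) y x = 0 \<Longrightarrow>
      P m x y = s e (\<Sum>j<N. s (sg (m + int j)) (D j (P (m + int j) y x)))"
    and "m \<noteq> 0" and x: "x \<in> par p" and N: "\<forall>j\<ge>N. P (m - 1 + int j) y x = 0"
  shows "P (m - 1) x y = s e (\<Sum>j<N. s (sg (m - 1 + int j)) (D j (P (m - 1 + int j) y x)))"
proof -
  define Z where "Z j = D j (P (m - 1 + int j) y x)" for j
  have *: "P (m + int j) y (T x) = T (P (m - 1 + int (Suc j)) y x) + s (of_int (m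
    + int j)) (P (m - 1 + int j) y x)" for j
    by (simp add: P_right_T algebra_simps)
  \<comment> \<open>The shift of the summation index produces one extra term, at N.\<close>
  have ZN: "Z N = 0" using N by (simp add: Z_def)
  have "s (- of_int m) (P (m - 1) x y) = P m (T x) y"
    by (simp add: P_T)
  also have "\<dots> = s e (\<Sum>j<N. s (sg (m + int j)) (D j (P (m + int j) y (T x))))"
    by (rule hyp[OF par_T[OF x]]) (use N in \<open>simp add: * del: of_nat_Suc\<close>)
  also have "(\<Sum>j<N. s (sg (m + int j)) (D j (P (m + int j) y (T x))))
     = (\<Sum>j<N. s (sg (m - 1 + int (Suc j)) * of_nat (Suc j)) (Z (Suc j)))
       + (\<Sum>j<N. s (sg (m + int j) * of_int (m + int j)) (Z j))"
    unfolding * D_add D_T D_scale scale_right_distrib sum.distrib Z_def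
    by (simp add: del: of_nat_Suc) (simp add: algebra_simps)
  also have "(\<Sum>j<N. s (sg (m - 1 + int (Suc j)) * of_nat (Suc j)) (Z (Suc j)))
     = (\<Sum>j<N. s (sg (m - 1 + int j) * of_nat j) (Z j))"
    using sum.lessThan_Suc_shift[of "\<lambda>j. s (sg (m - 1 + int j) * of_nat j) (Z j)" N] ZN
    by (simp del: of_nat_Suc)
  also have "\<dots> + (\<Sum>j<N. s (sg (m + int j) * of_int (m + int j)) (Z j))
     = s (- of_int m) (\<Sum>j<N. s (sg (m - 1 + int j)) (Z j))"
    unfolding sum.distrib[symmetric] scale_left_distrib[symmetric] scale_sum_right scale_scale
    by (intro sum.cong refl arg_cong2[where f = s]) (simp add: sg_add sg_diff algebra_simps)
  finally have "s (- of_int m) (P (m - 1) x y)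
      = s (- of_int m) (s e (\<Sum>j<N. s (sg (m - 1 + int j)) (Z j)))"
    by (simp add: mult.commute)
  then show ?thesis
    using \<open>m \<noteq> 0\<close> unfolding Z_def scale_cancel_left by simp
qed

lemma skew:
  assumes "x \<in> par p" and y: "y \<in> par q" and "\<forall>j\<ge>N. P (m + int j) y x = 0"
  shows "P m x y = s (- \<kappa> p q) (\<Sum>j<N. s (sg (m + int j)) (D j (P (m + int j) y x)))"
proof (cases "m \<ge> 0")
  case True
  then obtain k where "m = int k" using nonneg_int_cases by blast
  then show ?thesis
    using skew_nonneg[of x p y q N k] assms by (simp add: sg_of_nat flip: of_nat_add)
next
  case False
  then have "m \<le> - 1" by simp
  then show ?thesis using assms(1,3)
  proof (induction m arbitrary: x rule: int_le_induct)
    case base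
    then show ?case using skew_minus_one y by blast
  next
    case (step m)
    show ?case
      by (rule skew_step[where p = p]) (use step in auto)
  qed
qed


section \<open>Commutators of x_(-1) with arbitrary modes\<close>

lemma commutator_minus_one_step:
  assumes hyp: "\<And>z. z \<in> par q \<Longrightarrow> \<forall>k\<ge>Suc N. P (int k) x z = 0 \<Longrightarrow>
      bracket e (- 1) x m z w = (\<Sum>k<Suc N. s ((- 1) ^ k) (P (m - 1 - int k) (P (int k) x z) w))"
    and "m \<noteq> 0" and z: "z \<in> par q" and N: "\<forall>k\<ge>N. P (int k) x z = 0"
  shows "bracket e (- 1) x (m - 1) z w
    = (\<Sum>k<N. s ((- 1) ^ k) (P (m - 2 - int k) (P (int k) x z) w))"
proof -
  define Z where "Z k = P (m - 2 - int k) (P (int k) x z) w" for k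
  have ZN: "Z k = 0" if "k \<ge> N" for k using N that by (simp add: Z_def)
  \<comment> \<open>Since x_k (T z) involves x_(k-1) z, its vanishing is only guaranteed from N + 1
    on; hence the bound \<open>Suc N\<close> in the hypothesis.\<close>
  have left: "P (int k - 1) x z = 0" if "k \<ge> Suc N" for k
    using N that by (metis Suc_le_D Suc_le_mono add_diff_cancel_left' of_nat_Suc)
  have "s (- of_int m) (bracket e (- 1) x (m - 1) z w) = bracket e (- 1) x m (T z) w"
    by (simp add: bracket_T_right)
  also have "\<dots> = (\<Sum>k<Suc N. s ((- 1) ^ k) (P (m - 1 - int k) (P (int k) x (T z)) w))"
    by (rule hyp[OF par_T[OF z]]) (use N left in \<open>simp add: P_right_T\<close>)
  also have "\<dots> = (\<Sum>k<Suc N. s ((- 1) ^ k * - of_int (m - 1 - int k)) (Z k))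
      + (\<Sum>k<Suc N. s ((- 1) ^ k * of_nat k) (P (m - 1 - int k) (P (int k - 1) x z) w))"
    unfolding P_right_T P_add_left P_T P_scale_left scale_right_distrib sum.distrib Z_def
    by (simp add: algebra_simps)
  also have "(\<Sum>k<Suc N. s ((- 1) ^ k * of_nat k) (P (m - 1 - int k) (P (int k - 1) x z) w))
      = (\<Sum>k<N. s ((- 1) ^ Suc k * of_nat (Suc k)) (Z k))"
    unfolding sum.lessThan_Suc_shift Z_def by (simp add: algebra_simps)
  also have "(\<Sum>k<Suc N. s ((- 1) ^ k * - of_int (m - 1 - int k)) (Z k))
      = (\<Sum>k<N. s ((- 1) ^ k * - of_int (m - 1 - int k)) (Z k))"
    by (simp add: ZN)
  \<comment> \<open>Up to the common sign the weights are -(m - 1 - k) and -(k + 1), with sum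
    -m.\<close>
  also have "\<dots> + (\<Sum>k<N. s ((- 1) ^ Suc k * of_nat (Suc k)) (Z k))
      = s (- of_int m) (\<Sum>k<N. s ((- 1) ^ k) (Z k))"
    unfolding sum.distrib[symmetric] scale_left_distrib[symmetric] scale_sum_right scale_scale
    by (intro sum.cong refl arg_cong2[where f = s]) (simp add: algebra_simps)
  finally show ?thesis
    using \<open>m \<noteq> 0\<close> unfolding Z_def scale_cancel_left by simp
qed

text \<open>This is the coefficient of X^k in (1 + X)^(-1) ((1 + X) - X)^m = (1 + X)^(-1), with the
  power expanded by the binomial theorem. The induction on m uses Pascal's rule in both factors, and
  the two extra sums cancel.\<close>

lemma alternating_gchoose:
  "(\<Sum>t\<le>k. (- 1) ^ t * of_nat (m choose t) * (of_int (int m - 1 - int t) gchoose (k - t)))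
    = ((- 1) ^ k :: 'k)"
    (is "(\<Sum>t\<le>k. ?f m k t) = _")
proof (induction m arbitrary: k)
  case 0
  have "(\<Sum>t\<le>k. ?f 0 k t) = (\<Sum>t\<in>{0}. ?f 0 k t)"
    by (rule sum.mono_neutral_right) auto
  also have "\<dots> = (- 1) ^ k"
    by (simp add: gbinomial_minus[of 1, simplified] flip: binomial_gbinomial)
  finally show ?case .
next
  case (Suc m)
  define A :: "nat \<Rightarrow> nat \<Rightarrow> 'k" where "A k t = (- 1) ^ t * of_nat (m choose t) * (of_int (int m - 1
    - int t) gchoose (k - t))" for k t
  show ?case
  proof (cases k)
    case (Suc l)
    have "(\<Sum>t\<le>Suc l. ?f (Suc m) (Suc l) t)
        = (\<Sum>t\<le>Suc l. (- 1) ^ t * of_nat (m choose t) * (of_int (int m - int t) gchoose (Suc l - t)))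
        + (\<Sum>t\<le>l. (- 1) ^ Suc t * of_nat (m choose t) * (of_int (int m - 1 - int t) gchoose (l -
          t)) :: 'k)"
      unfolding sum.atMost_Suc_shift by (simp add: sum.distrib[symmetric] algebra_simps)
    also have "(\<Sum>t\<le>Suc l. (- 1) ^ t * of_nat (m choose t) * (of_int (int m - int t) gchoose (Suc l - t)))
        = (\<Sum>t\<le>Suc l. A (Suc l) t) + (\<Sum>t\<le>l. A l t)"
    proof -
      have "(- 1) ^ t * of_nat (m choose t) * (of_int (int m - int t) gchoose (Suc l - t))
        = A (Suc l) t + A l t" if "t \<le> l" for t
      proof -
        have "((of_int (int m - int t) :: 'k) gchoose Suc (l - t))
          = (of_int (int m - 1 - int t) gchoose Suc (l - t))
            + (of_int (int m - 1 - int t) gchoose (l - t))"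
          using gbinomial_Suc_Suc[of "of_int (int m - 1 - int t) :: 'k" "l - t"]
            by (simp add: algebra_simps)
        then show ?thesis
          using that by (simp add: A_def Suc_diff_le algebra_simps)
      qed
      then show ?thesis by (simp add: sum.distrib) (simp add: A_def)
    qed
    also have "(\<Sum>t\<le>l. (- 1) ^ Suc t * of_nat (m choose t) * (of_int (int m - 1 - int t) gchoose (l
      - t)) :: 'k) = - (\<Sum>t\<le>l. A l t)"
      by (simp add: A_def sum_negf)
    finally show ?thesis
      using Suc.IH[of "Suc l"] by (simp only: Suc A_def) simp
  qed simp
qed

text \<open>The Wick formula for z_m applied to the product of x and w expresses [z_m, x_(-1)] w by
  the products z_t x. Skew symmetry rewrites these as divided powers of T on x_k z,
  \<open>P_D\<close> turns the powers into index shifts, and the coefficients of x_k z sum up to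
  (-1)^k by \<open>alternating_gchoose\<close>.\<close>

lemma commutator_minus_one_nonneg:
  assumes x: "x \<in> par p" and z: "z \<in> par q" and N: "\<forall>k\<ge>N. P (int k) x z = 0"
  shows "bracket (\<kappa> p q) (- 1) x (int m) z w
    = (\<Sum>k<N. s ((- 1) ^ k) (P (int m - 1 - int k) (P (int k) x z) w))"
proof -
  define Z where "Z k = P (int m - 1 - int k) (P (int k) x z) w" for k
  define f :: "nat \<Rightarrow> nat \<Rightarrow> 'k" where "f t j = (- 1) ^ t * of_nat (m choose t) * (of_int (int m - 1
    - int t) gchoose j)" for t j
  have ZN: "Z k = 0" if "k \<ge> N" for k using N that by (simp add: Z_def)
  let ?S = "\<Sum>t\<le>m. s (of_nat (m choose t)) (P (int m - 1 - int t) (P (int t) z x) w)"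
  let ?B = "bracket (\<kappa> p q) (- 1) x (int m) z w"
  have "?S = bracket (\<kappa> p q) (int m) z (- 1) x w"
    unfolding bracket_def wick[OF z x] lessThan_Suc_atMost[symmetric] sum.lessThan_Suc
    by (simp add: kappa_commute[of q p] of_nat_diff diff_diff_eq)
  also have "\<dots> = - s (\<kappa> p q) ?B"
    by (simp add: bracket_def scale_right_diff_distrib)
  finally have "s (- \<kappa> p q) (- s (\<kappa> p q) ?B) = s (- \<kappa> p q) ?S" by simp
  then have "?B = s (- \<kappa> p q) ?S"
    by simp
  also have "\<dots> = (\<Sum>t\<le>m. \<Sum>j<N. s (f t j) (Z (t + j)))"
    unfolding scale_sum_right
  proof (intro sum.cong refl)
    fix t
    have "P (int t) z x = s (- \<kappa> q p) (\<Sum>j<N. s (sg (int t + int j)) (D j (P (int t + int j) x z)))"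
      by (rule skew[OF z x]) (use N in \<open>simp flip: of_nat_add\<close>)
    then show "s (- \<kappa> p q) (s (of_nat (m choose t)) (P (int m - 1 - int t) (P (int t) z x) w))
       = (\<Sum>j<N. s (f t j) (Z (t + j)))"
      by (simp add: P_sum_left P_scale_left P_D scale_sum_right Z_def f_def sg_add sg_of_nat
          kappa_commute[of q p] algebra_simps)
  qed
  \<comment> \<open>Regroup by k = t + j; terms with k >= N vanish because x_k z = 0 there.\<close>
  also have "\<dots> = (\<Sum>t\<le>m. \<Sum>k<N. s (if t \<le> k then f t (k - t) else 0) (Z k))"
  proof (rule sum.cong[OF refl])
    fix t
    have "(\<Sum>j<N. s (f t j) (Z (t + j))) = (\<Sum>k\<in>{t..<N + t}. s (f t (k - t)) (Z k))"
      by (rule sum.reindex_bij_witness[of _ "\<lambda>k. k - t" "\<lambda>j. t + j"]) auto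
    also have "\<dots> = (\<Sum>k\<in>{..<N + t}. s (if t \<le> k then f t (k - t) else 0) (Z k))"
      by (rule sum.mono_neutral_cong_left) auto
    also have "\<dots> = (\<Sum>k<N. s (if t \<le> k then f t (k - t) else 0) (Z k))"
      by (rule sum.mono_neutral_right) (auto simp: ZN)
    finally show "(\<Sum>j<N. s (f t j) (Z (t + j)))
      = (\<Sum>k<N. s (if t \<le> k then f t (k - t) else 0) (Z k))" .
  qed
  also have "\<dots> = (\<Sum>k<N. s (\<Sum>t\<le>m. if t \<le> k then f t (k - t) else 0) (Z k))"
    unfolding scale_sum_left by (rule sum.swap)
  also have "\<dots> = (\<Sum>k<N. s (\<Sum>t\<le>k. f t (k - t)) (Z k))"
    by (intro sum.cong refl arg_cong2[where f = s] sum.mono_neutral_cong) (auto simp: f_def)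
  finally show ?thesis
    by (simp only: f_def alternating_gchoose Z_def)
qed

text \<open>At m = -1 the axiom \<open>comm\<close> says that the commutator is multiplication by
  [x, z], which quasi-commutativity expands.\<close>

lemma commutator_minus_one:
  assumes x: "x \<in> par p" and z: "z \<in> par q" and N: "\<forall>k\<ge>N. P (int k) x z = 0"
  shows "bracket (\<kappa> p q) (- 1) x m z w
    = (\<Sum>k<N. s ((- 1) ^ k) (P (m - 1 - int k) (P (int k) x z) w))"
proof (cases "m \<ge> 0")
  case True
  then show ?thesis
    using commutator_minus_one_nonneg[OF assms, of "nat m"] by simp
next
  case False
  then have "m \<le> - 1" by simp
  then show ?thesis using z N
  proof (induction m arbitrary: z N rule: int_le_induct)
    case base
    have "bracket (\<kappa> p q) (- 1) x (- 1) z w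
        = P (- 1) (\<Sum>j<N. s ((- 1) ^ j) (D (j + 1) (P (int j) x z))) w"
      unfolding quasi_comm[OF x base, symmetric] comm[OF x base(1)] bracket_def ..
    moreover have "- 1 - int (j + 1) = - 1 - 1 - int j" for j by simp
    ultimately show ?case
      by (simp only: P_sum_left P_scale_left P_D_minus_one)
  next
    case (step m)
    show ?case
      using commutator_minus_one_step[of q N x "\<kappa> p q" m w z] step by (simp add: algebra_simps)
  qed
qed

section \<open>Modes of a normally ordered product\<close>

lemma bounded_int: "\<exists>N. \<forall>j\<ge>N. P (m + int j) x y = 0"
proof -
  obtain N where N: "\<forall>t\<ge>N. P (int t) x y = 0" using bounded by blast
  have "P (m + int j) x y = 0" if "j \<ge> N + nat \<bar>m\<bar>" for j
  proof -
    have "m + int j = int (nat (m + int j))" "nat (m + int j) \<ge> N" using that by linarith+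
    then show ?thesis using N by metis
  qed
  then show ?thesis by blast
qed

lemma sum_triangle:
  fixes N :: nat
  assumes "\<And>i l. i + l \<ge> N \<Longrightarrow> g i l = 0"
  shows "(\<Sum>j<N. \<Sum>i\<le>j. g i (j - i)) = (\<Sum>i<N. \<Sum>l<N. g i l)"
proof -
  have "(\<Sum>i<N. \<Sum>l<N. g i l) = (\<Sum>(i, l)\<in>{..<N} \<times> {..<N}. g i l)"
    by (rule sum.cartesian_product)
  also have "\<dots> = (\<Sum>(i, l)\<in>{(i, l). i + l < N}. g i l)"
    by (rule sum.mono_neutral_right) (auto, metis assms not_le)
  finally show ?thesis by (simp add: sum.triangle_reindex)
qed

text \<open>
  Skew symmetry turns \<open>(x y)\<^sub>m z\<close> into terms \<open>z\<^sub>m\<^sub>+\<^sub>j (x y)\<close>, the commutator formula moves \<open>z\<^sub>m\<^sub>+\<^sub>j\<close>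
  past \<open>x\<close>, and skew symmetry in the other direction yields the two normally ordered sums.
\<close>

lemma iterate_product_bounded:
  assumes x: "x \<in> par p" and y: "y \<in> par q" and z: "z \<in> par r"
    and zxy: "\<forall>j\<ge>N. P (m + int j) z (P (- 1) x y) = 0"
    and zy: "\<forall>j\<ge>N. P (m + int j) z y = 0"
    and xz: "\<forall>k\<ge>N. P (int k) x z = 0"
    and xzy: "\<forall>k. \<forall>j\<ge>N. P (m - 1 - int k + int j) (P (int k) x z) y = 0"
  shows "P m (P (- 1) x y) z
    = (\<Sum>i<N. P (- 1 - int i) x (P (m + int i) y z))
      + s (\<kappa> p q) (\<Sum>k<N. P (m - 1 - int k) y (P (int k) x z))"
proof -
  define W where "W j k = D j (P (m - 1 - int k + int j) (P (int k) x z) y)" for j k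
  have move: "P (m + int j) z (P (- 1) x y)
      = s (\<kappa> p r) (P (- 1) x (P (m + int j) z y)
        - (\<Sum>k<N. s ((- 1) ^ k) (P (m - 1 - int k + int j) (P (int k) x z) y)))" for j
  proof -
    have "P (- 1) x (P (m + int j) z y) - s (\<kappa> p r) (P (m + int j) z (P (- 1) x y))
        = (\<Sum>k<N. s ((- 1) ^ k) (P (m - 1 - int k + int j) (P (int k) x z) y))"
      using commutator_minus_one[OF x z xz, of "m + int j" y]
      by (simp add: bracket_def algebra_simps)
    then have "s (\<kappa> p r) (s (\<kappa> p r) (P (m + int j) z (P (- 1) x y)))
        = s (\<kappa> p r) (P (- 1) x (P (m + int j) z y)
        - (\<Sum>k<N. s ((- 1) ^ k) (P (m - 1 - int k + int j) (P (int k) x z) y)))"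
      by (simp add: algebra_simps)
    then show ?thesis by simp
  qed
  have "P m (P (- 1) x y) z = s (- \<kappa> (p \<noteq> q) r)
      (\<Sum>j<N. s (sg (m + int j)) (D j (P (m + int j) z (P (- 1) x y))))"
    by (rule skew[OF par_P[OF x y] z zxy])
  also have "\<dots> = s (- \<kappa> q r)
      (\<Sum>j<N. s (sg (m + int j)) (D j (P (- 1) x (P (m + int j) z y))))
    + s (\<kappa> q r) (\<Sum>j<N. \<Sum>k<N. s (sg (m + int j) * (- 1) ^ k) (W j k))"
    by (simp add: move kappa_xor D_scale D_diff D_sum W_def sum_subtractf scale_right_diff_distrib
        scale_sum_right mult_ac sum_negf)
  \<comment> \<open>The Leibniz rule puts i of the j divided derivatives on x, which makes x_(-1-i).
    The other l = j - i stay on the inner product and rebuild y_(m+i) z by skew symmetry.\<close>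
  also have "(\<Sum>j<N. s (sg (m + int j)) (D j (P (- 1) x (P (m + int j) z y))))
     = (\<Sum>j<N. \<Sum>i\<le>j. s (sg (m + int i + int (j - i)))
         (P (- 1 - int i) x (D (j - i) (P (m + int i + int (j - i)) z y))))"
    by (intro sum.cong refl)
      (auto simp: D_P scale_sum_right P_D_minus_one of_nat_diff intro!: sum.cong)
  also have "\<dots> = (\<Sum>i<N. \<Sum>l<N. s (sg (m + int i + int l))
         (P (- 1 - int i) x (D l (P (m + int i + int l) z y))))"
    by (rule sum_triangle) (use zy in \<open>simp add: add.assoc flip: of_nat_add\<close>)
  also have "s (- \<kappa> q r) \<dots> = (\<Sum>i<N. P (- 1 - int i) x (P (m + int i) y z))"
    unfolding scale_sum_right[of _ _ "{..<N}"]
  proof (rule sum.cong[OF refl])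
    fix i
    have "P (m + int i) y z = s (- \<kappa> q r) (\<Sum>l<N. s (sg (m + int i + int l)) (D l (P (m + int i
      + int l) z y)))"
      by (rule skew[OF y z]) (use zy in \<open>simp add: add.assoc flip: of_nat_add\<close>)
    then show "(\<Sum>l<N. s (- \<kappa> q r) (s (sg (m + int i + int l)) (P (- 1 - int i) x (D l (P (m
      + int i + int l) z y)))))
      = P (- 1 - int i) x (P (m + int i) y z)"
      by (simp add: P_sum_right P_scale_right scale_sum_right sum_negf)
  qed
  also have "s (\<kappa> q r) (\<Sum>j<N. \<Sum>k<N. s (sg (m + int j) * (- 1) ^ k) (W j k))
      = (\<Sum>k<N. s (\<kappa> q r) (\<Sum>j<N. s (sg (m + int j) * (- 1) ^ k) (W j k)))"
    by (subst sum.swap) (simp only: scale_sum_right)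
  also have "\<dots> = (\<Sum>k<N. s (\<kappa> p q) (P (m - 1 - int k) y (P (int k) x z)))"
  proof (rule sum.cong[OF refl])
    fix k
    \<comment> \<open>The \<open>W j k\<close> are the terms of skew symmetry for y and x_k z, whose
      sign is the product of the signs of (y, x) and (y, z).\<close>
    have "P (m - 1 - int k) y (P (int k) x z)
        = s (- \<kappa> q (p \<noteq> r)) (\<Sum>j<N. s (sg (m - 1 - int k + int j)) (W j k))"
      unfolding W_def by (rule skew[OF y par_P[OF x z]]) (use xzy in simp)
    then show "s (\<kappa> q r) (\<Sum>j<N. s (sg (m + int j) * (- 1) ^ k) (W j k))
      = s (\<kappa> p q) (P (m - 1 - int k) y (P (int k) x z))"
      by (simp add: kappa_xor kappa_commute[of q p] sg_add sg_diff sg_of_nat scale_sum_right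
        sum_negf mult_ac)
  qed
  finally show ?thesis by (simp only: scale_sum_right)
qed

text \<open>Stating the formula for all large N allows bounds to be merged when it is extended by
  linearity, and it fits the partial sums by which the normally ordered product is defined.\<close>

lemma iterate_product:
  assumes x: "x \<in> par p" and y: "y \<in> par q" and z: "z \<in> par r"
  shows "\<exists>N0. \<forall>N\<ge>N0. P m (P (- 1) x y) z
    = (\<Sum>i<N. P (- 1 - int i) x (P (m + int i) y z))
      + s (\<kappa> p q) (\<Sum>k<N. P (m - 1 - int k) y (P (int k) x z))"
proof -
  obtain N1 where N1: "\<forall>j\<ge>N1. P (m + int j) z (P (- 1) x y) = 0" using bounded_int by blast
  obtain N2 where N2: "\<forall>j\<ge>N2. P (m + int j) z y = 0" using bounded_int by blast
  obtain N3 where N3: "\<forall>k\<ge>N3. P (int k) x z = 0" using bounded by blast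
  have "\<forall>k. \<exists>M. \<forall>j\<ge>M. P (m - 1 - int k + int j) (P (int k) x z) y = 0" using bounded_int by blast
  then obtain M where M: "\<And>k j. j \<ge> M k \<Longrightarrow> P (m - 1 - int k + int j) (P (int k) x z) y = 0" by metis
  \<comment> \<open>Each k has its own bound M k, but x_k z = 0 for k >= N3, so finitely many of
    them matter and their sum dominates them all.\<close>
  define N0 where "N0 = N1 + N2 + N3 + (\<Sum>k<N3. M k)"
  have M': "P (m - 1 - int k + int j) (P (int k) x z) y = 0" if "j \<ge> N0" for j k
  proof (cases "k < N3")
    case True
    then have "M k \<le> (\<Sum>k<N3. M k)" by (intro member_le_sum) auto
    then show ?thesis using M that by (simp add: N0_def)
  qed (use N3 in simp)
  show ?thesis
    by (rule exI[of _ N0], intro allI impI, rule iterate_product_bounded[OF x y z])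
      (use N1 N2 N3 M' in \<open>auto simp: N0_def\<close>)
qed

end

section \<open>Convergence in FZ-complete algebras\<close>

lemma graded_super_spaceD:
  assumes "graded_super_space \<rho> V"
  shows "internal_direct_sum (scl V) (car V) (par V)" "internal_direct_sum (scl V) (car V) (deg V)"
  using assms unfolding graded_super_space_def internal_direct_sum_def internal_direct_sum_axioms_def
  by blast+

section \<open>Graded superspaces and the space of distributions\<close>

locale graded_superspace =
  fixes \<rho> :: rat and V :: "('k::field, 'a::ab_group_add, 'z) super_space_scheme"
  assumes graded_super_space: "graded_super_space \<rho> V"
begin

sublocale vector_space "scl V"
  using graded_super_space by (simp add: graded_super_space_def)

sublocale dg: internal_direct_sum "scl V" "car V" "deg V"
  by (rule graded_super_spaceD[OF graded_super_space])

sublocale pr: internal_direct_sum "scl V" "car V" "par V"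
  by (rule graded_super_spaceD[OF graded_super_space])

lemmas subspace_car = dg.subspace_C

lemma car_closed [simp]:
  "0 \<in> car V" "x \<in> car V \<Longrightarrow> y \<in> car V \<Longrightarrow> x + y \<in> car V"
  "x \<in> car V \<Longrightarrow> y \<in> car V \<Longrightarrow> x - y \<in> car V" "x \<in> car V \<Longrightarrow> - x \<in> car V"
  "x \<in> car V \<Longrightarrow> scl V c x \<in> car V"
  by (simp_all add: subspace_car subspace_0 subspace_add subspace_diff subspace_neg subspace_scale)

lemma sum_car [simp]: "(\<And>i. i \<in> I \<Longrightarrow> f i \<in> car V) \<Longrightarrow> (\<Sum>i\<in>I. f i) \<in> car V"
  by (rule subspace_sum[OF subspace_car])

lemma koszul_scale: "koszul p q x = scl V (if p \<and> q then - 1 else 1) x"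
  by (simp add: koszul_def)

lemma koszul_car [simp]: "x \<in> car V \<Longrightarrow> koszul p q x \<in> car V"
  by (simp add: koszul_def)

lemma deg_car: "x \<in> deg V h \<Longrightarrow> x \<in> car V" and par_car: "x \<in> par V p \<Longrightarrow> x \<in> car V"
  using dg.G_subset pr.G_subset by auto

lemma component_deg_car [simp]: "x \<in> car V \<Longrightarrow> component (deg V) x h \<in> car V"
  and component_par_car [simp]: "x \<in> car V \<Longrightarrow> component (par V) x p \<in> car V"
  using dg.component_in pr.component_in deg_car par_car by blast+

lemma par_component_deg: "x \<in> deg V h \<Longrightarrow> component (par V) x p \<in> deg V h"
  using graded_super_space by (auto simp: graded_super_space_def super_subset_def)

lemma sum_par: "x \<in> car V \<Longrightarrow> (\<Sum>p\<in>UNIV. component (par V) x p) = x"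
  by (rule pr.sum_component_superset) auto

lemma vector_space_dist_scl: "vector_space (dist_scl V)"
  by unfold_locales
    (simp_all add: dist_scl_def fun_eq_iff scale_right_distrib scale_left_distrib plus_fun_def)

lemma homogeneous_dist_carrier: "a \<in> homogeneous_dist V h \<Longrightarrow> a \<in> dist_carrier V"
proof -
  interpret d: vector_space "dist_scl V" by (rule vector_space_dist_scl)
  show "a \<in> homogeneous_dist V h \<Longrightarrow> a \<in> dist_carrier V"
    unfolding dist_carrier_def by (intro d.span_base) blast
qed

lemma subspace_dist_carrier: "module.subspace (dist_scl V) (dist_carrier V)"
proof -
  interpret d: vector_space "dist_scl V" by (rule vector_space_dist_scl)
  show ?thesis unfolding dist_carrier_def by (rule d.subspace_span)
qed

text \<open>Scalars are absorbed by the homogeneous summands. The degrees \<open>\<eta> i\<close>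
  may repeat, which avoids collecting terms.\<close>

lemma dist_carrier_sum:
  assumes "a \<in> dist_carrier V"
  shows "\<exists>(n::nat) \<eta> \<alpha>. (\<forall>i<n. \<alpha> i \<in> homogeneous_dist V (\<eta> i)) \<and> (\<forall>t. a t = (\<Sum>i<n. \<alpha> i t))"
proof -
  interpret d: vector_space "dist_scl V" by (rule vector_space_dist_scl)
  show ?thesis
    using assms unfolding dist_carrier_def
  proof (induction rule: d.span_induct_alt)
    case base
    show ?case by (intro exI[of _ 0]) simp
  next
    case (step c x y)
    then obtain n :: nat and \<eta> \<alpha> h where *: "\<forall>i<n. \<alpha> i \<in> homogeneous_dist V (\<eta> i)"
      "\<forall>t. y t = (\<Sum>i<n. \<alpha> i t)" "x \<in> homogeneous_dist V h" by auto
    have "dist_scl V c x \<in> homogeneous_dist V h"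
      using *(3) by (simp add: homogeneous_dist_def dist_scl_def dg.subspace_G subspace_scale)
    then have "(\<forall>i<Suc n. (\<alpha>(n := dist_scl V c x)) i \<in> homogeneous_dist V ((\<eta>(n := h)) i)) \<and>
       (\<forall>t. (dist_scl V c x + y) t = (\<Sum>i<Suc n. (\<alpha>(n := dist_scl V c x)) i t))"
      using * by (auto simp: less_Suc_eq add.commute)
    then show ?case by blast
  qed
qed

lemma dist_carrier_car:
  assumes "a \<in> dist_carrier V" shows "a t \<in> car V"
proof -
  obtain n :: nat and \<eta> \<alpha> where *: "\<forall>i<n. \<alpha> i \<in> homogeneous_dist V (\<eta> i)"
    "\<forall>t. a t = (\<Sum>i<n. \<alpha> i t)" using dist_carrier_sum[OF assms] by blast
  have "\<alpha> i t \<in> car V" if "i < n" for i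
    using *(1) that deg_car unfolding homogeneous_dist_def by blast
  then show ?thesis by (auto simp: *(2) intro: sum_car)
qed

end

text \<open>The predicate under the definite description in \<open>fz_suminf\<close>, named in order
  to separate existence of a limit from its value.\<close>

definition fz_converges ::
    "('k::field, 'a::ab_group_add, 'z) fz_alg_scheme \<Rightarrow> (nat \<Rightarrow> 'a) \<Rightarrow> 'a \<Rightarrow> bool" where
  "fz_converges A x l \<longleftrightarrow> l \<in> car A \<and>
     (\<forall>h. limitin (topo A h) (\<lambda>N. \<Sum>j<N. component (deg A) (x j) h)
            (component (deg A) l h) sequentially)"

locale fz_complete_algebra =
  fixes \<rho> :: rat and A :: "('k::field, 'a::ab_group_add, 'z) fz_alg_scheme"
  assumes fz_complete: "fz_complete \<rho> A"
begin

lemma graded_associative: "graded_associative_algebra \<rho> A"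
  using fz_complete by (simp add: fz_complete_def)

sublocale graded_superspace \<rho> A
  by unfold_locales (use graded_associative in \<open>simp add: graded_associative_algebra_def\<close>)

lemma topspace_topo [simp]: "topspace (topo A h) = deg A h"
  using fz_complete by (simp add: fz_complete_def linear_topologies_def)

lemma mul_car [simp]: "x \<in> car A \<Longrightarrow> y \<in> car A \<Longrightarrow> mul A x y \<in> car A"
  using graded_associative by (simp add: graded_associative_algebra_def even_bilin_def lin_map_def)

lemma mul_add_left: "x \<in> car A \<Longrightarrow> x' \<in> car A \<Longrightarrow> y \<in> car A \<Longrightarrow> mul A (x + x') y = mul A x y + mul A x' y"
  and mul_add_right: "x \<in> car A \<Longrightarrow> y \<in> car A \<Longrightarrow> y' \<in> car A \<Longrightarrow> mul A x (y + y') = mul A x y + mul A x y'"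
  and mul_scale_left: "x \<in> car A \<Longrightarrow> y \<in> car A \<Longrightarrow> mul A (scl A c x) y = scl A c (mul A x y)"
  and mul_scale_right: "x \<in> car A \<Longrightarrow> y \<in> car A \<Longrightarrow> mul A x (scl A c y) = scl A c (mul A x y)"
  using graded_associative by (simp_all add: graded_associative_algebra_def even_bilin_def lin_map_def)

lemma mul_deg: "x \<in> deg A h \<Longrightarrow> y \<in> deg A k \<Longrightarrow> mul A x y \<in> deg A (h + k)"
  using graded_associative by (simp add: graded_associative_algebra_def)

lemma mul_zero [simp]: "y \<in> car A \<Longrightarrow> mul A 0 y = 0" "y \<in> car A \<Longrightarrow> mul A y 0 = 0"
  using mul_scale_left[of 0 y 0] mul_scale_right[of y 0 0] by simp_all

lemma mul_sum_left:
  "(\<And>i. i \<in> I \<Longrightarrow> f i \<in> car A) \<Longrightarrow> y \<in> car A \<Longrightarrow> mul A (\<Sum>i\<in>I. f i) y = (\<Sum>i\<in>I. mul A (f i) y)"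
  by (induction I rule: infinite_finite_induct) (simp_all add: mul_add_left)

lemma mul_sum_right:
  "(\<And>i. i \<in> I \<Longrightarrow> f i \<in> car A) \<Longrightarrow> y \<in> car A \<Longrightarrow> mul A y (\<Sum>i\<in>I. f i) = (\<Sum>i\<in>I. mul A y (f i))"
  by (induction I rule: infinite_finite_induct) (simp_all add: mul_add_right)

lemma mul_sum_sum:
  assumes "\<And>i. i \<in> I \<Longrightarrow> f i \<in> car A" "\<And>j. j \<in> J \<Longrightarrow> g j \<in> car A"
  shows "mul A (\<Sum>i\<in>I. f i) (\<Sum>j\<in>J. g j) = (\<Sum>(i, j)\<in>I \<times> J. mul A (f i) (g j))"
proof -
  have "mul A (\<Sum>i\<in>I. f i) (\<Sum>j\<in>J. g j) = (\<Sum>i\<in>I. mul A (f i) (\<Sum>j\<in>J. g j))"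
    by (intro mul_sum_left sum_car assms)
  also have "\<dots> = (\<Sum>i\<in>I. \<Sum>j\<in>J. mul A (f i) (g j))"
    by (intro sum.cong refl mul_sum_right assms)
  finally show ?thesis by (simp add: sum.cartesian_product)
qed

lemma limit_unique:
  assumes "limitin (topo A h) x l sequentially" "limitin (topo A h) x l' sequentially"
  shows "l = l'"
  using limitin_Hausdorff_unique[OF assms] fz_complete by (simp add: fz_complete_def)

lemma fz_suminf_eq:
  assumes "fz_converges A x l" shows "fz_suminf A x = l"
proof -
  have unique: "l' = l" if "fz_converges A x l'" for l'
  proof (rule dg.eq_by_components)
    show "l' \<in> car A" "l \<in> car A" using that assms by (simp_all only: fz_converges_def)
    fix h
    have "limitin (topo A h) (\<lambda>N. \<Sum>j<N. component (deg A) (x j) h) (component (deg A) k h) sequentially"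
      if "fz_converges A x k" for k
      using that by (simp only: fz_converges_def)
    from limit_unique[OF this[OF that] this[OF assms]]
    show "component (deg A) l' h = component (deg A) l h" .
  qed
  have "fz_suminf A x = (THE l. fz_converges A x l)"
    by (simp only: fz_suminf_def fz_converges_def)
  also have "\<dots> = l" using assms unique by (rule the_equality)
  finally show ?thesis .
qed

lemma fz_small:
  "\<forall>h U. openin (topo A h) U \<and> 0 \<in> U \<longrightarrow> (\<exists>k::int. topo A h closure_of
     span {mul A x y | x y l. l < of_int k \<and> x \<in> deg A (h - l) \<and> y \<in> deg A l} \<subseteq> U)"
  using fz_complete unfolding fz_complete_def by (elim conjE)

lemma cauchy_limit: "Defs.cauchy_filter A h F \<Longrightarrow> \<exists>x. limitin (topo A h) (\<lambda>y. y) x F"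
  using fz_complete unfolding fz_complete_def complete_degreewise_def by (elim conjE) simp

text \<open>As in non-archimedean analysis it suffices that the terms tend to 0: from some index on
  they lie in a given basic subspace, hence so do all differences of partial sums.\<close>

lemma partial_sums_converge:
  assumes deg: "\<And>j. x j \<in> deg A h"
    and small: "\<And>k::int. \<exists>J. \<forall>j\<ge>J. x j \<in>
       span {mul A u v | u v l. l < of_int k \<and> u \<in> deg A (h - l) \<and> v \<in> deg A l}"
  shows "\<exists>l. limitin (topo A h) (\<lambda>N. \<Sum>j<N. x j) l sequentially"
proof -
  define S where "S N = (\<Sum>j<N. x j)" for N
  define F where "F = filtermap S sequentially"
  have S_deg: "S N \<in> deg A h" for N
    unfolding S_def by (intro subspace_sum dg.subspace_G deg)
  have "\<forall>\<^sub>F (u, v) in prod_filter F F. u - v \<in> U" if U: "openin (topo A h) U" "0 \<in> U" for U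
  proof -
    from fz_small[rule_format, OF conjI[OF U]]
    obtain k :: int where k: "topo A h closure_of
           span {mul A x y | x y l. l < of_int k \<and> x \<in> deg A (h - l) \<and> y \<in> deg A l} \<subseteq> U" ..
    define E where "E = span {mul A x y | x y l. l < of_int k \<and> x \<in> deg A (h - l) \<and> y \<in> deg A l}"
    have E: "subspace E" unfolding E_def by (rule subspace_span)
    \<comment> \<open>A set is contained in its closure only if it lies in the topspace.\<close>
    have "E \<subseteq> deg A h"
      unfolding E_def by (rule span_minimal) (auto simp: dg.subspace_G dest: mul_deg)
    then have D: "E \<subseteq> U"
      using k[folded E_def] closure_of_subset[of E "topo A h"] by auto
    from small[of k, folded E_def] obtain J where "\<forall>j\<ge>J. x j \<in> E" ..
    then have J: "x j \<in> E" if "j \<ge> J" for j using that by simp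
    have tail: "S N - S M \<in> E" if "J \<le> M" "M \<le> N" for M N
    proof -
      have "S N - S M = (\<Sum>j\<in>{..<N} - {..<M}. x j)"
        unfolding S_def by (subst sum_diff) (use that in auto)
      then show ?thesis using that by (auto intro!: subspace_sum[OF E] J)
    qed
    have "S N - S M \<in> E" if "J \<le> M" "J \<le> N" for M N
      using tail[of M N] tail[of N M] that subspace_neg[OF E, of "S M - S N"]
      by (cases "M \<le> N") auto
    then have "\<forall>u v. (\<exists>N\<ge>J. u = S N) \<longrightarrow> (\<exists>N\<ge>J. v = S N) \<longrightarrow> (case (u, v) of (u, v) \<Rightarrow> u - v \<in> U)"
      using D by auto
    moreover have "\<forall>\<^sub>F u in F. \<exists>N\<ge>J. u = S N"
      unfolding F_def eventually_filtermap eventually_sequentially by blast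
    ultimately show ?thesis unfolding eventually_prod_filter by blast
  qed
  then have "cauchy_filter A h F"
    unfolding cauchy_filter_def using S_deg by (auto simp: F_def eventually_filtermap filtermap_bot_iff)
  from cauchy_limit[OF this] obtain l where "limitin (topo A h) (\<lambda>y. y) l F" ..
  then have "limitin (topo A h) S l sequentially"
    by (simp add: limitin_def F_def eventually_filtermap)
  then show ?thesis unfolding S_def by blast
qed

text \<open>The left factors gain degree with j and the right factors lose it, so the total degree
  is constant while the right factor becomes arbitrarily negative: this is smallness in the FZ
  topology. Both halves of a normally ordered product have this shape.\<close>

lemma fz_converges_products:
  fixes \<alpha> \<beta> :: "'i \<Rightarrow> rat"
  assumes "finite I" and u: "\<And>i j. i \<in> I \<Longrightarrow> u i j \<in> deg A (\<alpha> i + of_nat j)"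
    and v: "\<And>i j. i \<in> I \<Longrightarrow> v i j \<in> deg A (\<beta> i - of_nat j)"
    and x: "\<And>j. x j = (\<Sum>i\<in>I. mul A (u i j) (v i j))"
  shows "\<exists>l. fz_converges A x l"
proof -
  define w where "w i j = mul A (u i j) (v i j)" for i j
  have w: "w i j \<in> deg A (\<alpha> i + \<beta> i)" if "i \<in> I" for i j
    using mul_deg[OF u[OF that, of j] v[OF that, of j]] by (simp add: w_def)
  have comp: "component (deg A) (x j) h = (\<Sum>i\<in>{i\<in>I. \<alpha> i + \<beta> i = h}. w i j)" for j h
  proof -
    have "component (deg A) (x j) h = (\<Sum>i\<in>I. component (deg A) (w i j) h)"
      unfolding x w_def[symmetric] by (rule dg.component_sum) (use w deg_car in blast)
    also have "\<dots> = (\<Sum>i\<in>I. if \<alpha> i + \<beta> i = h then w i j else 0)"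
      by (intro sum.cong refl) (simp add: dg.component_homogeneous[OF w])
    finally show ?thesis using \<open>finite I\<close> by (simp add: sum.inter_filter)
  qed
  have "\<exists>l. limitin (topo A h) (\<lambda>N. \<Sum>j<N. component (deg A) (x j) h) l sequentially" for h
  proof (rule partial_sums_converge)
    show "component (deg A) (x j) h \<in> deg A h" for j
      unfolding comp using w by (auto intro!: subspace_sum dg.subspace_G)
    let ?E = "\<lambda>k::int. span {mul A u v | u v l. l < of_int k \<and> u \<in> deg A (h - l) \<and> v \<in> deg A l}"
    fix k :: int
    \<comment> \<open>A common strict bound for the degrees of the right factors at j = 0; then
      \<beta> i - j < k as soon as j >= b + |k|.\<close>
    obtain b :: nat where b: "\<And>i. i \<in> I \<Longrightarrow> \<beta> i < of_nat b"
    proof -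
      obtain r where "\<And>i. i \<in> I \<Longrightarrow> \<beta> i \<le> r"
        using \<open>finite I\<close> by (metis Max_ge finite_imageI imageI)
      moreover obtain b :: nat where "r < of_nat b" using reals_Archimedean2[of r] by blast
      ultimately show thesis using that by (meson le_less_trans)
    qed
    show "\<exists>J. \<forall>j\<ge>J. component (deg A) (x j) h \<in> ?E k"
    proof (intro exI[of _ "b + nat \<bar>k\<bar>"] allI impI)
      fix j assume j: "b + nat \<bar>k\<bar> \<le> j"
      have "w i j \<in> {mul A u v | u v l. l < of_int k \<and> u \<in> deg A (h - l) \<and> v \<in> deg A l}"
        if i: "i \<in> I" "\<alpha> i + \<beta> i = h" for i
      proof -
        have "of_int (int b - int j) \<le> (of_int k :: rat)"
          using j by (subst of_int_le_iff) linarith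
        then have "\<beta> i - of_nat j < of_int k" using b[OF i(1)] by simp
        moreover have "u i j \<in> deg A (h - (\<beta> i - of_nat j))"
          using u[OF i(1), of j] by (simp add: i(2)[symmetric])
        ultimately show ?thesis unfolding w_def using v[OF i(1), of j] by blast
      qed
      then show "component (deg A) (x j) h \<in> ?E k"
        unfolding comp by (intro span_sum span_base) auto
    qed
  qed
  then obtain L where L: "\<And>h. limitin (topo A h) (\<lambda>N. \<Sum>j<N. component (deg A) (x j) h) (L h)
    sequentially"
    by metis
  have L_deg: "L h \<in> deg A h" for h
    using limitin_topspace[OF L[of h]] by simp
  \<comment> \<open>The limits were found degree by degree. Only the finitely many degrees in H
    contribute, so the limits add up to an element of the carrier.\<close>
  define H where "H = (\<lambda>i. \<alpha> i + \<beta> i) ` I"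
  have "L h = 0" if "h \<notin> H" for h
  proof -
    have "component (deg A) (x j) h = 0" for j
      using that unfolding comp H_def by (intro sum.neutral) auto
    then have "limitin (topo A h) (\<lambda>N. 0) (L h) sequentially" using L[of h] by simp
    moreover have "limitin (topo A h) (\<lambda>N::nat. 0) 0 sequentially" by simp
    ultimately show ?thesis using limit_unique by blast
  qed
  then have "component (deg A) (\<Sum>h\<in>H. L h) = L"
    by (subst dg.component_sum_eq) (use \<open>finite I\<close> L_deg in \<open>auto simp: H_def fun_eq_iff\<close>)
  then have "fz_converges A x (\<Sum>h\<in>H. L h)"
    unfolding fz_converges_def using L L_deg[THEN deg_car] by (auto intro: sum_car)
  then show ?thesis by blast
qed

text \<open>Brings the opposite product into the form required by
  \<open>fz_converges_products\<close>, a finite sum of products of two factors; the Koszul sign is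
  absorbed by the left one.\<close>

lemma sopp_sum:
  assumes a: "\<And>i. i \<in> I \<Longrightarrow> a i \<in> car A" and b: "\<And>j. j \<in> J \<Longrightarrow> b j \<in> car A"
    and "finite I" "finite J"
  shows "sopp A (\<Sum>i\<in>I. a i) (\<Sum>j\<in>J. b j)
    = (\<Sum>(p, q, i, j)\<in>UNIV \<times> UNIV \<times> I \<times> J.
         mul A (koszul p q (component (par A) (b j) q)) (component (par A) (a i) p))"
proof -
  define S where "S p q = koszul p q (mul A (component (par A) (\<Sum>j\<in>J. b j) q)
      (component (par A) (\<Sum>i\<in>I. a i) p))" for p q
  have "S p q = (\<Sum>(i, j)\<in>I \<times> J.
      mul A (koszul p q (component (par A) (b j) q)) (component (par A) (a i) p))" for p q
  proof -
    have "S p q = mul A (\<Sum>j\<in>J. koszul p q (component (par A) (b j) q))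
        (\<Sum>i\<in>I. component (par A) (a i) p)"
      using a b by (simp add: S_def koszul_scale pr.component_sum mul_scale_left sum_car
          flip: scale_sum_right)
    also have "\<dots> = (\<Sum>(j, i)\<in>J \<times> I.
        mul A (koszul p q (component (par A) (b j) q)) (component (par A) (a i) p))"
      by (rule mul_sum_sum) (use a b in simp_all)
    also have "\<dots> = (\<Sum>(i, j)\<in>I \<times> J.
        mul A (koszul p q (component (par A) (b j) q)) (component (par A) (a i) p))"
      unfolding sum.cartesian_product[symmetric] by (rule sum.swap)
    finally show ?thesis .
  qed
  then have "sopp A (\<Sum>i\<in>I. a i) (\<Sum>j\<in>J. b j) = (\<Sum>p\<in>UNIV. \<Sum>q\<in>UNIV. \<Sum>(i, j)\<in>I \<times> J.
         mul A (koszul p q (component (par A) (b j) q)) (component (par A) (a i) p))"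
    unfolding sopp_def S_def[symmetric] by simp
  also have "\<dots> = (\<Sum>(p, q, i, j)\<in>UNIV \<times> UNIV \<times> I \<times> J.
         mul A (koszul p q (component (par A) (b j) q)) (component (par A) (a i) p))"
    by (simp only: sum.cartesian_product)
  finally show ?thesis .
qed

text \<open>In a_(-1-j) b_(m+j) and in b_(m-1-j) a_j alike, the degree of the left factor grows with
  j and that of the right factor falls.\<close>

lemma normal_ordered_converges:
  assumes a: "a \<in> dist_carrier A" and b: "b \<in> dist_carrier A"
  shows "\<exists>l. fz_converges A (\<lambda>j. mul A (a (- 1 - int j)) (b (m + int j))) l"
    and "\<exists>l. fz_converges A (\<lambda>j. sopp A (a (int j)) (b (m - 1 - int j))) l"
proof -
  obtain n :: nat and \<eta> \<alpha> where \<alpha>: "\<forall>i<n. \<alpha> i \<in> homogeneous_dist A (\<eta> i)"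
    and a_sum: "\<forall>t. a t = (\<Sum>i<n. \<alpha> i t)" using dist_carrier_sum[OF a] by blast
  obtain n' :: nat and \<theta> \<beta> where \<beta>: "\<forall>i<n'. \<beta> i \<in> homogeneous_dist A (\<theta> i)"
    and b_sum: "\<forall>t. b t = (\<Sum>i<n'. \<beta> i t)" using dist_carrier_sum[OF b] by blast
  have \<alpha>_deg: "\<alpha> i t \<in> deg A (\<eta> i - of_int t - 1)" if "i < n" for i t
    using \<alpha> that by (auto simp: homogeneous_dist_def)
  have \<beta>_deg: "\<beta> i t \<in> deg A (\<theta> i - of_int t - 1)" if "i < n'" for i t
    using \<beta> that by (auto simp: homogeneous_dist_def)
  have \<alpha>_car: "\<alpha> i t \<in> car A" if "i < n" for i t using \<alpha>_deg[OF that] deg_car by blast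
  have \<beta>_car: "\<beta> i t \<in> car A" if "i < n'" for i t using \<beta>_deg[OF that] deg_car by blast
  show "\<exists>l. fz_converges A (\<lambda>j. mul A (a (- 1 - int j)) (b (m + int j))) l"
  proof (rule fz_converges_products)
    show "finite ({..<n} \<times> {..<n'})" by simp
    show "(\<lambda>i j. \<alpha> (fst i) (- 1 - int j)) i j \<in> deg A ((\<lambda>i. \<eta> (fst i)) i + of_nat j)"
      if "i \<in> {..<n} \<times> {..<n'}" for i j
      using \<alpha>_deg[of "fst i" "- 1 - int j"] that by (auto simp: algebra_simps)
    show "(\<lambda>i j. \<beta> (snd i) (m + int j)) i j \<in> deg A ((\<lambda>i. \<theta> (snd i) - of_int m - 1) i - of_nat j)"
      if "i \<in> {..<n} \<times> {..<n'}" for i j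
      using \<beta>_deg[of "snd i" "m + int j"] that by (auto simp: algebra_simps)
    show "mul A (a (- 1 - int j)) (b (m + int j))
      = (\<Sum>i\<in>{..<n} \<times> {..<n'}. mul A (\<alpha> (fst i) (- 1 - int j)) (\<beta> (snd i) (m + int j)))" for j
      unfolding a_sum[rule_format] b_sum[rule_format]
      by (subst mul_sum_sum) (use \<alpha>_car \<beta>_car in \<open>auto simp: split_def\<close>)
  qed
  show "\<exists>l. fz_converges A (\<lambda>j. sopp A (a (int j)) (b (m - 1 - int j))) l"
  proof (rule fz_converges_products)
    let ?I = "(UNIV :: bool set) \<times> (UNIV :: bool set) \<times> {..<n} \<times> {..<n'}"
    show "finite ?I" by simp
    show "(\<lambda>(p, q, i, i') j. koszul p q (component (par A) (\<beta> i' (m - 1 - int j)) q)) i j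
        \<in> deg A ((\<lambda>(p, q, i, i'). \<theta> i' - of_int m) i + of_nat j)" if "i \<in> ?I" for i j
    proof -
      obtain p q i1 i2 where i: "i = (p, q, i1, i2)" "i2 < n'" using \<open>i \<in> ?I\<close> by auto
      have "component (par A) (\<beta> i2 (m - 1 - int j)) q \<in> deg A (\<theta> i2 - of_int m + of_nat j)"
        using par_component_deg[OF \<beta>_deg[OF i(2), of "m - 1 - int j"]] by (simp add: algebra_simps)
      then show ?thesis
        by (simp add: i koszul_scale dg.subspace_G subspace_scale)
    qed
    show "(\<lambda>(p, q, i, i') j. component (par A) (\<alpha> i (int j)) p) i j
        \<in> deg A ((\<lambda>(p, q, i, i'). \<eta> i - 1) i - of_nat j)" if "i \<in> ?I" for i j
    proof -
      obtain p q i1 i2 where i: "i = (p, q, i1, i2)" "i1 < n" using \<open>i \<in> ?I\<close> by auto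
      show ?thesis
        using par_component_deg[OF \<alpha>_deg[OF i(2), of "int j"]] by (simp add: i algebra_simps)
    qed
    show "sopp A (a (int j)) (b (m - 1 - int j))
      = (\<Sum>i\<in>?I. mul A ((\<lambda>(p, q, i, i') j. koszul p q (component (par A) (\<beta> i' (m - 1 - int j)) q)) i j)
           ((\<lambda>(p, q, i, i') j. component (par A) (\<alpha> i (int j)) p) i j))" for j
      unfolding a_sum[rule_format] b_sum[rule_format]
        by (subst sopp_sum) (auto simp: \<alpha>_car \<beta>_car split_def)
  qed
qed

end

section \<open>Morphisms\<close>

lemma sum_apply: "(\<Sum>i\<in>I. f i) t = (\<Sum>i\<in>I. f i t)"
  by (induction I rule: infinite_finite_induct) simp_all

lemma dist_simps [simp]:
  "scl (dist A) = dist_scl A" "car (dist A) = dist_carrier A"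
  "par (dist A) p = {a \<in> dist_carrier A. \<forall>t. a t \<in> par A p}" "deg (dist A) = homogeneous_dist A"
  "mul (dist A) = normal_ordered A" "one (dist A) = (\<lambda>t. if t = - 1 then one A else 0)"
  "der (dist A) = (\<lambda>a t. scl A (- of_int t) (a (t - 1)))" "lam (dist A) = dist_lam A"
  by (simp_all add: dist_def)

lemma fz_homD:
  assumes "\<phi> \<in> fz_hom A B"
  shows "x \<in> car A \<Longrightarrow> \<phi> x \<in> car B" "x \<in> car A \<Longrightarrow> y \<in> car A \<Longrightarrow> \<phi> (x + y) = \<phi> x + \<phi> y"
    and "x \<in> car A \<Longrightarrow> \<phi> (scl A c x) = scl B c (\<phi> x)" "x \<in> par A p \<Longrightarrow> \<phi> x \<in> par B p"
    and "x \<in> deg A h \<Longrightarrow> \<phi> x \<in> deg B h" "\<phi> (one A) = one B"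
    and "x \<in> car A \<Longrightarrow> y \<in> car A \<Longrightarrow> \<phi> (mul A x y) = mul B (\<phi> x) (\<phi> y)"
    and "continuous_map (topo A h) (topo B h) \<phi>" "\<phi> \<in> extensional (car A)"
  using assms by (simp_all add: fz_hom_def even_map_def lin_map_def preserves_degree_def)

lemma fz_homI:
  assumes "\<phi> \<in> extensional (car A)"
    and "\<And>x. x \<in> car A \<Longrightarrow> \<phi> x \<in> car B" "\<And>x y. x \<in> car A \<Longrightarrow> y \<in> car A \<Longrightarrow> \<phi> (x + y) = \<phi> x + \<phi> y"
    and "\<And>c x. x \<in> car A \<Longrightarrow> \<phi> (scl A c x) = scl B c (\<phi> x)" "\<And>p x. x \<in> par A p \<Longrightarrow> \<phi> x \<in> par B p"
    and "\<And>h x. x \<in> deg A h \<Longrightarrow> \<phi> x \<in> deg B h" "\<phi> (one A) = one B"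
    and "\<And>x y. x \<in> car A \<Longrightarrow> y \<in> car A \<Longrightarrow> \<phi> (mul A x y) = mul B (\<phi> x) (\<phi> y)"
    and "\<And>h. continuous_map (topo A h) (topo B h) \<phi>"
  shows "\<phi> \<in> fz_hom A B"
  using assms by (simp add: fz_hom_def even_map_def lin_map_def preserves_degree_def)

lemma va_homD:
  assumes "f \<in> va_hom V W"
  shows "f \<in> extensional (car V)" "x \<in> car V \<Longrightarrow> f x \<in> car W"
    and "x \<in> car V \<Longrightarrow> y \<in> car V \<Longrightarrow> f (x + y) = f x + f y"
    and "x \<in> car V \<Longrightarrow> f (scl V c x) = scl W c (f x)" "x \<in> par V p \<Longrightarrow> f x \<in> par W p"
    and "x \<in> deg V h \<Longrightarrow> f x \<in> deg W h" "f (one V) = one W"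
    and "x \<in> car V \<Longrightarrow> f (der V x) = der W (f x)"
    and "x \<in> car V \<Longrightarrow> y \<in> car V \<Longrightarrow> f (mul V x y) = mul W (f x) (f y)"
    and "x \<in> car V \<Longrightarrow> y \<in> car V \<Longrightarrow> f (lam V n x y) = lam W n (f x) (f y)"
  using assms by (simp_all add: va_hom_def even_map_def lin_map_def preserves_degree_def)

lemma va_homI:
  assumes "f \<in> extensional (car V)" "\<And>x. x \<in> car V \<Longrightarrow> f x \<in> car W"
    and "\<And>x y. x \<in> car V \<Longrightarrow> y \<in> car V \<Longrightarrow> f (x + y) = f x + f y"
    and "\<And>c x. x \<in> car V \<Longrightarrow> f (scl V c x) = scl W c (f x)" "\<And>p x. x \<in> par V p \<Longrightarrow> f x \<in> par W p"
    and "\<And>h x. x \<in> deg V h \<Longrightarrow> f x \<in> deg W h" "f (one V) = one W"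
    and "\<And>x. x \<in> car V \<Longrightarrow> f (der V x) = der W (f x)"
    and "\<And>x y. x \<in> car V \<Longrightarrow> y \<in> car V \<Longrightarrow> f (mul V x y) = mul W (f x) (f y)"
    and "\<And>n x y. x \<in> car V \<Longrightarrow> y \<in> car V \<Longrightarrow> f (lam V n x y) = lam W n (f x) (f y)"
  shows "f \<in> va_hom V W"
  using assms by (simp add: va_hom_def even_map_def lin_map_def preserves_degree_def)

locale graded_va = graded_superspace \<rho> V
  for \<rho> :: rat and V :: "('k::field_char_0, 'v::ab_group_add) vertex_alg" +
  assumes unbounded: "graded_unbounded_vertex_algebra \<rho> V"
begin

lemma va_closed [simp]:
  "one V \<in> car V" "x \<in> car V \<Longrightarrow> der V x \<in> car V"
  "x \<in> car V \<Longrightarrow> y \<in> car V \<Longrightarrow> mul V x y \<in> car V"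
  "x \<in> car V \<Longrightarrow> y \<in> car V \<Longrightarrow> lam V n x y \<in> car V"
  using unbounded
  by (simp_all add: graded_unbounded_vertex_algebra_def is_unit_def even_derivation_def even_map_def
      lin_map_def even_bilin_def)

lemma va_hom_compose:
  assumes f: "f \<in> va_hom V W" and g: "g \<in> va_hom W Z"
  shows "compose (car V) g f \<in> va_hom V Z"
proof -
  have eq: "compose (car V) g f x = g (f x)" if "x \<in> car V" for x
    using that by (simp add: compose_eq)
  show ?thesis
    by (rule va_homI) (simp_all add: eq deg_car par_car va_homD[OF f] va_homD[OF g])
qed

lemma va_hom_id: "(\<lambda>x\<in>car V. x) \<in> va_hom V V"
  by (rule va_homI) (simp_all add: deg_car par_car)

end

lemma graded_vaI: "graded_unbounded_vertex_algebra \<rho> V \<Longrightarrow> graded_va \<rho> V"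
  by unfold_locales (auto simp: graded_unbounded_vertex_algebra_def)

context fz_complete_algebra
begin

lemma one_car [simp]: "one A \<in> car A"
  using graded_associative by (simp add: graded_associative_algebra_def is_unit_def)

lemma sopp_car [simp]: "x \<in> car A \<Longrightarrow> y \<in> car A \<Longrightarrow> sopp A x y \<in> car A"
  unfolding sopp_def by (intro sum_car) simp

lemma scomm_car [simp]: "x \<in> car A \<Longrightarrow> y \<in> car A \<Longrightarrow> scomm A x y \<in> car A"
  unfolding scomm_def by simp

lemma fz_hom_id: "(\<lambda>x\<in>car A. x) \<in> fz_hom A A"
proof (rule fz_homI)
  show "continuous_map (topo A h) (topo A h) (\<lambda>x\<in>car A. x)" for h
    by (rule continuous_map_eq[OF continuous_map_id]) (simp add: deg_car)
qed (simp_all add: deg_car par_car)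

lemma fz_hom_compose:
  assumes f: "\<phi> \<in> fz_hom A B" and g: "\<psi> \<in> fz_hom B C"
  shows "compose (car A) \<psi> \<phi> \<in> fz_hom A C"
proof -
  have eq: "compose (car A) \<psi> \<phi> x = \<psi> (\<phi> x)" if "x \<in> car A" for x
    using that by (simp add: compose_eq)
  show ?thesis
  proof (rule fz_homI)
    show "continuous_map (topo A h) (topo C h) (compose (car A) \<psi> \<phi>)" for h
      by (rule continuous_map_eq[OF continuous_map_compose[OF fz_homD(8)[OF f] fz_homD(8)[OF g]]])
        (simp add: eq deg_car)
  qed (simp_all add: eq deg_car par_car fz_homD[OF f] fz_homD[OF g])
qed

end

section \<open>Continuous morphisms acting on distributions\<close>

locale fz_morphism = A: fz_complete_algebra \<rho> A + B: fz_complete_algebra \<rho> B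
  for \<rho> :: rat and A :: "('k::field_char_0, 'a::ab_group_add, 'z) fz_alg_scheme"
    and B :: "('k, 'b::ab_group_add, 'y) fz_alg_scheme" +
  fixes \<phi> :: "'a \<Rightarrow> 'b"
  assumes hom: "\<phi> \<in> fz_hom A B"
begin

lemmas hom_simps [simp] = fz_homD(1-7)[OF hom]

lemma hom_zero [simp]: "\<phi> 0 = 0"
  using hom_simps(3)[of 0 0] by simp

lemma hom_sum: "(\<And>i. i \<in> I \<Longrightarrow> f i \<in> car A) \<Longrightarrow> \<phi> (\<Sum>i\<in>I. f i) = (\<Sum>i\<in>I. \<phi> (f i))"
  by (induction I rule: infinite_finite_induct) (simp_all add: A.sum_car)

lemma hom_minus: "x \<in> car A \<Longrightarrow> \<phi> (- x) = - \<phi> x"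
  using hom_simps(3)[of x "- 1"] by simp

lemma hom_diff: "x \<in> car A \<Longrightarrow> y \<in> car A \<Longrightarrow> \<phi> (x - y) = \<phi> x - \<phi> y"
  using hom_simps(2)[of x "- y"] by (simp add: hom_minus)

lemma hom_koszul: "x \<in> car A \<Longrightarrow> \<phi> (koszul p q x) = koszul p q (\<phi> x)"
  by (simp add: koszul_def hom_minus)

lemma hom_component:
  assumes "x \<in> car A"
  shows "component (par B) (\<phi> x) p = \<phi> (component (par A) x p)"
    and "component (deg B) (\<phi> x) h = \<phi> (component (deg A) x h)"
  using component_map[OF A.pr.internal_direct_sum_axioms B.pr.internal_direct_sum_axioms, of \<phi> "\<lambda>i. i" x]
    component_map[OF A.dg.internal_direct_sum_axioms B.dg.internal_direct_sum_axioms,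
      of \<phi> "\<lambda>i. i" x] assms
  by simp_all

lemma hom_sopp: "x \<in> car A \<Longrightarrow> y \<in> car A \<Longrightarrow> \<phi> (sopp A x y) = sopp B (\<phi> x) (\<phi> y)"
  by (simp add: sopp_def hom_sum hom_koszul hom_component A.sum_car)

lemma hom_scomm: "x \<in> car A \<Longrightarrow> y \<in> car A \<Longrightarrow> \<phi> (scomm A x y) = scomm B (\<phi> x) (\<phi> y)"
  by (simp add: scomm_def hom_diff hom_sopp)

text \<open>Continuity in each degree carries the limits over, because \<open>\<phi>\<close>
  commutes with degree components and finite sums.\<close>

lemma hom_converges:
  assumes x: "\<And>j. x j \<in> car A" and l: "fz_converges A x l"
  shows "fz_converges B (\<lambda>j. \<phi> (x j)) (\<phi> l)"
  unfolding fz_converges_def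
proof (intro conjI allI)
  have lcar: "l \<in> car A" using l by (simp only: fz_converges_def)
  then show "\<phi> l \<in> car B" by simp
  fix h
  have "limitin (topo A h) (\<lambda>N. \<Sum>j<N. component (deg A) (x j) h) (component (deg A) l h) sequentially"
    using l by (simp only: fz_converges_def)
  from continuous_map_limit[OF fz_homD(8)[OF hom] this]
  have "limitin (topo B h) (\<lambda>N. \<phi> (\<Sum>j<N. component (deg A) (x j) h)) (\<phi> (component (deg A) l h))
    sequentially"
    by (simp only: comp_def)
  then show "limitin (topo B h) (\<lambda>N. \<Sum>j<N. component (deg B) (\<phi> (x j)) h) (component (deg B) (\<phi> l)
    h) sequentially"
    by (simp only: hom_component x lcar hom_sum A.component_deg_car)
qed

lemma hom_suminf:
  assumes x: "\<And>j. x j \<in> car A" and l: "\<exists>l. fz_converges A x l"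
  shows "\<phi> (fz_suminf A x) = fz_suminf B (\<lambda>j. \<phi> (x j))" "fz_suminf A x \<in> car A"
proof -
  from l obtain l where l: "fz_converges A x l" ..
  show "\<phi> (fz_suminf A x) = fz_suminf B (\<lambda>j. \<phi> (x j))"
    by (simp only: A.fz_suminf_eq[OF l] B.fz_suminf_eq[OF hom_converges[OF x l]])
  show "fz_suminf A x \<in> car A"
    using l by (simp only: A.fz_suminf_eq[OF l] fz_converges_def)
qed

lemma hom_normal_ordered:
  assumes a: "a \<in> dist_carrier A" and b: "b \<in> dist_carrier A"
  shows "\<phi> (normal_ordered A a b t) = normal_ordered B (\<lambda>t. \<phi> (a t)) (\<lambda>t. \<phi> (b t)) t"
proof -
  have car: "a t \<in> car A" "b t \<in> car A" for t using a b A.dist_carrier_car by blast+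
  show ?thesis
    unfolding normal_ordered_def
    by (simp add: car hom_suminf A.normal_ordered_converges[OF a b] hom_sopp)
qed

lemma hom_dist_lam:
  assumes a: "a \<in> dist_carrier A" and b: "b \<in> dist_carrier A"
  shows "\<phi> (dist_lam A n a b t) = dist_lam B n (\<lambda>t. \<phi> (a t)) (\<lambda>t. \<phi> (b t)) t"
proof -
  have car: "a t \<in> car A" "b t \<in> car A" for t using a b A.dist_carrier_car by blast+
  show ?thesis
    unfolding dist_lam_def by (simp add: car hom_sum hom_scomm A.sum_car)
qed

lemma hom_homogeneous: "a \<in> homogeneous_dist A h \<Longrightarrow> (\<lambda>t. \<phi> (a t)) \<in> homogeneous_dist B h"
  by (simp add: homogeneous_dist_def)

lemma hom_dist_carrier:
  assumes a: "a \<in> dist_carrier A"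
  shows "(\<lambda>t. \<phi> (a t)) \<in> dist_carrier B"
proof -
  interpret d: vector_space "dist_scl B" by (rule B.vector_space_dist_scl)
  obtain n :: nat and \<eta> \<alpha> where \<alpha>: "\<forall>i<n. \<alpha> i \<in> homogeneous_dist A (\<eta> i)"
    and a_sum: "\<forall>t. a t = (\<Sum>i<n. \<alpha> i t)" using A.dist_carrier_sum[OF a] by blast
  have car: "\<alpha> i t \<in> car A" if "i \<in> {..<n}" for i t
    using \<alpha> that A.deg_car unfolding homogeneous_dist_def by blast
  have "(\<lambda>t. \<phi> (a t)) = (\<Sum>i<n. (\<lambda>t. \<phi> (\<alpha> i t)))"
    unfolding a_sum[rule_format] by (rule ext) (simp only: sum_apply, rule hom_sum, rule car)
  also have "\<dots> \<in> dist_carrier B"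
    by (rule d.subspace_sum[OF B.subspace_dist_carrier])
      (use \<alpha> hom_homogeneous B.homogeneous_dist_carrier in blast)
  finally show ?thesis .
qed

text \<open>\<open>\<phi>\<close> is applied coefficientwise. Brackets are finite sums of
  commutators; the normally ordered product is the one operation for which continuity of
  \<open>\<phi>\<close> is needed.\<close>

lemma va_hom_dist:
  assumes V: "graded_va \<rho> V" and y: "y \<in> va_hom V (dist A)"
  shows "(\<lambda>a\<in>car V. \<lambda>t. \<phi> (y a t)) \<in> va_hom V (dist B)"
proof -
  interpret V: graded_va \<rho> V by fact
  have dc: "y a \<in> dist_carrier A" if "a \<in> car V" for a
    using va_homD(2)[OF y that] by simp
  have car: "y a t \<in> car A" if "a \<in> car V" for a t
    using A.dist_carrier_car[OF dc[OF that]] .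
  show ?thesis
  proof (rule va_homI)
    show "(\<lambda>a\<in>car V. \<lambda>t. \<phi> (y a t)) x \<in> car (dist B)" if "x \<in> car V" for x
      using that by (simp add: hom_dist_carrier dc)
    show "(\<lambda>a\<in>car V. \<lambda>t. \<phi> (y a t)) x \<in> par (dist B) p" if "x \<in> par V p" for p x
      using va_homD(5)[OF y that] V.par_car[OF that] by (simp add: hom_dist_carrier dc)
    show "(\<lambda>a\<in>car V. \<lambda>t. \<phi> (y a t)) x \<in> deg (dist B) h" if "x \<in> deg V h" for h x
      using va_homD(6)[OF y that] V.deg_car[OF that] by (simp add: hom_homogeneous)
  qed (simp_all add: fun_eq_iff va_homD[OF y] dist_scl_def dc car hom_minus hom_normal_ordered
    hom_dist_lam)
qed

end

text \<open>Taking the t-th coefficient of \<open>Y\<close> commutes with components, up to the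
  shift of degrees by t + 1. So \<open>Y\<close> kills every component of w of the wrong parity or
  degree, and by injectivity that component is 0.\<close>

lemma va_hom_reflects_grading:
  assumes V: "graded_va \<rho> W" and B: "fz_complete_algebra \<rho> B"
    and Y: "Y \<in> va_hom W (dist B)" "inj_on Y (car W)" and w: "w \<in> car W"
  shows "Y w \<in> par (dist B) p \<Longrightarrow> w \<in> par W p" and "Y w \<in> deg (dist B) h \<Longrightarrow> w \<in> deg W h"
proof -
  interpret W: graded_va \<rho> W by fact
  interpret B: fz_complete_algebra \<rho> B by fact
  have Y0: "Y 0 = 0"
    using va_homD(4)[OF Y(1), of 0 0] by (simp add: dist_scl_def fun_eq_iff)
  have zero: "v = 0" if "v \<in> car W" "\<And>t. Y v t = 0" for v
  proof -
    have "Y v = Y 0" using that by (simp add: Y0 fun_eq_iff)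
    then show ?thesis using Y(2) that by (simp add: inj_on_def)
  qed
  have add: "Y (x + y) t = Y x t + Y y t" if "x \<in> car W" "y \<in> car W" for x y t
    using va_homD(3)[OF Y(1) that] by simp
  {
    assume "Y w \<in> par (dist B) p"
    then have p: "Y w t \<in> par B p" for t by simp
    show "w \<in> par W p"
    proof (rule W.pr.in_G_by_components[OF w])
      fix q assume "q \<noteq> p"
      show "component (par W) w q = 0"
      proof (rule zero)
        fix t
        have "component (par B) (Y w t) q = Y (component (par W) w q) t"
          by (rule component_map[OF W.pr.internal_direct_sum_axioms B.pr.internal_direct_sum_axioms,
                of "\<lambda>w. Y w t" "\<lambda>i. i"])
            (use add va_homD(5)[OF Y(1)] w in auto)
        then show "Y (component (par W) w q) t = 0"
          using B.pr.component_homogeneous[OF p] \<open>q \<noteq> p\<close> by simp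
      qed (use w in simp)
    qed
  }
  {
    assume "Y w \<in> deg (dist B) h"
    then have p: "Y w t \<in> deg B (h - of_int t - 1)" for t by (simp add: homogeneous_dist_def)
    show "w \<in> deg W h"
    proof (rule W.dg.in_G_by_components[OF w])
      fix k assume "k \<noteq> h"
      show "component (deg W) w k = 0"
      proof (rule zero)
        fix t
        have "component (deg B) (Y w t) (k - of_int t - 1) = Y (component (deg W) w k) t"
          by (rule component_map[OF W.dg.internal_direct_sum_axioms B.dg.internal_direct_sum_axioms,
                of "\<lambda>w. Y w t" "\<lambda>i. i - of_int t - 1"])
            (use add va_homD(6)[OF Y(1)] w in \<open>auto simp: inj_on_def homogeneous_dist_def\<close>)
        then show "Y (component (deg W) w k) t = 0"
          using B.dg.component_homogeneous[OF p] \<open>k \<noteq> h\<close> by simp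
      qed (use w in simp)
    qed
  }
qed

text \<open>The lift is y followed by the inverse of \<open>Y\<close> on its image. Compatibility
  with the operations follows from injectivity of \<open>Y\<close>, and with parity and degree from
  \<open>va_hom_reflects_grading\<close>.\<close>

lemma va_hom_lift:
  assumes V: "graded_va \<rho> V" and W: "graded_va \<rho> W" and B: "fz_complete_algebra \<rho> B"
    and Y: "Y \<in> va_hom W (dist B)" "inj_on Y (car W)"
    and y: "y \<in> va_hom V (dist B)" and range: "\<And>a. a \<in> car V \<Longrightarrow> y a \<in> Y ` car W"
  shows "\<exists>f\<in>va_hom V W. \<forall>a\<in>car V. Y (f a) = y a"
proof -
  interpret V: graded_va \<rho> V by fact
  interpret W: graded_va \<rho> W by fact
  interpret B: fz_complete_algebra \<rho> B by fact
  define f where "f = (\<lambda>a\<in>car V. inv_into (car W) Y (y a))"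
  have f_car: "f a \<in> car W" and Yf: "Y (f a) = y a" if "a \<in> car V" for a
    using range[OF that] that by (simp_all add: f_def inv_into_into f_inv_into_f)
  have eqI: "f a = w" if "a \<in> car V" "w \<in> car W" "y a = Y w" for a w
    using that by (simp add: f_def inv_into_f_f Y)
  note reflect = va_hom_reflects_grading[OF W B Y]
  have "f \<in> va_hom V W"
  proof (rule va_homI)
    show "f \<in> extensional (car V)" by (simp add: f_def)
    show "f x \<in> par W p" if "x \<in> par V p" for p x
      by (rule reflect(1)[OF f_car]) (use that V.par_car va_homD(5)[OF y that] in \<open>simp_all add: Yf\<close>)
    show "f x \<in> deg W h" if "x \<in> deg V h" for h x
      by (rule reflect(2)[OF f_car]) (use that V.deg_car va_homD(6)[OF y that] in \<open>simp_all add: Yf\<close>)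
  qed (simp_all add: f_car eqI Yf va_homD[OF Y(1)] va_homD[OF y] del: dist_simps)
  then show ?thesis using Yf by blast
qed

lemma va_generated_image:
  assumes W: "graded_va \<rho> W" and B: "fz_complete_algebra \<rho> B" and Y: "Y \<in> va_hom W (dist B)"
  shows "va_generated (dist B) (Y ` car W) \<subseteq> Y ` car W"
proof -
  interpret W: graded_va \<rho> W by fact
  interpret B: fz_complete_algebra \<rho> B by fact
  interpret d: vector_space "dist_scl B" by (rule B.vector_space_dist_scl)
  note YD = va_homD[OF Y]
  have "d.subspace (Y ` car W)"
  proof (rule d.subspaceI)
    show "0 \<in> Y ` car W"
      using YD(4)[of 0 0] by (auto simp: dist_scl_def fun_eq_iff image_iff intro!: bexI[of _ 0])
  next
    fix x y assume "x \<in> Y ` car W" "y \<in> Y ` car W"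
    then obtain v w where "v \<in> car W" "x = Y v" "w \<in> car W" "y = Y w" by blast
    then show "x + y \<in> Y ` car W" using YD(3)[of v w] by (metis W.car_closed(2) image_eqI)
  next
    fix c x assume "x \<in> Y ` car W"
    then obtain v where "v \<in> car W" "x = Y v" by blast
    then show "dist_scl B c x \<in> Y ` car W" using YD(4)[of v c]
      by (metis W.car_closed(5) dist_simps(1) image_eqI)
  qed
  moreover have "Y ` car W \<subseteq> car (dist B)" using YD(2) by (intro image_subsetI)
  moreover have "one (dist B) \<in> Y ` car W"
    using imageI[of "one W" "car W" Y] by (simp only: YD(7) W.va_closed)
  moreover have "\<forall>a\<in>Y ` car W. der (dist B) a \<in> Y ` car W"
  proof (intro ballI, elim imageE)
    fix a v assume "a = Y v" "v \<in> car W"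
    then show "der (dist B) a \<in> Y ` car W"
      using imageI[of "der W v" "car W" Y] by (simp only: YD(8) W.va_closed)
  qed
  moreover have "\<forall>a\<in>Y ` car W. \<forall>b\<in>Y ` car W. mul (dist B) a b \<in> Y ` car W \<and>
      (\<forall>t. lam (dist B) t a b \<in> Y ` car W)"
  proof (intro ballI, elim imageE)
    fix a v b w assume "a = Y v" "v \<in> car W" "b = Y w" "w \<in> car W"
    then show "mul (dist B) a b \<in> Y ` car W \<and> (\<forall>t. lam (dist B) t a b \<in> Y ` car W)"
      using imageI[of "mul W v w" "car W" Y] imageI[of "lam W _ v w" "car W" Y]
      by (simp only: YD(9,10) W.va_closed) simp
  qed
  ultimately show ?thesis
    unfolding va_generated_def by (intro Inter_lower CollectI conjI order_refl) simp_all
qed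

section \<open>Associative vertex algebras\<close>

locale assoc_va = graded_va \<rho> V
  for \<rho> :: rat and V :: "('k::field_char_0, 'v::ab_group_add) vertex_alg" +
  assumes associative: "associative_graded_vertex_algebra \<rho> V"
begin

text \<open>A linear projection of the ambient space onto \<open>car V\<close>, which exists because
  subspaces have complements. Precomposing with it makes the operations total and linear everywhere,
  as \<open>vertex_products\<close> demands.\<close>

definition proj :: "'v \<Rightarrow> 'v" where
  "proj = (SOME g. range g \<subseteq> car V \<and> Vector_Spaces.linear (scl V) (scl V) g \<and> (\<forall>v\<in>car V. g v = v))"

lemma proj_exists: "range proj \<subseteq> car V \<and> Vector_Spaces.linear (scl V) (scl V) proj
  \<and> (\<forall>v\<in>car V. proj v = v)"
proof -
  interpret vector_space_pair "scl V" "scl V" by unfold_locales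
  have "\<exists>g. range g \<subseteq> car V \<and> Vector_Spaces.linear (scl V) (scl V) g \<and> (\<forall>v\<in>car V. g v = v)"
    using linear_exists_left_inverse_on[OF linear_id subspace_car] by auto
  from someI_ex[OF this] show ?thesis unfolding proj_def .
qed

lemma proj_car [simp]: "proj x \<in> car V"
  and proj_id [simp]: "x \<in> car V \<Longrightarrow> proj x = x"
  using proj_exists by auto

lemma proj_add: "proj (x + y) = proj x + proj y" and proj_scale: "proj (scl V c x) = scl V c (proj x)"
  using proj_exists by (auto simp: Vector_Spaces.linear_iff)

lemma der_add: "x \<in> car V \<Longrightarrow> y \<in> car V \<Longrightarrow> der V (x + y) = der V x + der V y"
  and der_scale: "x \<in> car V \<Longrightarrow> der V (scl V c x) = scl V c (der V x)"
  and der_mul: "x \<in> car V \<Longrightarrow> y \<in> car V \<Longrightarrow> der V (mul V x y) = mul V (der V x) y + mul V x (der V y)"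
  and der_par: "x \<in> par V p \<Longrightarrow> der V x \<in> par V p"
  using unbounded
  by (simp_all add: graded_unbounded_vertex_algebra_def even_derivation_def even_map_def lin_map_def)

lemma der_lam: "x \<in> car V \<Longrightarrow> y \<in> car V \<Longrightarrow> der V (lam V n x y) = lam V n (der V x) y + lam V n x (der V y)"
  and lam_der: "x \<in> car V \<Longrightarrow> y \<in> car V \<Longrightarrow> lam V n (der V x) y
    = (if n = 0 then 0 else scl V (- of_nat n) (lam V (n - 1) x y))"
  and mul_one: "x \<in> car V \<Longrightarrow> mul V x (one V) = x"
  and lam_one: "x \<in> car V \<Longrightarrow> lam V n (one V) x = 0"
  and one_mul: "x \<in> car V \<Longrightarrow> mul V (one V) x = x"
  and nprod_deg: "a \<in> deg V h \<Longrightarrow> b \<in> deg V k \<Longrightarrow> nprod V t a b \<in> deg V (h + k - of_int t - 1)"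
  using unbounded by (simp_all add: graded_unbounded_vertex_algebra_def is_unit_def)

lemma dpow_car [simp]: "x \<in> car V \<Longrightarrow> dpow V j x \<in> car V"
proof -
  assume "x \<in> car V"
  then have "(der V ^^ j) x \<in> car V" by (induction j) simp_all
  then show ?thesis by (simp add: dpow_def)
qed

lemma nprod_car [simp]: "x \<in> car V \<Longrightarrow> y \<in> car V \<Longrightarrow> nprod V n x y \<in> car V"
  by (simp add: nprod_def)

lemma dpow_par: "x \<in> par V p \<Longrightarrow> dpow V j x \<in> par V p"
proof -
  assume "x \<in> par V p"
  then have "(der V ^^ j) x \<in> par V p" by (induction j) (simp_all add: der_par)
  then show ?thesis by (simp add: dpow_def pr.subspace_G subspace_scale)
qed

lemma dpow_add: "x \<in> car V \<Longrightarrow> y \<in> car V \<Longrightarrow> dpow V j (x + y) = dpow V j x + dpow V j y"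
  and dpow_scale: "x \<in> car V \<Longrightarrow> dpow V j (scl V c x) = scl V c (dpow V j x)"
proof -
  have car: "(der V ^^ j) x \<in> car V" if "x \<in> car V" for x j
    using that by (induction j) simp_all
  show "dpow V j (x + y) = dpow V j x + dpow V j y" if "x \<in> car V" "y \<in> car V"
  proof -
    have "(der V ^^ j) (x + y) = (der V ^^ j) x + (der V ^^ j) y"
      using that by (induction j) (simp_all add: der_add car)
    then show ?thesis by (simp add: dpow_def scale_right_distrib)
  qed
  show "dpow V j (scl V c x) = scl V c (dpow V j x)" if "x \<in> car V"
  proof -
    have "(der V ^^ j) (scl V c x) = scl V c ((der V ^^ j) x)"
      using that by (induction j) (simp_all add: der_scale car)
    then show ?thesis by (simp add: dpow_def mult.commute)
  qed
qed

lemma even_bilinD: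
  assumes "even_bilin V m"
  shows "x \<in> car V \<Longrightarrow> x' \<in> car V \<Longrightarrow> y \<in> car V \<Longrightarrow> m (x + x') y = m x y + m x' y"
    and "x \<in> car V \<Longrightarrow> y \<in> car V \<Longrightarrow> y' \<in> car V \<Longrightarrow> m x (y + y') = m x y + m x y'"
    and "x \<in> car V \<Longrightarrow> y \<in> car V \<Longrightarrow> m (scl V c x) y = scl V c (m x y)"
    and "x \<in> car V \<Longrightarrow> y \<in> car V \<Longrightarrow> m x (scl V c y) = scl V c (m x y)"
    and "x \<in> par V p \<Longrightarrow> y \<in> par V q \<Longrightarrow> m x y \<in> par V (p \<noteq> q)"
  using assms unfolding even_bilin_def lin_map_def by blast+

lemma even_bilin_mul: "even_bilin V (mul V)" and even_bilin_lam: "even_bilin V (lam V n)"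
  using unbounded by (simp_all add: graded_unbounded_vertex_algebra_def)

lemmas nprod_bilin = even_bilinD[OF even_bilin_mul] even_bilinD[OF even_bilin_lam] dpow_add dpow_scale

lemma nprod_add_left: "x \<in> car V \<Longrightarrow> x' \<in> car V \<Longrightarrow> y \<in> car V \<Longrightarrow> nprod V n (x + x') y = nprod V n x y
  + nprod V n x' y"
  and nprod_add_right: "x \<in> car V \<Longrightarrow> y \<in> car V \<Longrightarrow> y' \<in> car V \<Longrightarrow> nprod V n x (y + y') = nprod V n x y
    + nprod V n x y'"
  and nprod_scale_left: "x \<in> car V \<Longrightarrow> y \<in> car V \<Longrightarrow> nprod V n (scl V c x) y = scl V c (nprod V n x y)"
  and nprod_scale_right: "x \<in> car V \<Longrightarrow> y \<in> car V \<Longrightarrow> nprod V n x (scl V c y) = scl V c (nprod V n x y)"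
  by (simp_all add: nprod_def nprod_bilin)

lemma nprod_par: "x \<in> par V p \<Longrightarrow> y \<in> par V q \<Longrightarrow> nprod V n x y \<in> par V (p \<noteq> q)"
  using even_bilinD(5)[OF even_bilin_mul] even_bilinD(5)[OF even_bilin_lam] dpow_par
  unfolding nprod_def by presburger

lemma nprod_of_nat [simp]: "nprod V (int n) = lam V n"
  by (simp add: nprod_def fun_eq_iff)

lemma nprod_minus_one [simp]: "nprod V (- 1) = mul V"
  by (simp add: nprod_def dpow_def fun_eq_iff)

lemma nprod_neg: "nprod V (- 1 - int t) x y = mul V (dpow V t x) y"
  by (simp add: nprod_def)

text \<open>The outer \<open>proj\<close> matters for t = 0, where the divided power returns x
  itself, which may lie outside \<open>car V\<close>.\<close>

lemma proj_divpow:
  "proj (divpow (scl V) (\<lambda>x. der V (proj x)) t x) = dpow V t (proj x)"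
proof -
  have "proj (((\<lambda>x. der V (proj x)) ^^ t) x) = (der V ^^ t) (proj x)"
  proof (induction t)
    case (Suc t)
    have "(der V ^^ t) (proj x) \<in> car V" by (induction t) simp_all
    with Suc show ?case by simp
  qed simp
  then show ?thesis by (simp add: divpow_def dpow_def proj_scale)
qed

lemma divpow_car:
  assumes "x \<in> car V"
  shows "divpow (scl V) (\<lambda>x. der V (proj x)) t x = dpow V t x"
proof -
  have "((\<lambda>x. der V (proj x)) ^^ t) x = (der V ^^ t) x \<and> (der V ^^ t) x \<in> car V"
    using assms by (induction t) simp_all
  then show ?thesis by (simp add: divpow_def dpow_def)
qed

lemma koszul_sign: "koszul p q x = scl V (koszul_sign p q) x"
  by (simp add: koszul_def koszul_sign_def)

lemma par_id: "x \<in> par V p \<Longrightarrow> proj x = x"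
  using par_car by simp

text \<open>Passes from the sums over supports in the axioms to the sums over j < N in
  \<open>vertex_products\<close>.\<close>

lemma sum_support: "\<forall>j\<ge>N. f j = 0 \<Longrightarrow> (\<And>j. f j = 0 \<Longrightarrow> g j = 0) \<Longrightarrow> (\<Sum>j | f j \<noteq> 0. g j) = (\<Sum>j<(N::nat). g j)"
  by (rule sum.mono_neutral_left) (auto simp: not_less not_le intro: leI)

lemma dpow_zero [simp]: "dpow V j 0 = 0"
  using dpow_scale[of 0 j 0] by simp

lemma associative_axioms:
  shows "comm_associativity V" "lam_jacobi V" "lam_skew V" "quasi_commutativity V" "wick_formula V"
    and lam_bounded: "a \<in> car V \<Longrightarrow> b \<in> car V \<Longrightarrow> \<exists>N. \<forall>t\<ge>N. lam V t a b = 0"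
  using associative by (simp_all add: associative_graded_vertex_algebra_def graded_vertex_algebra_def)

sublocale products: vertex_products "scl V" "\<lambda>x. der V (proj x)" "\<lambda>n x y. nprod V n (proj x) (proj
  y)" "par V"
proof unfold_locales
  fix x y z :: 'v and p q
  show "nprod V (- 1 - int t) (proj x) (proj y)
    = nprod V (- 1) (proj (divpow (scl V) (\<lambda>x. der V (proj x)) t x)) (proj y)" for t
    by (simp add: proj_divpow nprod_neg)
  show "\<exists>N. \<forall>t\<ge>N. nprod V (int t) (proj x) (proj y) = 0"
    by (simp add: lam_bounded)
  show "nprod V (int t) (proj (der V (proj x))) (proj y)
      = scl V (- of_nat t) (nprod V (int t - 1) (proj x) (proj y))" for t
  \<comment> \<open>For t = 0 the index t - 1 belongs to the multiplication instead of the bracket,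
    but its coefficient is 0.\<close>
  proof (cases t)
    case 0
    then show ?thesis by (simp add: nprod_def lam_der)
  next
    case (Suc k)
    then have "int t - 1 = int k" by simp
    then show ?thesis
      by (simp only: nprod_of_nat proj_id proj_car va_closed lam_der) (simp add: Suc)
  qed
  assume x: "x \<in> par V p"
  then have xc: "x \<in> car V" by (rule par_car)
  show "der V (proj x) \<in> par V p" using x by (simp add: par_id der_par)
  assume y: "y \<in> par V q"
  then have yc: "y \<in> car V" by (rule par_car)
  show "nprod V n (proj x) (proj y) \<in> par V (p \<noteq> q)" for n
    unfolding par_id[OF x] par_id[OF y] using x y by (rule nprod_par)
  show "nprod V (- 1) (proj (nprod V (- 1) (proj x) (proj y)
          - scl V (koszul_sign p q) (nprod V (- 1) (proj y) (proj x)))) (proj z) =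
       nprod V (- 1) (proj x) (proj (nprod V (- 1) (proj y) (proj z))) -
       scl V (koszul_sign p q) (nprod V (- 1) (proj y) (proj (nprod V (- 1) (proj x) (proj z))))"
    using associative_axioms(1) x y xc yc by (simp add: comm_associativity_def koszul_sign)
  show "nprod V (int l) (proj (nprod V (int k) (proj x) (proj y))) (proj z) =
       (\<Sum>i\<le>k. scl V ((- 1) ^ i * of_nat (k choose i))
                (nprod V (int (k - i)) (proj x) (proj (nprod V (int (l + i)) (proj y) (proj z))) -
                 scl V (koszul_sign p q)
                  (nprod V (int (l + i)) (proj y) (proj (nprod V (int (k - i)) (proj x) (proj
                    z))))))" for k l
    using associative_axioms(2) x y xc yc by (simp only: nprod_of_nat proj_id proj_car va_closed
      lam_jacobi_def koszul_sign)
  show "nprod V (int k) (proj x) (proj y) = - scl V (koszul_sign p q)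
       (\<Sum>j<N. scl V ((- 1) ^ (k + j)) (divpow (scl V) (\<lambda>x. der V (proj x)) j
          (nprod V (int (k + j)) (proj y) (proj x))))"
    if "\<forall>j\<ge>N. nprod V (int (k + j)) (proj y) (proj x) = 0" for k N
  proof -
    have "lam V k x y = - koszul p q (\<Sum>j | lam V (k + j) y x \<noteq> 0.
              scl V ((- 1) ^ (k + j)) (dpow V j (lam V (k + j) y x)))"
      using associative_axioms(3) x y unfolding lam_skew_def by blast
    also have "(\<Sum>j | lam V (k + j) y x \<noteq> 0. scl V ((- 1) ^ (k + j)) (dpow V j (lam V (k + j) y x)))
      = (\<Sum>j<N. scl V ((- 1) ^ (k + j)) (dpow V j (lam V (k + j) y x)))"
      by (rule sum_support) (use that xc yc in \<open>simp_all only: nprod_of_nat proj_id, simp_all\<close>)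
    finally show ?thesis using xc yc
      by (simp only: nprod_of_nat proj_id koszul_sign divpow_car va_closed)
  qed
  show "nprod V (- 1) (proj x) (proj y) - scl V (koszul_sign p q) (nprod V (- 1) (proj y) (proj x)) =
       (\<Sum>j<N. scl V ((- 1) ^ j) (divpow (scl V) (\<lambda>x. der V (proj x)) (j + 1)
          (nprod V (int j) (proj x) (proj y))))"
    if "\<forall>j\<ge>N. nprod V (int j) (proj x) (proj y) = 0" for N
  proof -
    have "mul V x y - koszul p q (mul V y x)
      = (\<Sum>i | lam V i x y \<noteq> 0. scl V ((- 1) ^ i) (dpow V (i + 1) (lam V i x y)))"
      using associative_axioms(4) x y unfolding quasi_commutativity_def by blast
    also have "\<dots> = (\<Sum>j<N. scl V ((- 1) ^ j) (dpow V (j + 1) (lam V j x y)))"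
      by (rule sum_support) (use that xc yc in \<open>simp_all only: nprod_of_nat proj_id, simp_all\<close>)
    finally show ?thesis using xc yc
      by (simp only: nprod_of_nat nprod_minus_one proj_id koszul_sign divpow_car va_closed)
  qed
  show "nprod V (int k) (proj x) (proj (nprod V (- 1) (proj y) (proj z))) =
       nprod V (- 1) (proj (nprod V (int k) (proj x) (proj y))) (proj z) +
       scl V (koszul_sign p q) (nprod V (- 1) (proj y) (proj (nprod V (int k) (proj x) (proj z)))) +
       (\<Sum>t<k. scl V (of_nat (k choose t))
           (nprod V (int (k - 1 - t)) (proj (nprod V (int t) (proj x) (proj y))) (proj z)))" for k
    using associative_axioms(5) x y xc yc
    by (simp only: nprod_of_nat nprod_minus_one proj_id proj_car va_closed wick_formula_def koszul_sign)
qed (simp_all add: proj_add proj_scale der_add der_scale nprod_add_left nprod_add_right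
      nprod_scale_left nprod_scale_right der_lam der_mul)

lemma nprod_bounded:
  assumes "a \<in> car V" "b \<in> car V"
  shows "\<exists>N. \<forall>j\<ge>N. nprod V (m + int j) a b = 0"
  using products.bounded_int[of m a b] assms by simp

lemma nprod_der: "a \<in> car V \<Longrightarrow> b \<in> car V \<Longrightarrow> nprod V n (der V a) b
  = scl V (- of_int n) (nprod V (n - 1) a b)"
  using products.P_T[of n a b] by simp

text \<open>\<open>opposite m a n b c\<close> is the bilinear extension of \<open>\<zeta> b\<^sub>n (a\<^sub>m c)\<close>.\<close>

definition opposite :: "int \<Rightarrow> 'v \<Rightarrow> int \<Rightarrow> 'v \<Rightarrow> 'v \<Rightarrow> 'v" where
  "opposite m a n b c = (\<Sum>p\<in>UNIV. \<Sum>q\<in>UNIV.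
     koszul p q (nprod V n (component (par V) b q) (nprod V m (component (par V) a p) c)))"

lemma opposite_homogeneous:
  assumes a: "a \<in> par V p" and b: "b \<in> par V q" and c: "c \<in> car V"
  shows "opposite m a n b c = scl V (koszul_sign p q) (nprod V n b (nprod V m a c))"
proof -
  have zero: "nprod V m 0 c = 0" if "c \<in> car V" for m c
    using nprod_scale_left[of 0 c m 0] that by simp
  have zero': "nprod V m c 0 = 0" if "c \<in> car V" for m c
    using nprod_scale_right[of c 0 m 0] that by simp
  show ?thesis
    using par_car[OF a] par_car[OF b] c
    by (cases p; cases q) (simp_all add: opposite_def UNIV_bool pr.component_homogeneous[OF a]
       pr.component_homogeneous[OF b] zero zero' koszul_def koszul_sign_def)
qed

lemma opposite_add:
  assumes "a \<in> car V" "b \<in> car V" "c \<in> car V"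
  shows "a' \<in> car V \<Longrightarrow> opposite m (a + a') n b c = opposite m a n b c + opposite m a' n b c"
    and "b' \<in> car V \<Longrightarrow> opposite m a n (b + b') c = opposite m a n b c + opposite m a n b' c"
    and "c' \<in> car V \<Longrightarrow> opposite m a n b (c + c') = opposite m a n b c + opposite m a n b c'"
  unfolding opposite_def using assms
  by (simp_all add: nprod_add_left nprod_add_right pr.component_add koszul_sign
    scale_right_distrib sum.distrib)

lemma par_induct [consumes 1, case_names par add]:
  assumes "a \<in> car V" and par: "\<And>p x. x \<in> par V p \<Longrightarrow> Q x"
    and add: "\<And>x y. x \<in> car V \<Longrightarrow> y \<in> car V \<Longrightarrow> Q x \<Longrightarrow> Q y \<Longrightarrow> Q (x + y)"
  shows "Q a"
proof -
  have "component (par V) a False + component (par V) a True = a"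
    using sum_par[OF assms(1)] by (simp add: UNIV_bool)
  moreover have "Q (component (par V) a False + component (par V) a True)"
    using assms(1) by (intro add component_par_car par[OF pr.component_in])
  ultimately show ?thesis by simp
qed

text \<open>Since \<open>opposite\<close> contains the signs, both sides are additive in a and b,
  and the parity-homogeneous case suffices.\<close>

lemma nprod_lam:
  assumes a: "a \<in> car V" and b: "b \<in> car V" and c: "c \<in> car V"
  shows "nprod V m (lam V k a b) c = (\<Sum>i\<le>k. scl V ((- 1) ^ i * of_nat (k choose i))
      (nprod V (int k - int i) a (nprod V (m + int i) b c)
        - opposite (int k - int i) a (m + int i) b c))"
  using a
proof (induction a rule: par_induct)
  case (par p a)
  then have ac: "a \<in> car V" by (rule par_car)
  show ?case using b
  proof (induction b rule: par_induct)
    case b: (par q b)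
    show ?case
      using products.iterate_nonneg[OF par b, of m k c] c ac par_car[OF b]
      by (simp add: products.bracket_def opposite_homogeneous[OF par b])
  next
    case (add b b')
    then show ?case
      using c ac by (simp add: nprod_bilin nprod_add_left nprod_add_right opposite_add
        add_diff_add scale_right_distrib sum.distrib)
  qed
next
  case (add a a')
  then show ?case
    using c b by (simp add: nprod_bilin nprod_add_left opposite_add
        add_diff_add scale_right_distrib sum.distrib)
qed

text \<open>Here c has to be reduced to homogeneous elements too, since the homogeneous case used
  skew symmetry with c. Each reduction merges two bounds N0 into a common one
  (\<open>combine\<close>).\<close>

lemma nprod_mul:
  assumes a: "a \<in> car V" and b: "b \<in> car V" and c: "c \<in> car V"
  shows "\<exists>N0. \<forall>N\<ge>N0. nprod V m (mul V a b) c
    = (\<Sum>i<N. nprod V (- 1 - int i) a (nprod V (m + int i) b c))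
      + (\<Sum>k<N. opposite (int k) a (m - 1 - int k) b c)"
    (is "\<exists>N0. \<forall>N\<ge>N0. ?L a b c = ?R N a b c")
proof -
  have combine: "\<exists>N0. \<forall>N\<ge>N0. L = R N"
    if "\<exists>N0. \<forall>N\<ge>N0. l = r N" "\<exists>N0. \<forall>N\<ge>N0. l' = r' N" "L = l + l'" "\<And>N. R N = r N + r' N"
    for l l' L :: 'v and r r' R :: "nat \<Rightarrow> 'v"
    using that by (metis le_trans nle_le)
  show ?thesis using a
  proof (induction a rule: par_induct)
    case a: (par p a)
    then have ac: "a \<in> car V" by (rule par_car)
    show ?case using b
    proof (induction b rule: par_induct)
      case b: (par q b)
      then have bc: "b \<in> car V" by (rule par_car)
      show ?case using c
      proof (induction c rule: par_induct)
        case c: (par r c)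
        show ?case
          using products.iterate_product[OF a b c, of m] ac bc par_car[OF c]
          by (simp add: opposite_homogeneous[OF a b] scale_sum_right)
      next
        case (add c c')
        show ?case
          by (rule combine[OF add(3,4)])
            (use add(1,2) ac bc in \<open>simp_all add: nprod_add_right opposite_add sum.distrib
              algebra_simps\<close>)
      qed
    next
      case (add b b')
      show ?case
        by (rule combine[OF add(3,4)])
          (use add(1,2) ac c in \<open>simp_all add: nprod_bilin nprod_add_left nprod_add_right
            opposite_add sum.distrib algebra_simps\<close>)
    qed
  next
    case (add a a')
    show ?case
      by (rule combine[OF add(3,4)])
        (use add(1,2) b c in \<open>simp_all add: nprod_bilin nprod_add_left opposite_add sum.distrib
          algebra_simps\<close>)
  qed
qed

end

section \<open>Graded endomorphisms\<close>

lemma (in vector_space) span_decomposes: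
  assumes G: "\<And>i. subspace (G i)" and x: "x \<in> span (\<Union>i. G i)"
  shows "\<exists>c. decomposes G x c"
  using x
proof (induction rule: span_induct_alt)
  case base
  have "decomposes G 0 (\<lambda>_. 0)" using G subspace_0 by (simp add: decomposes_def)
  then show ?case by (rule exI[where x = "\<lambda>_. 0"])
next
  case (step a x y)
  then obtain i c where i: "x \<in> G i" and c: "decomposes G y c" by blast
  have fin: "finite {i. c i \<noteq> 0}" and cG: "\<And>j. c j \<in> G j" and y: "y = (\<Sum>j | c j \<noteq> 0. c j)"
    using c by (simp_all add: decomposes_def)
  let ?d = "c(i := scale a x + c i)"
  let ?I = "insert i {j. c j \<noteq> 0}"
  have y': "y = (\<Sum>j\<in>?I. c j)"
    unfolding y by (rule sum.mono_neutral_left) (use fin in auto)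
  have "scale a x + y = scale a x + (c i + (\<Sum>j\<in>?I - {i}. c j))"
    unfolding y' using fin by (subst sum.remove[of ?I i]) auto
  also have "(\<Sum>j\<in>?I - {i}. c j) = (\<Sum>j\<in>?I - {i}. ?d j)" by (rule sum.cong) auto
  also have "scale a x + (c i + (\<Sum>j\<in>?I - {i}. ?d j)) = ?d i + (\<Sum>j\<in>?I - {i}. ?d j)"
    by (simp add: add.assoc)
  also have "\<dots> = (\<Sum>j\<in>?I. ?d j)"
    using fin by (subst sum.remove[of ?I i]) auto
  also have "\<dots> = (\<Sum>j | ?d j \<noteq> 0. ?d j)"
    by (rule sum.mono_neutral_right) (use fin in \<open>auto split: if_splits\<close>)
  finally have "scale a x + y = (\<Sum>j | ?d j \<noteq> 0. ?d j)" .
  moreover have "finite {j. ?d j \<noteq> 0}"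
    by (rule finite_subset[of _ ?I]) (use fin in \<open>auto split: if_splits\<close>)
  moreover have "?d j \<in> G j" for j
    using cG i G by (auto intro: subspace_add subspace_scale)
  ultimately have "decomposes G (scale a x + y) ?d" unfolding decomposes_def by blast
  then show ?case by (rule exI[where x = ?d])
qed

context assoc_va
begin

lemma deg_induct [consumes 1, case_names deg add]:
  assumes a: "a \<in> car V" and deg: "\<And>h x. x \<in> deg V h \<Longrightarrow> Q x"
    and add: "\<And>x y. x \<in> car V \<Longrightarrow> y \<in> car V \<Longrightarrow> Q x \<Longrightarrow> Q y \<Longrightarrow> Q (x + y)"
  shows "Q a"
proof -
  have "Q (\<Sum>h\<in>H. component (deg V) a h)" if "finite H" for H
    using that
  proof (induction H)
    case empty
    show ?case using deg[OF dg.zero_G] by simp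
  next
    case (insert h H)
    then show ?case
      using a by (simp add: add sum_car deg[OF dg.component_in])
  qed
  from this[OF dg.finite_component[OF a]] show ?thesis by (simp add: dg.sum_component[OF a])
qed

definition fscl :: "'k \<Rightarrow> ('v \<Rightarrow> 'v) \<Rightarrow> 'v \<Rightarrow> 'v" where
  "fscl c f = (\<lambda>v. scl V c (f v))"

sublocale F: vector_space fscl
  by unfold_locales (simp_all add: fscl_def fun_eq_iff scale_right_distrib scale_left_distrib)

text \<open>
  Endomorphisms of \<open>car V\<close> are extended to the ambient type by precomposition with the projection
  \<open>proj\<close>; this makes composition total and equality of endomorphisms equality of functions.
\<close>

definition Elin :: "('v \<Rightarrow> 'v) set" where
  "Elin = {f. (\<forall>x y. f (x + y) = f x + f y) \<and> (\<forall>c x. f (scl V c x) = scl V c (f x)) \<and>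
     (\<forall>x. f (proj x) = f x) \<and> (\<forall>x. f x \<in> car V)}"

definition Edeg :: "rat \<Rightarrow> ('v \<Rightarrow> 'v) set" where
  "Edeg h = {f \<in> Elin. \<forall>k. \<forall>v\<in>deg V k. f v \<in> deg V (k + h)}"

text \<open>Finite sums of homogeneous endomorphisms only, so that the algebra is the direct sum of
  its degrees.\<close>

definition Efun :: "('v \<Rightarrow> 'v) set" where
  "Efun = F.span (\<Union>h. Edeg h)"

definition Epar :: "bool \<Rightarrow> ('v \<Rightarrow> 'v) set" where
  "Epar p = {f \<in> Efun. \<forall>q. \<forall>v\<in>par V q. f v \<in> par V (p \<noteq> q)}"

lemma ElinD:
  assumes "f \<in> Elin"
  shows "f (x + y) = f x + f y" "f (scl V c x) = scl V c (f x)" "f (proj x)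
    = f x" "f x \<in> car V" "f 0 = 0"
proof -
  show "f (x + y) = f x + f y" and scl: "f (scl V c x) = scl V c (f x)" and "f (proj x)
    = f x" "f x \<in> car V" for c x
    using assms by (simp_all add: Elin_def)
  show "f 0 = 0" using scl[of 0 0] by simp
qed

text \<open>Because elements of \<open>Elin\<close> factor through \<open>proj\<close>, their values
  on homogeneous vectors determine them on the whole ambient type.\<close>

lemma Elin_eqI:
  assumes "f \<in> Elin" "g \<in> Elin" "\<And>k v. v \<in> deg V k \<Longrightarrow> f v = g v"
  shows "f = g"
proof
  fix x
  have "f v = g v" if "v \<in> car V" for v
    using that by (induction v rule: deg_induct) (simp_all add: assms ElinD)
  from this[OF proj_car, of x] show "f x = g x" using assms ElinD(3) by metis
qed

lemma Elin_comp: "f \<in> Elin \<Longrightarrow> g \<in> Elin \<Longrightarrow> f \<circ> g \<in> Elin"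
  by (simp add: Elin_def)

lemma proj_Elin: "proj \<in> Elin"
  by (simp add: Elin_def proj_add proj_scale)

lemma subspace_Elin: "F.subspace Elin"
  by (rule F.subspaceI) (auto simp: Elin_def fscl_def algebra_simps scale_right_distrib)

lemma subspace_Edeg: "F.subspace (Edeg h)"
  by (rule F.subspaceI)
    (use subspace_Elin in \<open>auto simp: Edeg_def F.subspace_def fscl_def
      intro: subspace_add[OF dg.subspace_G] subspace_scale[OF dg.subspace_G]\<close>)

lemma subspace_Efun: "F.subspace Efun"
  unfolding Efun_def by (rule F.subspace_span)

lemma Edeg_Efun: "f \<in> Edeg h \<Longrightarrow> f \<in> Efun"
  unfolding Efun_def by (rule F.span_base) blast

lemma Efun_Elin: "f \<in> Efun \<Longrightarrow> f \<in> Elin"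
  using F.span_minimal[OF _ subspace_Elin, of "\<Union>h. Edeg h"] unfolding Efun_def Edeg_def by blast

lemma Edeg_Elin: "f \<in> Edeg h \<Longrightarrow> f \<in> Elin"
  by (simp add: Edeg_def)

lemma EdegD: "f \<in> Edeg h \<Longrightarrow> v \<in> deg V k \<Longrightarrow> f v \<in> deg V (k + h)"
  by (simp add: Edeg_def)

lemma proj_Edeg: "proj \<in> Edeg 0"
  by (simp add: Edeg_def proj_Elin deg_car)

lemma Edeg_comp: "f \<in> Edeg h \<Longrightarrow> g \<in> Edeg k \<Longrightarrow> f \<circ> g \<in> Edeg (h + k)"
proof -
  assume f: "f \<in> Edeg h" and g: "g \<in> Edeg k"
  have "f (g v) \<in> deg V (l + (h + k))" if "v \<in> deg V l" for l v
    using EdegD[OF f EdegD[OF g that]] by (simp add: algebra_simps)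
  then show ?thesis using f g by (simp add: Edeg_def Elin_comp)
qed

lemma Efun_comp:
  assumes f: "f \<in> Efun" and g: "g \<in> Efun"
  shows "f \<circ> g \<in> Efun"
proof -
  have "f \<circ> g \<in> Efun" if f: "f \<in> Edeg h" for f h
    using g unfolding Efun_def
  proof (induction g rule: F.span_induct)
    case base
    have eqs: "f \<circ> 0 = 0" "f \<circ> (x + y) = (f \<circ> x) + (f \<circ> y)" "f \<circ> fscl c x = fscl c (f \<circ> x)" for x y c
      using Edeg_Elin[OF f] by (simp_all add: fun_eq_iff ElinD fscl_def)
    show ?case
      by (rule F.subspaceI) (simp_all only: mem_Collect_eq eqs F.span_zero F.span_add F.span_scale)
  next
    case (step g)
    then obtain k where "g \<in> Edeg k" by blast
    from Edeg_Efun[OF Edeg_comp[OF f this]] show ?case by (simp only: Efun_def)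
  qed
  then have *: "f \<circ> g \<in> Efun" if "f \<in> (\<Union>h. Edeg h)" for f using that by blast
  show ?thesis
    using f unfolding Efun_def
  proof (induction f rule: F.span_induct)
    case base
    have eqs: "0 \<circ> g = (0 :: 'v \<Rightarrow> 'v)" "(x + y) \<circ> g = (x \<circ> g) + (y \<circ> g)" "fscl c x \<circ> g = fscl c (x \<circ> g)"
      for x y :: "'v \<Rightarrow> 'v" and c by (simp_all add: fun_eq_iff fscl_def)
    show ?case
      by (rule F.subspaceI) (simp_all only: mem_Collect_eq eqs F.span_zero F.span_add F.span_scale)
  next
    case (step f)
    from *[OF step] show ?case by (simp only: Efun_def)
  qed
qed

text \<open>For independence, evaluate at a homogeneous vector: the summands then have values in
  pairwise different degrees.\<close>

sublocale Ed: internal_direct_sum fscl Efun Edeg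
proof (rule internal_direct_sumI)
  show "vector_space fscl" by unfold_locales
  show "\<exists>c. decomposes Edeg x c" if "x \<in> Efun" for x
    using F.span_decomposes[OF subspace_Edeg] that by (simp only: Efun_def)
  show "c i = 0" if "finite I" and c: "\<And>i. i \<in> I \<Longrightarrow> c i \<in> Edeg i" and sum: "(\<Sum>i\<in>I. c i) = 0"
    and i: "i \<in> I" for I c i
  proof (rule Elin_eqI)
    show "c i \<in> Elin" "0 \<in> Elin" using c[OF i] Edeg_Elin F.subspace_0[OF subspace_Elin] by auto
    fix k v assume v: "v \<in> deg V k"
    have deg: "c j v \<in> deg V (k + j)" if "j \<in> I" for j by (rule EdegD[OF c[OF that] v])
    have "(\<Sum>j\<in>I. c j v) = 0" using sum by (simp flip: sum_apply)
    then have "component (deg V) (\<Sum>j\<in>I. c j v) (k + i) = 0" by (simp add: dg.component_zero)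
    moreover have "component (deg V) (\<Sum>j\<in>I. c j v) (k + i) = (\<Sum>j\<in>I. component (deg V) (c j v) (k + i))"
      by (rule dg.component_sum) (use deg deg_car in blast)
    moreover have "\<dots> = (\<Sum>j\<in>I. if j = i then c i v else 0)"
      by (intro sum.cong refl) (simp add: dg.component_homogeneous[OF deg])
    ultimately show "c i v = 0 v" using \<open>finite I\<close> i by simp
  qed
qed (auto simp: subspace_Efun subspace_Edeg Edeg_Efun)

lemma Edeg_component:
  assumes f: "f \<in> Efun" and v: "v \<in> deg V k"
  shows "component Edeg f h v = component (deg V) (f v) (k + h)"
  by (rule component_map[OF Ed.internal_direct_sum_axioms dg.internal_direct_sum_axioms,
        of "\<lambda>f. f v" "\<lambda>h. k + h", symmetric])
    (use f v EdegD in \<open>auto simp: inj_on_def\<close>)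

text \<open>The parity components of an endomorphism, given explicitly: the formula shows that they
  keep its degree and that they vanish on each V_k on which it vanishes.\<close>

definition ppart :: "bool \<Rightarrow> ('v \<Rightarrow> 'v) \<Rightarrow> 'v \<Rightarrow> 'v" where
  "ppart p f v = (\<Sum>q\<in>UNIV. component (par V) (f (component (par V) (proj v) q)) (p \<noteq> q))"

lemma ppart_Elin: "f \<in> Elin \<Longrightarrow> ppart p f \<in> Elin"
  unfolding Elin_def ppart_def
  by (auto simp: proj_add proj_scale pr.component_add pr.component_scale sum.distrib scale_right_distrib
      UNIV_bool)

lemma ppart_Edeg: "f \<in> Edeg h \<Longrightarrow> ppart p f \<in> Edeg h"
  unfolding Edeg_def
  by (auto simp: ppart_Elin)
    (auto simp: ppart_def deg_car intro!: subspace_sum[OF dg.subspace_G] par_component_deg)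

lemma ppart_Efun:
  assumes "f \<in> Efun" shows "ppart p f \<in> Efun"
proof -
  have "f \<in> Efun \<and> ppart p f \<in> Efun"
    using assms unfolding Efun_def
  proof (induction f rule: F.span_induct_alt)
    case base
    have "ppart p 0 = 0" by (simp add: fun_eq_iff ppart_def pr.component_zero)
    then show ?case by (simp only: F.span_zero simp_thms)
  next
    case (step c x y)
    have x: "x \<in> Elin" using step(1) Edeg_Elin by blast
    have y: "y \<in> Elin" using step(2) Efun_Elin by (simp add: Efun_def)
    have "ppart p (fscl c x + y) = fscl c (ppart p x) + ppart p y"
      using ElinD(4)[OF x] ElinD(4)[OF y]
      by (simp add: fun_eq_iff ppart_def fscl_def pr.component_add pr.component_scale sum.distrib
        scale_sum_right)
    moreover have "ppart p x \<in> (\<Union>h. Edeg h)" using step(1) ppart_Edeg by blast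
    ultimately show ?case
      by (simp only:) (intro conjI F.span_add F.span_scale F.span_base step(1) conjunct1[OF
        step(2)] conjunct2[OF step(2)])
  qed
  then show ?thesis ..
qed

lemma ppart_Epar:
  assumes f: "f \<in> Efun" shows "ppart p f \<in> Epar p"
proof -
  have "ppart p f v \<in> par V (p \<noteq> q)" if v: "v \<in> par V q" for q v
  proof -
    have eq: "ppart p f v = component (par V) (f v) (p \<noteq> q)"
      using par_car[OF v] ElinD(5)[OF Efun_Elin[OF f]]
      by (cases q) (simp_all add: ppart_def UNIV_bool pr.component_homogeneous[OF v] pr.component_zero)
    show ?thesis unfolding eq by (rule pr.component_in[OF ElinD(4)[OF Efun_Elin[OF f]]])
  qed
  then show ?thesis using ppart_Efun[OF f] unfolding Epar_def by blast
qed

lemma ppart_sum: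
  assumes f: "f \<in> Elin" shows "ppart False f + ppart True f = f"
proof
  fix v
  note car = ElinD(4)[OF f]
  have s: "component (par V) x False + component (par V) x True = x" if "x \<in> car V" for x
    using sum_par[OF that] by (simp add: UNIV_bool)
  have "(ppart False f + ppart True f) v
    = f (component (par V) (proj v) False) + f (component (par V) (proj v) True)"
    using s[OF car, of "component (par V) (proj v) False"] s[OF car,
      of "component (par V) (proj v) True"]
    by (simp add: ppart_def UNIV_bool algebra_simps)
  also have "\<dots> = f v"
    using s[of "proj v"] by (simp add: ElinD(3)[OF f] flip: ElinD(1)[OF f])
  finally show "(ppart False f + ppart True f) v = f v" .
qed

lemma subspace_Epar: "F.subspace (Epar p)"
  by (rule F.subspaceI)
    (use subspace_Efun in \<open>auto simp: Epar_def F.subspace_def fscl_def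
      intro: subspace_add[OF pr.subspace_G] subspace_scale[OF pr.subspace_G]\<close>)

lemma Epar_Efun: "f \<in> Epar p \<Longrightarrow> f \<in> Efun"
  by (simp add: Epar_def)

sublocale Ep: internal_direct_sum fscl Efun Epar
proof (rule internal_direct_sumI)
  show "vector_space fscl" by unfold_locales
  show "\<exists>c. decomposes Epar f c" if f: "f \<in> Efun" for f
  proof -
    have "decomposes Epar f (\<lambda>p. ppart p f)"
      unfolding decomposes_def
    proof (intro conjI allI)
      show "ppart p f \<in> Epar p" for p by (rule ppart_Epar[OF f])
      have "(\<Sum>p | ppart p f \<noteq> 0. ppart p f) = (\<Sum>p\<in>UNIV. ppart p f)"
        by (rule sum.mono_neutral_left) auto
      also have "\<dots> = f" using ppart_sum[OF Efun_Elin[OF f]] by (simp add: UNIV_bool)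
      finally show "f = (\<Sum>p | ppart p f \<noteq> 0. ppart p f)" ..
    qed simp
    then show ?thesis by (rule exI[where x = "\<lambda>p. ppart p f"])
  qed
  show "c i = 0" if "finite I" and c: "\<And>i. i \<in> I \<Longrightarrow> c i \<in> Epar i" and sum: "(\<Sum>i\<in>I. c i) = 0"
    and i: "i \<in> I"
    for I and c :: "bool \<Rightarrow> 'v \<Rightarrow> 'v" and i
  proof
    fix v
    have lin: "c j \<in> Elin" if "j \<in> I" for j using c[OF that] Efun_Elin by (simp add: Epar_def)
    have hom: "c i v = 0" if v: "v \<in> par V q" for v q
    proof -
      have par: "c j v \<in> par V (j \<noteq> q)" if "j \<in> I" for j using c[OF that] v unfolding Epar_def by blast
      have "(\<Sum>j\<in>I. c j v) = 0" using sum by (simp flip: sum_apply)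
      then have "component (par V) (\<Sum>j\<in>I. c j v) (i \<noteq> q) = 0" by (simp add: pr.component_zero)
      moreover have "component (par V) (\<Sum>j\<in>I. c j v) (i \<noteq> q) = (\<Sum>j\<in>I. component (par V) (c j v) (i \<noteq> q))"
        by (rule pr.component_sum) (use par par_car in blast)
      moreover have "\<dots> = (\<Sum>j\<in>I. if j = i then c i v else 0)"
        by (intro sum.cong refl) (auto simp: pr.component_homogeneous[OF par])
      ultimately show ?thesis using \<open>finite I\<close> i by simp
    qed
    have "c i w = 0" if "w \<in> car V" for w
      using that by (induction w rule: par_induct) (simp_all add: hom ElinD(1)[OF lin[OF i]])
    from this[OF proj_car] show "c i v = 0 v" by (simp add: ElinD(3)[OF lin[OF i]])
  qed
qed (auto simp: subspace_Efun subspace_Epar dest: Epar_Efun)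

lemma Epar_component:
  assumes f: "f \<in> Efun" shows "component Epar f p = ppart p f"
proof -
  have "component Epar (\<Sum>p\<in>UNIV. ppart p f) = (\<lambda>p. if p \<in> UNIV then ppart p f else 0)"
    by (rule Ep.component_sum_eq) (simp_all add: ppart_Epar[OF f])
  then show ?thesis using ppart_sum[OF Efun_Elin[OF f]] by (simp add: UNIV_bool)
qed

lemma Epar_comp: "f \<in> Epar p \<Longrightarrow> g \<in> Epar q \<Longrightarrow> f \<circ> g \<in> Epar (p \<noteq> q)"
proof -
  assume f: "f \<in> Epar p" and g: "g \<in> Epar q"
  have "f (g v) \<in> par V ((p \<noteq> q) \<noteq> r)" if "v \<in> par V r" for r v
  proof -
    have "f (g v) \<in> par V (p \<noteq> (q \<noteq> r))" using f g that unfolding Epar_def by blast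
    then show ?thesis by (cases p; cases q; cases r) simp_all
  qed
  then show ?thesis using Efun_comp f g unfolding Epar_def comp_def by blast
qed

end

section \<open>The endomorphism algebra as an FZ-complete algebra\<close>

lemma internal_direct_sum_image:
  assumes "internal_direct_sum s C G" and "vector_space s'"
    and add: "\<And>x y. j (x + y) = j x + j y" and scale: "\<And>c x. j (s c x) = s' c (j x)" and "inj j"
  shows "internal_direct_sum s' (j ` C) (\<lambda>i. j ` G i)"
proof -
  interpret A: internal_direct_sum s C G by fact
  interpret B: vector_space s' by fact
  have zero: "j 0 = 0" using add[of 0 0] by simp
  have sum: "j (\<Sum>i\<in>I. f i) = (\<Sum>i\<in>I. j (f i))" for I :: "'x set" and f
    by (induction I rule: infinite_finite_induct) (simp_all add: zero add)
  have sub: "B.subspace (j ` X)" if "A.subspace X" for X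
  proof (rule B.subspaceI)
    show "0 \<in> j ` X" using A.subspace_0[OF that] by (metis image_eqI zero)
    show "x + y \<in> j ` X" if "x \<in> j ` X" "y \<in> j ` X" for x y
      using that A.subspace_add[OF \<open>A.subspace X\<close>] by (auto simp flip: add)
    show "s' c x \<in> j ` X" if "x \<in> j ` X" for x c
      using that A.subspace_scale[OF \<open>A.subspace X\<close>] by (auto simp flip: scale)
  qed
  show ?thesis
  proof (rule internal_direct_sumI)
    fix x assume "x \<in> j ` C"
    then obtain v where v: "v \<in> C" "x = j v" by blast
    have "decomposes (\<lambda>i. j ` G i) x (\<lambda>i. j (component G v i))"
      unfolding decomposes_def
    proof (intro conjI allI)
      have "{i. j (component G v i) \<noteq> 0} = {i. component G v i \<noteq> 0}"
        using \<open>inj j\<close> zero by (metis injD)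
      then show "finite {i. j (component G v i) \<noteq> 0}" "x
        = (\<Sum>i | j (component G v i) \<noteq> 0. j (component G v i))"
        using A.finite_component[OF v(1)] A.sum_component[OF v(1)] by (simp_all add: v(2) flip: sum)
    qed (use A.component_in[OF v(1)] in blast)
    then show "\<exists>c. decomposes (\<lambda>i. j ` G i) x c" by (rule exI[where x = "\<lambda>i. j (component G v i)"])
  next
    fix I c i assume I: "finite I" "\<And>i. i \<in> I \<Longrightarrow> c i \<in> j ` G i" "(\<Sum>i\<in>I. c i) = 0" "i \<in> I"
    define d where "d i = inv j (c i)" for i
    have d: "d i \<in> G i" "c i = j (d i)" if "i \<in> I" for i
      using I(2)[OF that] \<open>inj j\<close> by (auto simp: d_def)
    have "j (\<Sum>i\<in>I. d i) = j 0" using I(3) by (simp add: sum zero d cong: sum.cong)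
    then have "(\<Sum>i\<in>I. d i) = 0" using \<open>inj j\<close> by (simp add: inj_eq)
    then have "(if i \<in> I then d i else 0) = component G 0 i"
      using A.component_sum_eq[OF I(1), of d] d(1) by simp
    then show "c i = 0" using I(4) by (simp add: A.component_zero d zero)
  qed (simp_all add: assms sub A.subspace_C A.subspace_G image_mono A.G_subset)
qed

text \<open>\<open>su\<close> is a scalar multiplication on the type in which the test algebras
  live, and \<open>j\<close> embeds all functions linearly. Transport along \<open>j\<close> makes
  the endomorphism algebra one of the test algebras.\<close>

locale end_model = assoc_va \<rho> V
  for \<rho> :: rat and V :: "('k::field_char_0, 'v::ab_group_add) vertex_alg" +
  fixes su :: "'k \<Rightarrow> 'u::ab_group_add \<Rightarrow> 'u" and j :: "('v \<Rightarrow> 'v) \<Rightarrow> 'u"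
  assumes vector_space_su: "vector_space su" and j_add: "j (f + g) = j f + j g"
    and j_scale: "j (fscl c f) = su c (j f)" and inj_j: "inj j" and truncated: "truncated V"
begin

sublocale U: vector_space su by (rule vector_space_su)

definition act :: "'u \<Rightarrow> 'v \<Rightarrow> 'v" where
  "act = inv j"

lemma act_j [simp]: "act (j f) = f"
  by (simp add: act_def inj_j)

lemma j_eq [simp]: "j f = j g \<longleftrightarrow> f = g"
  using inj_j by (simp add: inj_eq)

lemma j_zero [simp]: "j 0 = 0"
  using j_add[of 0 0] by simp

lemma j_minus: "j (- f) = - j f"
  using j_add[of f "- f"] by (simp add: eq_neg_iff_add_eq_0 add.commute)

lemma j_diff: "j (f - g) = j f - j g"
  using j_add[of f "- g"] by (simp add: j_minus)

lemma j_sum: "j (\<Sum>i\<in>I. f i) = (\<Sum>i\<in>I. j (f i))"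
  by (induction I rule: infinite_finite_induct) (simp_all only: sum.infinite sum.empty sum.insert
    j_zero j_add not_False_eq_True)

section \<open>The topology of agreement up to a given degree\<close>

definition agree :: "rat \<Rightarrow> ('v \<Rightarrow> 'v) \<Rightarrow> ('v \<Rightarrow> 'v) \<Rightarrow> bool" where
  "agree K f g \<longleftrightarrow> (\<forall>k\<le>K. \<forall>v\<in>deg V k. f v = g v)"

definition near :: "rat \<Rightarrow> rat \<Rightarrow> ('v \<Rightarrow> 'v) \<Rightarrow> 'u set" where
  "near h K f = j ` {g \<in> Edeg h. agree K f g}"

definition topo_end :: "rat \<Rightarrow> 'u topology" where
  "topo_end h = topology (\<lambda>U. U \<subseteq> j ` Edeg h \<and> (\<forall>f\<in>Edeg h. j f \<in> U \<longrightarrow> (\<exists>K. near h K f \<subseteq> U)))"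

definition endalg :: "('k, 'u) fz_alg" where
  "endalg = \<lparr> scl = su, car = j ` Efun, par = (\<lambda>p. j ` Epar p), deg = (\<lambda>h. j ` Edeg h),
     mul = (\<lambda>x y. j (act x \<circ> act y)), one = j proj, topo = topo_end \<rparr>"

lemma endalg_simps [simp]:
  "scl endalg = su" "car endalg = j ` Efun" "par endalg = (\<lambda>p. j ` Epar p)" "deg endalg
    = (\<lambda>h. j ` Edeg h)"
  "mul endalg x y = j (act x \<circ> act y)" "one endalg = j proj" "topo endalg = topo_end"
  by (simp_all add: endalg_def)

lemma agree_refl [simp]: "agree K f f"
  by (simp add: agree_def)

lemma agree_mono: "agree K f g \<Longrightarrow> L \<le> K \<Longrightarrow> agree L f g"
  unfolding agree_def by (meson order_trans)

lemma agree_trans: "agree K f g \<Longrightarrow> agree K g e \<Longrightarrow> agree K f e"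
  and agree_sym: "agree K f g \<Longrightarrow> agree K g f"
  by (simp_all add: agree_def)

lemma near_mono: "L \<le> K \<Longrightarrow> near h K f \<subseteq> near h L f"
  using agree_mono by (auto simp: near_def)

lemma near_iff [simp]: "j g \<in> near h K f \<longleftrightarrow> g \<in> Edeg h \<and> agree K f g"
  by (auto simp: near_def)

lemma openin_topo_end:
  "openin (topo_end h) U \<longleftrightarrow> U \<subseteq> j ` Edeg h \<and> (\<forall>f\<in>Edeg h. j f \<in> U \<longrightarrow> (\<exists>K. near h K f \<subseteq> U))"
proof -
  have "istopology (\<lambda>U. U \<subseteq> j ` Edeg h \<and> (\<forall>f\<in>Edeg h. j f \<in> U \<longrightarrow> (\<exists>K. near h K f \<subseteq> U)))"
    unfolding istopology_def
  proof (intro conjI allI impI ballI)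
    fix S T f
    assume S: "S \<subseteq> j ` Edeg h \<and> (\<forall>f\<in>Edeg h. j f \<in> S \<longrightarrow> (\<exists>K. near h K f \<subseteq> S))"
      and T: "T \<subseteq> j ` Edeg h \<and> (\<forall>f\<in>Edeg h. j f \<in> T \<longrightarrow> (\<exists>K. near h K f \<subseteq> T))"
    show "S \<inter> T \<subseteq> j ` Edeg h" using S by blast
    assume f: "f \<in> Edeg h" "j f \<in> S \<inter> T"
    obtain K where K: "near h K f \<subseteq> S" using S f by blast
    obtain L where L: "near h L f \<subseteq> T" using T f by blast
    have "near h (max K L) f \<subseteq> S \<inter> T"
      using near_mono[of K "max K L" h f] near_mono[of L "max K L" h f] K L by auto
    then show "\<exists>K. near h K f \<subseteq> S \<inter> T" ..
  next
    fix \<K> f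
    assume K: "\<forall>S\<in>\<K>. S \<subseteq> j ` Edeg h \<and> (\<forall>f\<in>Edeg h. j f \<in> S \<longrightarrow> (\<exists>K. near h K f \<subseteq> S))"
    show "\<Union> \<K> \<subseteq> j ` Edeg h" using K by blast
    assume f: "f \<in> Edeg h" "j f \<in> \<Union> \<K>"
    then obtain S where S: "S \<in> \<K>" "j f \<in> S" by blast
    then obtain K where "near h K f \<subseteq> S" using K f by blast
    then show "\<exists>K. near h K f \<subseteq> \<Union> \<K>" using S by blast
  qed
  then show ?thesis by (simp add: topo_end_def)
qed

lemma near_subset: "near h K f \<subseteq> j ` Edeg h"
  by (auto simp: near_def)

lemma openin_near: "openin (topo_end h) (near h K f)"
  unfolding openin_topo_end
proof (intro conjI ballI impI near_subset)
  fix g assume g: "g \<in> Edeg h" "j g \<in> near h K f"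
  have "near h K g \<subseteq> near h K f"
    using g(2) agree_trans by (auto simp: near_def)
  then show "\<exists>K'. near h K' g \<subseteq> near h K f" ..
qed

lemma topspace_end [simp]: "topspace (topo_end h) = j ` Edeg h"
proof -
  have "openin (topo_end h) (j ` Edeg h)" using near_subset by (auto simp: openin_topo_end)
  moreover have "topspace (topo_end h) \<subseteq> j ` Edeg h"
    using openin_topspace[of "topo_end h"] unfolding openin_topo_end by blast
  ultimately show ?thesis using openin_subset by blast
qed

lemma near_open_subset:
  assumes "openin (topo_end h) U" "f \<in> Edeg h" "j f \<in> U"
  obtains K where "near h K f \<subseteq> U"
  using assms unfolding openin_topo_end by blast

text \<open>A neighbourhood criterion in terms of \<open>agree\<close>, applied to addition and to
  composition.\<close>

lemma continuous_binary:
  assumes maps: "\<And>f g. f \<in> Edeg h \<Longrightarrow> g \<in> Edeg k \<Longrightarrow> m f g \<in> Edeg l"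
    and agree: "\<And>f g K. f \<in> Edeg h \<Longrightarrow> g \<in> Edeg k \<Longrightarrow>
      \<exists>K1 K2. \<forall>f'\<in>Edeg h. \<forall>g'\<in>Edeg k. agree K1 f f' \<longrightarrow> agree K2 g g' \<longrightarrow> agree K (m f g) (m f' g')"
    and m: "\<And>f g. f \<in> Edeg h \<Longrightarrow> g \<in> Edeg k \<Longrightarrow> M (j f) (j g) = j (m f g)"
  shows "continuous_map (prod_topology (topo_end h) (topo_end k)) (topo_end l) (\<lambda>(x, y). M x y)"
  unfolding continuous_map_def
proof (intro conjI allI impI)
  show "(\<lambda>(x, y). M x y) \<in> topspace (prod_topology (topo_end h) (topo_end k)) \<rightarrow> topspace (topo_end l)"
    using maps m by auto
  fix U assume U: "openin (topo_end l) U"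
  show "openin (prod_topology (topo_end h) (topo_end k))
      {z \<in> topspace (prod_topology (topo_end h) (topo_end k)). (case z of (x, y) \<Rightarrow> M x y) \<in> U}"
    (is "openin _ ?W")
    unfolding openin_prod_topology_alt
  proof (intro allI impI)
    fix x y
    assume "(x, y) \<in> ?W"
    then obtain f g where f: "f \<in> Edeg h" "x = j f" and g: "g \<in> Edeg k" "y = j g" and "M x y \<in> U"
      by auto
    then have "j (m f g) \<in> U" using m by simp
    then obtain K where K: "near l K (m f g) \<subseteq> U" using near_open_subset[OF U maps[OF f(1) g(1)]]
      by blast
    obtain K1 K2 where K12: "\<forall>f'\<in>Edeg h. \<forall>g'\<in>Edeg k. agree K1 f f' \<longrightarrow> agree K2 g g'
      \<longrightarrow> agree K (m f g) (m f' g')"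
      using agree[OF f(1) g(1)] by blast
    have M: "M x' y' \<in> U" if x': "x' \<in> near h K1 f" and y': "y' \<in> near k K2 g" for x' y'
    proof -
      obtain f' g' where f': "f' \<in> Edeg h" "agree K1 f f'" "x' = j f'"
        and g': "g' \<in> Edeg k" "agree K2 g g'" "y' = j g'" using x' y' by (auto simp: near_def)
      then have "j (m f' g') \<in> near l K (m f g)" using K12 maps by simp
      then show ?thesis using K f' g' m by auto
    qed
    show "\<exists>S T. openin (topo_end h) S \<and> openin (topo_end k) T \<and> x \<in> S \<and> y \<in> T \<and> S \<times> T \<subseteq> ?W"
      by (rule exI[of _ "near h K1 f"], rule exI[of _ "near k K2 g"])
        (use M f g in \<open>auto simp: openin_near dest: subsetD[OF near_subset]\<close>)
  qed
qed

lemma direct_sums_end: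
  "internal_direct_sum su (j ` Efun) (\<lambda>h. j ` Edeg h)" "internal_direct_sum su (j ` Efun) (\<lambda>p. j `
    Epar p)"
  by (rule internal_direct_sum_image; fact Ed.internal_direct_sum_axioms Ep.internal_direct_sum_axioms
        vector_space_su j_add j_scale inj_j)+

lemma component_end:
  assumes "f \<in> Efun"
  shows "component (\<lambda>h. j ` Edeg h) (j f) h = j (component Edeg f h)"
    and "component (\<lambda>p. j ` Epar p) (j f) p = j (ppart p f)"
  using component_map[OF Ed.internal_direct_sum_axioms direct_sums_end(1), of j "\<lambda>i. i" f h]
    component_map[OF Ep.internal_direct_sum_axioms direct_sums_end(2), of j "\<lambda>i. i" f p] assms
  by (simp_all add: j_add Epar_component)

lemma end_graded_super_space: "graded_super_space \<rho> endalg"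
proof -
  interpret dE: internal_direct_sum su "j ` Efun" "\<lambda>h. j ` Edeg h" by (rule direct_sums_end)
  interpret pE: internal_direct_sum su "j ` Efun" "\<lambda>p. j ` Epar p" by (rule direct_sums_end)
  have "super_subset endalg (deg endalg h)" for h
    unfolding super_subset_def by (auto simp: Edeg_Efun component_end ppart_Edeg)
  moreover have "deg endalg h = {0}" if h: "h \<notin> range (\<lambda>n::int. \<rho> * of_int n)" for h
  proof -
    have triv: "deg V k = {0}" if "k \<notin> range (\<lambda>n::int. \<rho> * of_int n)" for k
      using graded_super_space that unfolding graded_super_space_def by blast
    have "f = 0" if f: "f \<in> Edeg h" for f
    proof (rule Elin_eqI)
      show "f \<in> Elin" "0 \<in> Elin" using f Edeg_Elin F.subspace_0[OF subspace_Elin] by auto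
      fix k v assume v: "v \<in> deg V k"
      show "f v = 0 v"
      \<comment> \<open>The multiples of \<rho> form a group and h is not one of them, so k and k +
        h are not both multiples; hence v = 0 or f v = 0.\<close>
      proof (cases "k \<in> range (\<lambda>n::int. \<rho> * of_int n)")
        case False
        then show ?thesis using triv[OF False] v ElinD(5)[OF Edeg_Elin[OF f]] by simp
      next
        case True
        then obtain n :: int where n: "k = \<rho> * of_int n" by blast
        have "k + h \<notin> range (\<lambda>n::int. \<rho> * of_int n)"
        proof
          assume "k + h \<in> range (\<lambda>n::int. \<rho> * of_int n)"
          then obtain m :: int where "k + h = \<rho> * of_int m" by blast
          then have "h = \<rho> * of_int (m - n)" by (simp add: n algebra_simps)
          then show False using h by blast
        qed
        then show ?thesis using triv EdegD[OF f v] by simp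
      qed
    qed
    then have "Edeg h = {0}" using F.subspace_0[OF subspace_Edeg] by blast
    then show ?thesis by (simp only: endalg_simps image_insert image_empty j_zero)
  qed
  ultimately show ?thesis
    unfolding graded_super_space_def
    using vector_space_su dE.subspace_C dE.direct_sum pE.direct_sum by (simp add: endalg_def)
qed

lemma end_graded_associative: "graded_associative_algebra \<rho> endalg"
  unfolding graded_associative_algebra_def
proof (intro conjI end_graded_super_space)
  have add: "f \<circ> (g + e) = (f \<circ> g) + (f \<circ> e)" "f \<circ> fscl c g = fscl c (f \<circ> g)" if "f \<in> Efun" for f g e c
    using ElinD[OF Efun_Elin[OF that]] by (simp_all add: fun_eq_iff fscl_def)
  have add': "(g + e) \<circ> f = (g \<circ> f) + (e \<circ> f)" "fscl c g \<circ> f = fscl c (g \<circ> f)"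
    for f g e :: "'v \<Rightarrow> 'v" and c
    by (simp_all add: fun_eq_iff fscl_def)
  show "even_bilin endalg (mul endalg)"
    unfolding even_bilin_def lin_map_def
    by (auto simp: Efun_comp Epar_comp[simplified] add add' simp flip: j_add j_scale)
  have p: "f \<circ> proj = f" "proj \<circ> f = f" if "f \<in> Efun" for f
    using ElinD[OF Efun_Elin[OF that]] by (simp_all add: fun_eq_iff)
  show "is_unit endalg"
    by (auto simp: is_unit_def p Edeg_Efun[OF proj_Edeg])
  show "\<forall>x\<in>car endalg. \<forall>y\<in>car endalg. \<forall>z\<in>car endalg.
      mul endalg (mul endalg x y) z = mul endalg x (mul endalg y z)"
    by (auto simp: comp_assoc)
  show "\<forall>h k. \<forall>x\<in>deg endalg h. \<forall>y\<in>deg endalg k. mul endalg x y \<in> deg endalg (h + k)"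
    by (auto simp: Edeg_comp)
qed

lemma near_zero_super:
  shows "U.subspace (near h K 0)" "super_subset endalg (near h K 0)"
proof -
  show "U.subspace (near h K 0)"
  proof (rule U.subspaceI)
    show "0 \<in> near h K 0" using near_iff[of 0 h K 0] F.subspace_0[OF subspace_Edeg] by simp
    fix x y assume "x \<in> near h K 0" "y \<in> near h K 0"
    then obtain f g where "f \<in> Edeg h" "agree K 0 f" "x = j f" "g \<in> Edeg h" "agree K 0 g" "y = j g"
      by (auto simp: near_def)
    then show "x + y \<in> near h K 0"
      using F.subspace_add[OF subspace_Edeg, of f h g] by (auto simp: agree_def simp flip: j_add)
  next
    fix c x assume "x \<in> near h K 0"
    then obtain f where "f \<in> Edeg h" "agree K 0 f" "x = j f" by (auto simp: near_def)
    then show "su c x \<in> near h K 0"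
      using F.subspace_scale[OF subspace_Edeg, of f h c]
        by (auto simp: agree_def fscl_def simp flip: j_scale)
  qed
  show "super_subset endalg (near h K 0)"
    unfolding super_subset_def
  proof (intro conjI ballI allI)
    show "near h K 0 \<subseteq> car endalg" using Edeg_Efun by (auto simp: near_def)
    fix x p assume "x \<in> near h K 0"
    then obtain f where f: "f \<in> Edeg h" "agree K 0 f" "x = j f" by (auto simp: near_def)
    \<comment> \<open>The parity components of v stay in V_k, where f vanishes.\<close>
    have "ppart p f v = 0" if "k \<le> K" "v \<in> deg V k" for k v
    proof -
      have "f (component (par V) v q) = 0" for q
        using f(2) that par_component_deg[OF that(2)] by (auto simp: agree_def)
      then show ?thesis using that deg_car by (simp add: ppart_def pr.component_zero)
    qed
    then show "component (par endalg) x p \<in> near h K 0"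
      using f ppart_Edeg[OF f(1)] by (simp add: endalg_def component_end Edeg_Efun agree_def)
  qed
qed

lemma end_linear_topologies: "linear_topologies endalg"
  unfolding linear_topologies_def
proof (intro allI conjI impI)
  fix h
  show "topspace (topo endalg h) = deg endalg h" by simp
  show "continuous_map (prod_topology (topo endalg h) (topo endalg h)) (topo endalg h) (\<lambda>(x, y). x + y)"
    unfolding endalg_simps
  proof (rule continuous_binary[where m = "(+)"])
    fix f g K
    show "\<exists>K1 K2. \<forall>f'\<in>Edeg h. \<forall>g'\<in>Edeg h. agree K1 f f' \<longrightarrow> agree K2 g g' \<longrightarrow> agree K (f + g) (f' + g')"
      by (intro exI[of _ K]) (auto simp: agree_def)
  qed (simp_all add: F.subspace_add[OF subspace_Edeg] j_add)
  show "continuous_map (prod_topology (discrete_topology UNIV) (topo endalg h)) (topo endalg h)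
      (\<lambda>(c, x). scl endalg c x)"
    unfolding continuous_map_def endalg_simps
  proof (intro conjI allI impI)
    have scl: "su c (j f) = j (fscl c f)" "fscl c f \<in> Edeg h" if "f \<in> Edeg h" for c f
      using that by (simp_all add: j_scale F.subspace_scale[OF subspace_Edeg])
    then show "(\<lambda>(c, x). su c x) \<in> topspace (prod_topology (discrete_topology UNIV) (topo_end h))
      \<rightarrow> topspace (topo_end h)"
      by auto
    fix U assume U: "openin (topo_end h) U"
    show "openin (prod_topology (discrete_topology UNIV) (topo_end h))
        {z \<in> topspace (prod_topology (discrete_topology UNIV) (topo_end h)). (case z
          of (c, x) \<Rightarrow> su c x) \<in> U}"
      (is "openin _ ?W")
      unfolding openin_prod_topology_alt
    proof (intro allI impI)
      fix c x
      assume "(c, x) \<in> ?W"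
      then obtain f where f: "f \<in> Edeg h" "x = j f" "su c x \<in> U" by auto
      then have "j (fscl c f) \<in> U" using scl by simp
      then obtain K where K: "near h K (fscl c f) \<subseteq> U"
        using near_open_subset[OF U scl(2)[OF f(1)]] by blast
      have M: "su c y \<in> U" if y: "y \<in> near h K f" for y
      proof -
        obtain g where g: "g \<in> Edeg h" "agree K f g" "y = j g" using y by (auto simp: near_def)
        then have "j (fscl c g) \<in> near h K (fscl c f)" using scl by (simp add: agree_def fscl_def)
        then show ?thesis using K g scl by auto
      qed
      show "\<exists>S T. openin (discrete_topology UNIV) S \<and> openin (topo_end h) T \<and> c \<in> S \<and> x \<in> T \<and> S \<times> T \<subseteq> ?W"
        by (intro exI[of _ "{c}"] exI[of _ "near h K f"])
          (use M f in \<open>auto simp: openin_near dest: subsetD[OF near_subset]\<close>)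
    qed
  qed
  fix U assume U: "openin (topo endalg h) U \<and> 0 \<in> U"
  obtain K where "near h K 0 \<subseteq> U"
    by (rule near_open_subset[of h U 0]) (use U F.subspace_0[OF subspace_Edeg] in auto)
  then show "\<exists>N. openin (topo endalg h) N \<and> N \<subseteq> U \<and> module.subspace (scl endalg) N
    \<and> super_subset endalg N"
    using near_zero_super openin_near by (intro exI[of _ "near h K 0"]) simp
qed

lemma end_Hausdorff: "Hausdorff_space (topo_end h)"
  unfolding Hausdorff_space_def
proof (intro allI impI)
  fix x y assume xy: "x \<in> topspace (topo_end h) \<and> y \<in> topspace (topo_end h) \<and> x \<noteq> y"
  then obtain f g where f: "f \<in> Edeg h" "x = j f" and g: "g \<in> Edeg h" "y = j g" and "f \<noteq> g" by auto
  have "\<exists>k v. v \<in> deg V k \<and> f v \<noteq> g v"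
  proof (rule ccontr)
    assume "\<not> ?thesis"
    then have "f = g" by (intro Elin_eqI Edeg_Elin[OF f(1)] Edeg_Elin[OF g(1)]) blast
    then show False using \<open>f \<noteq> g\<close> by simp
  qed
  then obtain k v where v: "v \<in> deg V k" "f v \<noteq> g v" by blast
  have disj: "disjnt (near h k f) (near h k g)"
    using v unfolding disjnt_iff near_def agree_def by force
  show "\<exists>S T. openin (topo_end h) S \<and> openin (topo_end h) T \<and> x \<in> S \<and> y \<in> T \<and> disjnt S T"
    by (rule exI[of _ "near h k f"], rule exI[of _ "near h k g"]) (simp add: f g openin_near disj)
qed

lemma end_mul_continuous:
  "continuous_map (prod_topology (topo_end h) (topo_end k)) (topo_end (h
    + k)) (\<lambda>(x, y). j (act x \<circ> act y))"
proof (rule continuous_binary[where m = "(\<circ>)"])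
  fix f g K assume f: "f \<in> Edeg h" and g: "g \<in> Edeg k"
  show "\<exists>K1 K2. \<forall>f'\<in>Edeg h. \<forall>g'\<in>Edeg k. agree K1 f f' \<longrightarrow> agree K2 g g' \<longrightarrow> agree K (f \<circ> g) (f' \<circ> g')"
  \<comment> \<open>On V_l with l <= K the right factor has values in degree l + k, so the left
    factor must be controlled up to degree K + k.\<close>
  proof (rule exI[of _ "K + k"], rule exI[of _ K], intro ballI impI)
    fix f' g' assume g': "g' \<in> Edeg k" and agree: "agree (K + k) f f'" "agree K g g'"
    have "f (g v) = f' (g' v)" if "l \<le> K" "v \<in> deg V l" for l v
    proof -
      have "l + k \<le> K + k" using that(1) by simp
      then have "f (g' v) = f' (g' v)" using agree(1) EdegD[OF g' that(2)] unfolding agree_def by blast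
      then show ?thesis using agree(2) that by (simp add: agree_def)
    qed
    then show "agree K (f \<circ> g) (f' \<circ> g')" by (simp add: agree_def)
  qed
qed (simp_all add: Edeg_comp)

text \<open>Along a Cauchy filter the value at each vector is eventually constant, and these
  eventual values form the limit \<open>w\<close>. By \<open>stable\<close>, for each K a single f
  agrees up to degree K with almost all elements of the filter; this makes the convergence uniform
  on all V_k with k <= K.\<close>

lemma end_complete: "complete_degreewise endalg"
  unfolding complete_degreewise_def
proof (intro allI impI)
  fix h F assume "Defs.cauchy_filter endalg h F"
  then have nt: "F \<noteq> bot" and deg: "eventually (\<lambda>x. x \<in> j ` Edeg h) F"
    and cauchy: "\<And>U. openin (topo_end h) U \<Longrightarrow> 0 \<in> U \<Longrightarrow> eventually (\<lambda>(x, y). x - y \<in> U) (prod_filter F F)"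
    by (simp_all add: Defs.cauchy_filter_def)
  have stable: "\<exists>f\<in>Edeg h. eventually (\<lambda>x. \<exists>g\<in>Edeg h. x = j g \<and> agree K f g) F" for K
  proof -
    have "0 \<in> near h K 0" using near_iff[of 0 h K 0] F.subspace_0[OF subspace_Edeg] by simp
    from cauchy[OF openin_near this] obtain P Q where PQ: "eventually P F" "eventually Q F"
      "\<And>x y. P x \<Longrightarrow> Q y \<Longrightarrow> x - y \<in> near h K 0"
      by (auto simp: eventually_prod_filter)
    have ev: "eventually (\<lambda>x. P x \<and> Q x \<and> x \<in> j ` Edeg h) F"
      using PQ(1,2) deg by eventually_elim simp
    then obtain x where x: "P x" "Q x" "x \<in> j ` Edeg h"
      using eventually_happens[OF ev] nt by blast
    then obtain f where f: "f \<in> Edeg h" "x = j f" by blast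
    have "eventually (\<lambda>x. \<exists>g\<in>Edeg h. x = j g \<and> agree K f g) F"
      using ev
    proof eventually_elim
      case (elim y)
      then obtain g where g: "g \<in> Edeg h" "y = j g" by blast
      have "j (f - g) \<in> near h K 0" using PQ(3)[OF x(1), of y] elim by (simp add: f g j_diff)
      then have "agree K f g" by (simp add: agree_def)
      then show ?case using g by blast
    qed
    then show ?thesis using f by blast
  qed
  have lin: "eventually (\<lambda>x. act x \<in> Edeg h) F"
    using deg by eventually_elim auto
  define w where "w v = (THE u. eventually (\<lambda>x. act x v = u) F)" for v
  have uniq: "u = u'" if "eventually (\<lambda>x. act x v = u) F" "eventually (\<lambda>x. act x v = u') F" for u u' v
  proof -
    have "eventually (\<lambda>x. u = u') F" using that by eventually_elim simp
    then show ?thesis using nt by (simp add: eventually_const_iff)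
  qed
  have wI: "w v = u" if "eventually (\<lambda>x. act x v = u) F" for u v
    unfolding w_def by (rule the_equality, rule that, rule uniq, assumption, rule that)
  have ev_deg: "\<exists>u. eventually (\<lambda>x. act x v = u) F" if v: "v \<in> deg V k" for v k
  proof -
    obtain f where "eventually (\<lambda>x. \<exists>g\<in>Edeg h. x = j g \<and> agree k f g) F" using stable by blast
    then have "eventually (\<lambda>x. act x v = f v) F"
      by eventually_elim (use v in \<open>auto simp: agree_def\<close>)
    then show ?thesis by (rule exI[where x = "f v"])
  qed
  have ev_add: "eventually (\<lambda>x. act x (v + v') = u + u') F"
    if "eventually (\<lambda>x. act x v = u) F" "eventually (\<lambda>x. act x v' = u') F" for u u' v v'
    using that lin by eventually_elim (simp add: ElinD(1)[OF Edeg_Elin])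
  have scale: "eventually (\<lambda>x. act x (scl V c v) = scl V c u) F"
    if "eventually (\<lambda>x. act x v = u) F" for u c v
    using that lin by eventually_elim (simp add: ElinD(2)[OF Edeg_Elin])
  have proj: "eventually (\<lambda>x. act x (proj v) = act x v) F" for v
    using lin by eventually_elim (simp add: ElinD(3)[OF Edeg_Elin])
  have ev_car: "\<exists>u. eventually (\<lambda>x. act x v = u) F" if "v \<in> car V" for v
    using that
  proof (induction v rule: deg_induct)
    case (deg k v)
    then show ?case by (rule ev_deg)
  next
    case (add x y)
    then obtain u u' where "eventually (\<lambda>z. act z x = u) F" "eventually (\<lambda>z. act z y = u') F" by blast
    from ev_add[OF this] show ?case by (rule exI[where x = "u + u'"])
  qed
  have "\<exists>u. eventually (\<lambda>x. act x v = u) F" for v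
  proof -
    obtain u where "eventually (\<lambda>x. act x (proj v) = u) F"
      using ev_car[OF proj_car] by blast
    then have "eventually (\<lambda>x. act x v = u) F" using proj[of v] by eventually_elim simp
    then show ?thesis by (rule exI[where x = u])
  qed
  then have w: "eventually (\<lambda>x. act x v = w v) F" for v
    using wI[of v] by fastforce
  have "w \<in> Elin"
    unfolding Elin_def
  proof (intro CollectI conjI allI)
    show "w (x + y) = w x + w y" for x y by (rule wI[OF ev_add[OF w w]])
    show "w (scl V c x) = scl V c (w x)" for c x by (rule wI[OF scale[OF w]])
    show "w (proj x) = w x" for x
      by (rule wI) (use proj[of x] w[of x] in \<open>eventually_elim, simp\<close>)
    fix x
    have "eventually (\<lambda>y. w x \<in> car V) F"
      using w[of x] lin by eventually_elim (metis ElinD(4) Edeg_Elin)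
    then show "w x \<in> car V" using nt by (simp add: eventually_const_iff)
  qed
  moreover have "w v \<in> deg V (k + h)" if v: "v \<in> deg V k" for k v
  proof -
    have "eventually (\<lambda>y. w v \<in> deg V (k + h)) F"
      using w[of v] lin by eventually_elim (metis EdegD v)
    then show ?thesis using nt by (simp add: eventually_const_iff)
  qed
  ultimately have w_deg: "w \<in> Edeg h" by (simp add: Edeg_def)
  have "limitin (topo_end h) (\<lambda>y. y) (j w) F"
    unfolding limitin_def
  proof (intro conjI allI impI)
    show "j w \<in> topspace (topo_end h)" using w_deg by simp
    fix U assume "openin (topo_end h) U \<and> j w \<in> U"
    then obtain K where K: "near h K w \<subseteq> U" using near_open_subset[OF _ w_deg, of U] by blast
    obtain f where f: "f \<in> Edeg h" "eventually (\<lambda>x. \<exists>g\<in>Edeg h. x = j g \<and> agree K f g) F"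
      using stable by blast
    have "agree K f w"
      unfolding agree_def
    proof (intro allI impI ballI)
      fix k v assume kv: "k \<le> K" "v \<in> deg V k"
      from f(2) have "eventually (\<lambda>x. act x v = f v) F"
        by eventually_elim (use kv in \<open>auto simp: agree_def\<close>)
      then show "f v = w v" using wI by simp
    qed
    show "eventually (\<lambda>x. x \<in> U) F"
      using f(2)
    proof eventually_elim
      case (elim x)
      then obtain g where "g \<in> Edeg h" "x = j g" "agree K f g" by blast
      then have "x \<in> near h K w" by (simp add: agree_trans[OF agree_sym[OF \<open>agree K f w\<close>]])
      then show ?case using K by blast
    qed
  qed
  then show "\<exists>x. limitin (topo endalg h) (\<lambda>y. y) x F" by auto
qed

text \<open>Agreement up to K is an equivalence relation, so the complement of a basic neighbourhood
  is a union of others. Closedness lets the neighbourhood absorb the closure in the FZ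
  condition.\<close>

lemma closedin_near: "closedin (topo_end h) (near h K f)"
  unfolding closedin_def openin_topo_end
proof (intro conjI ballI impI)
  show "near h K f \<subseteq> topspace (topo_end h)" using near_subset by simp
  show "topspace (topo_end h) - near h K f \<subseteq> j ` Edeg h" by auto
  fix g assume g: "g \<in> Edeg h" "j g \<in> topspace (topo_end h) - near h K f"
  then have "\<not> agree K f g" by simp
  have "near h K g \<subseteq> topspace (topo_end h) - near h K f"
  proof
    fix x assume "x \<in> near h K g"
    then obtain e where e: "e \<in> Edeg h" "agree K g e" "x = j e" by (auto simp: near_def)
    have "\<not> agree K f e" using \<open>\<not> agree K f g\<close> agree_trans[OF _ agree_sym[OF e(2)]] by blast
    then show "x \<in> topspace (topo_end h) - near h K f" by (simp add: e)
  qed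
  then show "\<exists>L. near h L g \<subseteq> topspace (topo_end h) - near h K f" ..
qed

lemma end_fz_complete: "fz_complete \<rho> endalg"
  unfolding fz_complete_def
proof (intro conjI allI impI end_graded_associative end_linear_topologies end_complete)
  show "continuous_map (prod_topology (topo endalg h) (topo endalg k)) (topo endalg (h + k))
      (\<lambda>(x, y). mul endalg x y)" for h k
    using end_mul_continuous by simp
  show "Hausdorff_space (topo endalg h)" for h by (simp add: end_Hausdorff)
  fix h U assume U: "openin (topo endalg h) U \<and> 0 \<in> U"
  obtain K where K: "near h K 0 \<subseteq> U"
    by (rule near_open_subset[of h U 0]) (use U F.subspace_0[OF subspace_Edeg] in auto)
  obtain H where H: "\<And>h. h < H \<Longrightarrow> deg V h = {0}" using truncated by (auto simp: truncated_def)
  \<comment> \<open>If l < k and m <= K, then m + l < H, so a right factor of degree l maps V_m to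
    0.\<close>
  define k where "k = \<lfloor>H - K\<rfloor>"
  let ?D = "{mul endalg x y | x y l. l < of_int k \<and> x \<in> deg endalg (h - l) \<and> y \<in> deg endalg l}"
  have "?D \<subseteq> near h K 0"
  proof
    fix z assume "z \<in> ?D"
    then obtain x y l where z: "z = mul endalg x y" "l < of_int k" "x \<in> deg endalg (h - l)" "y \<in>
      deg endalg l"
      by blast
    then obtain f g where f: "f \<in> Edeg (h - l)" "x = j f" and g: "g \<in> Edeg l" "y = j g" by auto
    have "f (g v) = 0" if "m \<le> K" "v \<in> deg V m" for m v
    proof -
      have "of_int k \<le> H - K" unfolding k_def by linarith
      then have "m + l < H" using z(2) that(1) by linarith
      then have "g v = 0" using H EdegD[OF g(1) that(2)] by blast
      then show ?thesis using ElinD(5)[OF Edeg_Elin[OF f(1)]] by simp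
    qed
    then show "z \<in> near h K 0"
      using Edeg_comp[OF f(1) g(1)] by (simp add: z f g agree_def)
  qed
  then have "U.span ?D \<subseteq> near h K 0" by (rule U.span_minimal) (rule near_zero_super)
  then have "topo_end h closure_of U.span ?D \<subseteq> near h K 0"
    by (rule closure_of_minimal) (rule closedin_near)
  then have "topo endalg h closure_of module.span (scl endalg) ?D \<subseteq> U"
    unfolding endalg_simps(1,7) using K by (rule subset_trans)
  then show "\<exists>k::int. topo endalg h closure_of module.span (scl endalg)
      {mul endalg x y | x y l. l < of_int k \<and> x \<in> deg endalg (h - l) \<and> y \<in> deg endalg l} \<subseteq> U"
    by (rule exI[where x = k])
qed

end

section \<open>The adjoint representation\<close>

context end_model
begin

sublocale B: fz_complete_algebra \<rho> endalg
  by unfold_locales (rule end_fz_complete)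

section \<open>Modes of states as endomorphisms\<close>

definition mode :: "int \<Rightarrow> 'v \<Rightarrow> 'v \<Rightarrow> 'v" where
  "mode t a = (\<lambda>v. nprod V t a (proj v))"

lemma nprod_zero [simp]: "y \<in> car V \<Longrightarrow> nprod V n 0 y = 0" "y \<in> car V \<Longrightarrow> nprod V n y 0 = 0"
  using nprod_scale_left[of 0 y n 0] nprod_scale_right[of y 0 n 0] by simp_all

lemma mode_Elin: "a \<in> car V \<Longrightarrow> mode t a \<in> Elin"
  by (simp add: Elin_def mode_def proj_add proj_scale nprod_add_right nprod_scale_right)

lemma mode_Edeg: "a \<in> deg V h \<Longrightarrow> mode t a \<in> Edeg (h - of_int t - 1)"
proof -
  assume a: "a \<in> deg V h"
  have "mode t a v \<in> deg V (k + (h - of_int t - 1))" if "v \<in> deg V k" for k v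
    using nprod_deg[OF a that, of t] deg_car[OF that] by (simp add: mode_def algebra_simps)
  then show ?thesis using mode_Elin[OF deg_car[OF a]] by (simp add: Edeg_def)
qed

lemma mode_add: "a \<in> car V \<Longrightarrow> b \<in> car V \<Longrightarrow> mode t (a + b) = mode t a + mode t b"
  by (simp add: mode_def fun_eq_iff nprod_add_left)

lemma mode_scale: "a \<in> car V \<Longrightarrow> mode t (scl V c a) = fscl c (mode t a)"
  by (simp add: mode_def fscl_def fun_eq_iff nprod_scale_left)

lemma mode_Efun: "a \<in> car V \<Longrightarrow> mode t a \<in> Efun"
proof (induction a rule: deg_induct)
  case (deg h a)
  then show ?case using Edeg_Efun[OF mode_Edeg] by blast
next
  case (add a b)
  then show ?case using F.subspace_add[OF subspace_Efun] by (simp only: mode_add)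
qed

lemma mode_Epar: "a \<in> par V p \<Longrightarrow> mode t a \<in> Epar p"
proof -
  assume a: "a \<in> par V p"
  have "mode t a v \<in> par V (p \<noteq> q)" if "v \<in> par V q" for q v
    using nprod_par[OF a that] par_car[OF that] by (simp add: mode_def)
  then show ?thesis using mode_Efun[OF par_car[OF a]] by (simp add: Epar_def)
qed

definition modes :: "'v \<Rightarrow> int \<Rightarrow> 'u" where
  "modes a = (\<lambda>t. j (mode t a))"

lemma modes_add: "a \<in> car V \<Longrightarrow> b \<in> car V \<Longrightarrow> modes (a + b) = modes a + modes b"
  by (simp add: fun_eq_iff modes_def mode_add j_add)

lemma modes_homogeneous: "a \<in> deg V h \<Longrightarrow> modes a \<in> homogeneous_dist endalg h"
  using mode_Edeg by (auto simp: homogeneous_dist_def modes_def)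

lemma modes_carrier: "a \<in> car V \<Longrightarrow> modes a \<in> dist_carrier endalg"
proof (induction a rule: deg_induct)
  case (deg h a)
  then show ?case using B.homogeneous_dist_carrier[OF modes_homogeneous] by blast
next
  case (add a b)
  interpret d: vector_space "dist_scl endalg" by (rule B.vector_space_dist_scl)
  show ?case using add d.subspace_add[OF B.subspace_dist_carrier] by (simp only: modes_add)
qed

lemma component_field:
  assumes "a \<in> car V"
  shows "component (par endalg) (modes a t) p = modes (component (par V) a p) t"
  by (rule component_map[OF pr.internal_direct_sum_axioms B.pr.internal_direct_sum_axioms,
        of "\<lambda>a. modes a t" "\<lambda>i. i"])
    (use assms mode_Epar in \<open>auto simp: modes_add, auto simp: modes_def\<close>)

lemma sopp_field:
  assumes a: "a \<in> car V" and b: "b \<in> car V"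
  shows "sopp endalg (modes a s) (modes b t) = j (\<lambda>v. opposite s a t b (proj v))"
proof -
  have koszul_j: "koszul p q (j f) = j (koszul p q f)" for p q f
    by (simp add: koszul_def j_minus)
  have koszul_fun: "koszul p q f v = koszul p q (f v)" for p q and f :: "'v \<Rightarrow> 'v" and v
    by (simp add: koszul_def)
  have "sopp endalg (modes a s) (modes b t)
    = j (\<Sum>p\<in>UNIV. \<Sum>q\<in>UNIV. koszul p q (mode t (component (par V) b q) \<circ> mode s (component (par V) a p)))"
    (is "_ = j ?S")
    unfolding sopp_def component_field[OF a] component_field[OF b]
    by (simp only: j_sum endalg_simps modes_def act_j koszul_j)
  also have "?S = (\<lambda>v. opposite s a t b (proj v))"
    using a b by (simp add: fun_eq_iff sum_apply koszul_fun mode_def opposite_def)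
  finally show ?thesis .
qed

lemma scomm_field:
  assumes a: "a \<in> car V" and b: "b \<in> car V"
  shows "scomm endalg (modes a s) (modes b t)
    = j (\<lambda>v. nprod V s a (nprod V t b (proj v)) - opposite s a t b (proj v))"
proof -
  have "scomm endalg (modes a s) (modes b t)
    = j ((mode s a \<circ> mode t b) - (\<lambda>v. opposite s a t b (proj v)))"
    unfolding scomm_def sopp_field[OF a b] by (simp only: j_diff endalg_simps modes_def act_j)
  also have "(mode s a \<circ> mode t b) - (\<lambda>v. opposite s a t b (proj v))
    = (\<lambda>v. nprod V s a (nprod V t b (proj v)) - opposite s a t b (proj v))"
    using b by (simp add: fun_eq_iff mode_def)
  finally show ?thesis .
qed

text \<open>Limits in the topology of agreement can be computed at each vector. For v of degree k
  the limit and a late partial sum have degree h parts that agree on V_k, while the partial sums at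
  v are eventually constant.\<close>

lemma suminf_pointwise:
  assumes x: "\<And>i. x i = j (F i)" and F: "\<And>i. F i \<in> Efun" and conv: "\<exists>l. fz_converges endalg x l"
    and vanish: "\<And>v. v \<in> car V \<Longrightarrow> \<exists>N. \<forall>i\<ge>N. F i v = 0"
  shows "\<exists>f\<in>Efun. fz_suminf endalg x = j f \<and> (\<forall>v\<in>car V. \<exists>N0. \<forall>N\<ge>N0. f v = (\<Sum>i<N. F i v))"
proof -
  from conv obtain l where l: "fz_converges endalg x l" ..
  then have "l \<in> j ` Efun" by (simp add: fz_converges_def)
  then obtain f where f: "f \<in> Efun" "l = j f" by blast
  have hom: "\<exists>N0. \<forall>N\<ge>N0. f v = (\<Sum>i<N. F i v)" if v: "v \<in> deg V k" for v k
  proof -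
    have vc: "v \<in> car V" using v by (rule deg_car)
    obtain N1 where N1: "\<forall>i\<ge>N1. F i v = 0" using vanish[OF vc] ..
    have const: "(\<Sum>i<N. F i v) = (\<Sum>i<N1. F i v)" if "N \<ge> N1" for N
      by (rule sum.mono_neutral_right) (use that N1 in auto)
    have car: "F i v \<in> car V" for i by (rule ElinD(4)[OF Efun_Elin[OF F]])
    \<comment> \<open>How late a partial sum must be depends on h, whereas N1 does not. Comparing
      with the constant value at N1 gives one candidate for all degrees.\<close>
    have "component (deg V) (f v) (k + h) = component (deg V) (\<Sum>i<N1. F i v) (k + h)" for h
    proof -
      have fh: "component Edeg f h \<in> Edeg h" by (rule Ed.component_in[OF f(1)])
      have "limitin (topo_end h) (\<lambda>N. \<Sum>i<N. component (deg endalg) (x i) h)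
          (component (deg endalg) l h) sequentially"
        using l by (simp only: fz_converges_def endalg_simps(7))
      then have "limitin (topo_end h) (\<lambda>N. j (\<Sum>i<N. component Edeg (F i) h)) (j (component Edeg f
        h)) sequentially"
        by (simp only: endalg_simps x f component_end F j_sum)
      moreover have "openin (topo_end h) (near h k (component Edeg f h))" by (rule openin_near)
      moreover have "j (component Edeg f h) \<in> near h k (component Edeg f h)" using fh by simp
      ultimately have "eventually (\<lambda>N. j (\<Sum>i<N. component Edeg (F i) h) \<in> near h k (component Edeg
        f h)) sequentially"
        unfolding limitin_def by blast
      then obtain N2 where N2: "\<forall>N\<ge>N2. j (\<Sum>i<N. component Edeg (F i) h) \<in> near h k (component Edeg f h)"
        by (auto simp: eventually_sequentially)
      define N where "N = max N1 N2"
      have "agree k (component Edeg f h) (\<Sum>i<N. component Edeg (F i) h)"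
        using N2 by (simp only: near_iff) (simp add: N_def)
      then have "component Edeg f h v = (\<Sum>i<N. component Edeg (F i) h) v"
        using v unfolding agree_def by blast
      then have "component (deg V) (f v) (k + h) = (\<Sum>i<N. component (deg V) (F i v) (k + h))"
        by (simp only: sum_apply Edeg_component[OF f(1) v] Edeg_component[OF F v])
      also have "\<dots> = component (deg V) (\<Sum>i<N. F i v) (k + h)"
        by (rule dg.component_sum[symmetric]) (rule car)
      finally show ?thesis using const[of N] by (simp add: N_def)
    qed
    from this[of "_ - k"] have "component (deg V) (f v) h = component (deg V) (\<Sum>i<N1. F i v) h" for h
      by simp
    with ElinD(4)[OF Efun_Elin[OF f(1)]] sum_car[OF car] have "f v = (\<Sum>i<N1. F i v)"
      by (rule dg.eq_by_components)
    then have "f v = (\<Sum>i<N. F i v)" if "N \<ge> N1" for N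
      by (rule trans[OF _ const[OF that, symmetric]])
    then show ?thesis by (intro exI[of _ N1] allI impI)
  qed
  have pointwise: "\<exists>N0. \<forall>N\<ge>N0. f v = (\<Sum>i<N. F i v)" if "v \<in> car V" for v
    using that
  proof (induction v rule: deg_induct)
    case (deg k v)
    then show ?case by (rule hom)
  next
    case (add v w)
    then obtain N0 N1 where "\<forall>N\<ge>N0. f v = (\<Sum>i<N. F i v)" "\<forall>N\<ge>N1. f w = (\<Sum>i<N. F i w)" by blast
    then have "f v + f w = (\<Sum>i<N. F i v) + (\<Sum>i<N. F i w)" if "N \<ge> max N0 N1" for N
      using that by (intro arg_cong2[where f = "(+)"]) auto
    then have "\<forall>N\<ge>max N0 N1. f (v + w) = (\<Sum>i<N. F i (v + w))"
      by (simp only: ElinD(1)[OF Efun_Elin[OF f(1)]] ElinD(1)[OF Efun_Elin[OF F]] sum.distrib) blast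
    then show ?case by (rule exI[where x = "max N0 N1"])
  qed
  show ?thesis
  proof (rule bexI[OF _ f(1)], rule conjI)
    show "fz_suminf endalg x = j f" using B.fz_suminf_eq[OF l] f(2) by simp
  qed (use pointwise in blast)
qed

text \<open>At each vector both convergent halves become finite sums, and beyond the three bounds
  their total is the right side of \<open>nprod_mul\<close>.\<close>

lemma normal_ordered_field:
  assumes a: "a \<in> car V" and b: "b \<in> car V"
  shows "normal_ordered endalg (modes a) (modes b) m = modes (mul V a b) m"
proof -
  note conv = B.normal_ordered_converges[OF modes_carrier[OF a] modes_carrier[OF b], of m]
  have opp_Efun: "(\<lambda>v. opposite s a t b (proj v)) \<in> Efun" for s t
  proof -
    have "sopp endalg (modes a s) (modes b t) \<in> car endalg"
      by (rule B.sopp_car) (simp_all add: modes_def mode_Efun a b)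
    then show ?thesis unfolding sopp_field[OF a b] by auto
  qed
  let ?x = "\<lambda>i. mul endalg (modes a (- 1 - int i)) (modes b (m + int i))"
  let ?y = "\<lambda>i. sopp endalg (modes a (int i)) (modes b (m - 1 - int i))"
  have "\<exists>f\<in>Efun. fz_suminf endalg ?x = j f \<and>
     (\<forall>v\<in>car V. \<exists>N0. \<forall>N\<ge>N0. f v = (\<Sum>i<N. (mode (- 1 - int i) a \<circ> mode (m + int i) b) v))"
  proof (rule suminf_pointwise[OF _ _ conv(1)])
    show "\<exists>N. \<forall>i\<ge>N. (mode (- 1 - int i) a \<circ> mode (m + int i) b) v = 0" if v: "v \<in> car V" for v
    proof -
      obtain N where "\<forall>i\<ge>N. nprod V (m + int i) b v = 0" using nprod_bounded[OF b v] ..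
      then have "\<forall>i\<ge>N. (mode (- 1 - int i) a \<circ> mode (m + int i) b) v = 0"
        using a v by (simp add: mode_def)
      then show ?thesis ..
    qed
    show "?x i = j (mode (- 1 - int i) a \<circ> mode (m + int i) b)" for i
      by (simp only: endalg_simps modes_def act_j)
  qed (intro Efun_comp mode_Efun a b)
  then obtain f where f: "f \<in> Efun" "fz_suminf endalg ?x = j f"
    "\<And>v. v \<in> car V \<Longrightarrow> \<exists>N0. \<forall>N\<ge>N0. f v = (\<Sum>i<N. (mode (- 1 - int i) a \<circ> mode (m + int i) b) v)"
    by blast
  have "\<exists>f\<in>Efun. fz_suminf endalg ?y = j f \<and>
     (\<forall>v\<in>car V. \<exists>N0. \<forall>N\<ge>N0. f v = (\<Sum>i<N. (\<lambda>v. opposite (int i) a (m - 1 - int i) b (proj v)) v))"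
  proof (rule suminf_pointwise[OF _ _ conv(2)])
    show "\<exists>N. \<forall>i\<ge>N. opposite (int i) a (m - 1 - int i) b (proj v) = 0" if v: "v \<in> car V" for v
    proof -
      have "\<exists>N. \<forall>i\<ge>N. lam V i (component (par V) a p) v = 0" for p
        using lam_bounded a v by simp
      then obtain M where M: "\<forall>i\<ge>M p. lam V i (component (par V) a p) v = 0" for p by metis
      have "\<forall>i\<ge>M False + M True. opposite (int i) a (m - 1 - int i) b (proj v) = 0"
        using M v b by (simp add: opposite_def UNIV_bool koszul_def)
      then show ?thesis ..
    qed
  qed (simp_all add: sopp_field a b opp_Efun)
  then obtain g where g: "g \<in> Efun" "fz_suminf endalg ?y = j g"
    "\<And>v. v \<in> car V \<Longrightarrow> \<exists>N0. \<forall>N\<ge>N0. g v = (\<Sum>i<N. opposite (int i) a (m - 1 - int i) b (proj v))"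
    by blast
  have "(f + g) v = mode m (mul V a b) v" for v
  proof -
    have pv: "proj v \<in> car V" by simp
    obtain N1 where N1: "\<forall>N\<ge>N1. f (proj v) = (\<Sum>i<N. (mode (- 1 - int i) a \<circ> mode (m
      + int i) b) (proj v))"
      using f(3)[OF pv] ..
    obtain N2 where N2: "\<forall>N\<ge>N2. g (proj v) = (\<Sum>i<N. opposite (int i) a (m - 1 - int i) b (proj
      (proj v)))"
      using g(3)[OF pv] ..
    obtain N3 where N3: "\<forall>N\<ge>N3. nprod V m (mul V a b) (proj v)
       = (\<Sum>i<N. nprod V (- 1 - int i) a (nprod V (m + int i) b (proj v)))
         + (\<Sum>k<N. opposite (int k) a (m - 1 - int k) b (proj v))"
      using nprod_mul[OF a b pv] ..
    define N where "N = N1 + N2 + N3"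
    have "(f + g) v = f (proj v) + g (proj v)"
      by (simp add: ElinD(3)[OF Efun_Elin[OF f(1)]] ElinD(3)[OF Efun_Elin[OF g(1)]])
    also have "\<dots> = (\<Sum>i<N. nprod V (- 1 - int i) a (nprod V (m + int i) b (proj v)))
         + (\<Sum>k<N. opposite (int k) a (m - 1 - int k) b (proj v))"
      using N1[rule_format, of N] N2[rule_format, of N] b by (simp add: N_def mode_def)
    also have "\<dots> = mode m (mul V a b) v"
      using N3[rule_format, of N] by (simp add: N_def mode_def)
    finally show ?thesis .
  qed
  then have fg: "f + g = mode m (mul V a b)" by (rule ext)
  have "modes (mul V a b) m = j f + j g"
    by (simp only: modes_def fg[symmetric] j_add)
  then show ?thesis
    unfolding normal_ordered_def by (simp only: f(2) g(2))
qed

lemma dist_lam_field: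
  assumes a: "a \<in> car V" and b: "b \<in> car V"
  shows "dist_lam endalg n (modes a) (modes b) m = modes (lam V n a b) m"
proof -
  have "dist_lam endalg n (modes a) (modes b) m
    = j (\<Sum>i\<le>n. fscl ((- 1) ^ i * of_nat (n choose i)) (\<lambda>v. nprod V (int n - int i) a (nprod V (m
      + int i) b (proj v))
        - opposite (int n - int i) a (m + int i) b (proj v)))"
    (is "_ = j ?S")
    unfolding dist_lam_def by (simp only: scomm_field a b endalg_simps j_sum j_scale)
  also have "?S = mode m (lam V n a b)"
    using nprod_lam[OF a b proj_car] by (simp add: fun_eq_iff sum_apply fscl_def mode_def)
  finally show ?thesis by (simp only: modes_def)
qed

lemma der_one: "der V (one V) = 0"
  using der_mul[of "one V" "one V"] by (simp add: mul_one one_mul)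

lemma modes_one: "modes (one V) = one (dist endalg)"
proof
  fix t
  have "mode t (one V) = (if t = - 1 then proj else 0)"
  proof (cases "t \<ge> 0")
    case True
    then obtain n where n: "t = int n" using nonneg_int_cases by blast
    then show ?thesis by (simp add: fun_eq_iff mode_def lam_one)
  next
    case False
    define n where "n = nat (- 1 - t)"
    have t: "t = - 1 - int n" using False by (simp add: n_def)
    have "dpow V n (one V) = (if n = 0 then one V else 0)"
    proof (cases n)
      case (Suc k)
      have der0: "der V 0 = 0" using der_scale[of 0 0] by simp
      have "(der V ^^ Suc k) (one V) = 0" by (induction k) (simp_all add: der_one der0)
      then show ?thesis by (simp add: dpow_def Suc)
    qed (simp add: dpow_def)
    then show ?thesis
      using even_bilinD(3)[OF even_bilin_mul, of 0 _ 0]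
        by (simp add: fun_eq_iff mode_def t nprod_neg one_mul)
  qed
  then show "modes (one V) t = one (dist endalg) t" by (simp add: modes_def)
qed

definition state_field :: "'v \<Rightarrow> int \<Rightarrow> 'u" where
  "state_field = (\<lambda>a\<in>car V. modes a)"

lemma state_field_hom: "state_field \<in> va_hom V (dist endalg)"
proof (rule va_homI)
  have eq: "state_field a = modes a" if "a \<in> car V" for a using that by (simp add: state_field_def)
  show "state_field \<in> extensional (car V)" by (simp add: state_field_def)
  show "state_field x \<in> car (dist endalg)" if "x \<in> car V" for x
    using that by (simp add: eq modes_carrier)
  show "state_field (x + y) = state_field x + state_field y" if "x \<in> car V" "y \<in> car V" for x y
    using that by (simp add: eq modes_add)
  show "state_field (scl V c x) = scl (dist endalg) c (state_field x)" if "x \<in> car V" for c x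
    using that by (simp add: eq fun_eq_iff modes_def dist_scl_def mode_scale j_scale)
  show "state_field x \<in> par (dist endalg) p" if "x \<in> par V p" for p x
    using mode_Epar[OF that] par_car[OF that] by (simp add: eq modes_carrier) (simp add: modes_def)
  show "state_field x \<in> deg (dist endalg) h" if "x \<in> deg V h" for h x
    using modes_homogeneous[OF that] deg_car[OF that] by (simp add: eq)
  show "state_field (one V) = one (dist endalg)" by (simp add: eq modes_one del: dist_simps)
  show "state_field (der V x) = der (dist endalg) (state_field x)" if "x \<in> car V" for x
  proof -
    have "mode t (der V x) = fscl (- of_int t) (mode (t - 1) x)" for t
      using that by (simp add: mode_def fun_eq_iff fscl_def nprod_der)
    then show ?thesis
      by (intro ext) (simp only: eq va_closed that modes_def j_scale dist_simps endalg_simps)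
  qed
  show "state_field (mul V x y) = mul (dist endalg) (state_field x) (state_field y)"
    if "x \<in> car V" "y \<in> car V" for x y
    using that by (simp add: eq fun_eq_iff normal_ordered_field)
  show "state_field (lam V n x y) = lam (dist endalg) n (state_field x) (state_field y)"
    if "x \<in> car V" "y \<in> car V" for n x y
    using that by (simp add: eq fun_eq_iff dist_lam_field)
qed

lemma state_field_inj:
  assumes "a \<in> car V" "b \<in> car V" "state_field a = state_field b"
  shows "a = b"
proof -
  have "modes a (- 1) = modes b (- 1)" using assms by (simp add: state_field_def)
  then have "mode (- 1) a (one V) = mode (- 1) b (one V)" by (simp add: modes_def)
  then show ?thesis using assms by (simp add: mode_def mul_one)
qed

end

section \<open>Full faithfulness\<close>

text \<open>A basis of the source goes into the independent family by x \<mapsto> \<iota> (c x).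
  Thus \<open>c\<close> is a mere injection of sets, and only the cardinality of the index type
  matters.\<close>

lemma linear_embedding:
  fixes s :: "'k::field \<Rightarrow> 'a::ab_group_add \<Rightarrow> 'a" and su :: "'k \<Rightarrow> 'u::ab_group_add \<Rightarrow> 'u"
    and \<iota> :: "'i \<Rightarrow> 'u" and c :: "'a \<Rightarrow> 'i"
  assumes "vector_space s" "vector_space su" and "inj \<iota>" "\<not> module.dependent su (range \<iota>)" and "inj c"
  shows "\<exists>j. (\<forall>x y. j (x + y) = j x + j y) \<and> (\<forall>a x. j (s a x) = su a (j x)) \<and> inj j"
proof -
  interpret A: vector_space s by fact
  interpret B: vector_space su by fact
  interpret vector_space_pair s su ..
  obtain X where X: "A.independent X" "UNIV \<subseteq> A.span X"
    using A.maximal_independent_subset[of UNIV] by blast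
  obtain j where j: "Vector_Spaces.linear s su j" "\<forall>x\<in>X. j x = \<iota> (c x)"
    using linear_independent_extend[OF X(1), of "\<lambda>x. \<iota> (c x)"] by blast
  have "j ` X \<subseteq> range \<iota>" using j(2) by auto
  then have "B.independent (j ` X)" using assms(4) B.dependent_mono by blast
  moreover have "inj_on j X"
    using j(2) \<open>inj \<iota>\<close> \<open>inj c\<close> by (auto simp: inj_on_def)
  ultimately have "inj_on j (A.span X)"
    by (rule linear_inj_on_span_independent_image[OF j(1)])
  then have "inj j" using X(2) inj_on_subset by blast
  then show ?thesis using j(1) by (auto simp: Vector_Spaces.linear_iff)
qed

text \<open>The graph of \<open>f\<close>, with the pair \<open>(v, f v)\<close> encoded as the set \<open>{(0, v), (1, f v)}\<close>.\<close>

lemma inj_graph_code: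
  "inj (\<lambda>f :: 'v \<Rightarrow> 'v. range (\<lambda>v. {(0 :: 'k::field, v), (1, f v)}))"
proof (rule injI, rule ext)
  fix f g :: "'v \<Rightarrow> 'v" and v
  assume "range (\<lambda>v. {(0 :: 'k, v), (1, f v)}) = range (\<lambda>v. {(0 :: 'k, v), (1, g v)})"
  then have "{(0 :: 'k, v), (1, f v)} \<in> range (\<lambda>v. {(0 :: 'k, v), (1, g v)})" by blast
  then obtain w where "{(0 :: 'k, v), (1, f v)} = {(0, w), (1, g w)}" by blast
  then show "f v = g v" by (auto simp: doubleton_eq_iff)
qed

text \<open>The universal property ranges over \<open>fz_alg\<close> records while the functor has
  values in \<open>local_alg\<close> records. Forgetting \<open>tder\<close> and \<open>flds\<close>
  mediates between the two.\<close>

lemma fz_alg_truncate: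
  fixes A :: "('k::field_char_0, 'u::ab_group_add) local_alg"
  defines "B \<equiv> fz_alg.truncate A"
  shows "fz_complete \<rho> B = fz_complete \<rho> A" "dist B = dist A" "fz_hom X B = fz_hom X A"
proof -
  have sel: "scl B = scl A" "car B = car A" "par B = par A" "deg B = deg A" "mul B = mul A"
    "one B = one A" "topo B = topo A"
    by (simp_all add: B_def fz_alg.truncate_def)
  show "fz_complete \<rho> B = fz_complete \<rho> A"
    unfolding fz_complete_def graded_associative_algebra_def graded_super_space_def super_subset_def
      even_bilin_def lin_map_def is_unit_def linear_topologies_def complete_degreewise_def
      Defs.cauchy_filter_def sel ..
  show "dist B = dist A"
    unfolding dist_def dist_carrier_def dist_scl_def[abs_def] homogeneous_dist_def
      normal_ordered_def[abs_def]
      dist_lam_def[abs_def] fz_suminf_def sopp_def scomm_def sel ..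
  show "fz_hom X B = fz_hom X A"
    unfolding fz_hom_def even_map_def lin_map_def preserves_degree_def sel ..
qed

lemma frenkel_zhu_universal:
  fixes A :: "('k::field_char_0, 'u::ab_group_add) local_alg"
  assumes "frenkel_zhu \<rho> V A Y" "fz_complete \<rho> A'" "y \<in> va_hom V (dist A')"
  shows "\<exists>!\<phi>. \<phi> \<in> fz_hom A (A' :: ('k, 'u) local_alg) \<and> (\<forall>a\<in>car V. \<forall>t. \<phi> (Y a t) = y a t)"
proof -
  have "fz_complete \<rho> (fz_alg.truncate A')" "y \<in> va_hom V (dist (fz_alg.truncate A'))"
    using assms by (simp_all only: fz_alg_truncate)
  then have "\<exists>!\<phi>. \<phi> \<in> fz_hom A (fz_alg.truncate A') \<and> (\<forall>a\<in>car V. \<forall>t. \<phi> (Y a t) = y a t)"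
    using assms(1) unfolding frenkel_zhu_def by blast
  then show ?thesis by (simp only: fz_alg_truncate)
qed

lemma frenkel_zhuD:
  assumes "frenkel_zhu \<rho> V A Y"
  shows "A \<in> local_algebras \<rho>" "Y \<in> va_hom V (dist A)" "flds A = Y ` car V" "fz_complete \<rho> A"
proof -
  show A: "A \<in> local_algebras \<rho>" and "Y \<in> va_hom V (dist A)" "flds A = Y ` car V"
    using assms unfolding frenkel_zhu_def by blast+
  then show "fz_complete \<rho> A" unfolding local_algebras_def fz_complete_differential_def by blast
qed

text \<open>The universal property factors \<open>state_field\<close>, which is injective on
  \<open>car V\<close>, through \<open>Y\<close>.\<close>

lemma frenkel_zhu_inj:
  fixes A :: "('k::field_char_0, 'u::ab_group_add) local_alg"
    and V :: "('k, 'v::ab_group_add) vertex_alg"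
    and su :: "'k \<Rightarrow> 'u \<Rightarrow> 'u"
    and \<iota> :: "('k \<times> 'v) set set \<Rightarrow> 'u"
  assumes V: "V \<in> truncated_vertex_algebras \<rho>" and FZ: "frenkel_zhu \<rho> V A Y"
    and large: "vector_space su" "inj \<iota>" "\<not> module.dependent su (range \<iota>)"
  shows "inj_on Y (car V)"
proof (rule inj_onI)
  fix a b assume ab: "a \<in> car V" "b \<in> car V" "Y a = Y b"
  have assoc: "associative_graded_vertex_algebra \<rho> V" and trunc: "truncated V"
    using V by (simp_all add: truncated_vertex_algebras_def)
  then have unbounded: "graded_unbounded_vertex_algebra \<rho> V"
    by (simp add: associative_graded_vertex_algebra_def graded_vertex_algebra_def)
  interpret V: assoc_va \<rho> V
    by (intro assoc_va.intro assoc_va_axioms.intro graded_vaI unbounded assoc)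
  obtain j where "\<forall>x y. j (x + y) = j x + j y" "\<forall>c x. j (V.fscl c x) = su c (j x)" "inj j"
    using linear_embedding[OF V.F.vector_space_axioms large inj_graph_code] by blast
  then interpret M: end_model \<rho> V su j
    by unfold_locales (use large(1) trunc in \<open>simp_all add: vector_space_def\<close>)
  obtain \<phi> where "\<forall>a\<in>car V. \<forall>t. \<phi> (Y a t) = M.state_field a t"
    using FZ M.end_fz_complete M.state_field_hom unfolding frenkel_zhu_def by blast
  then have "M.state_field a = M.state_field b" using ab by (metis ext)
  then show "a = b" using ab M.state_field_inj by blast
qed

theorem proposition3p4p3:
  fixes \<rho> :: rat
    and su :: "'k::field_char_0 \<Rightarrow> 'u::ab_group_add \<Rightarrow> 'u"
    and \<iota> :: "('k \<times> 'v::ab_group_add) set set \<Rightarrow> 'u"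
    and \<A> :: "('k, 'v) vertex_alg \<Rightarrow> ('k, 'u) local_alg"
    and Y :: "('k, 'v) vertex_alg \<Rightarrow> 'v \<Rightarrow> int \<Rightarrow> 'u"
  assumes "\<rho> \<noteq> 0" and "inverse \<rho> \<in> \<nat>"
    and large_universe: "vector_space su" "inj \<iota>" "\<not> module.dependent su (range \<iota>)"
    and frenkel_zhu: "\<And>V. V \<in> truncated_vertex_algebras \<rho> \<Longrightarrow> frenkel_zhu \<rho> V (\<A> V) (Y V)"
  defines "Am \<equiv> (\<lambda>V W. frenkel_zhu_map V (\<A> V) (Y V) (\<A> W) (Y W))"
  shows "concrete_functor (truncated_vertex_algebras \<rho>) car va_hom
           (local_algebras \<rho>) car local_hom \<A> Am
       \<and> fully_faithful (truncated_vertex_algebras \<rho>) va_hom local_hom \<A> Am"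
proof -
  let ?Ob = "truncated_vertex_algebras \<rho> :: ('k, 'v) vertex_alg set"
  note FZ = frenkel_zhuD[OF frenkel_zhu]
  have va: "graded_va \<rho> V" if "V \<in> ?Ob" for V
    using that by (intro graded_vaI)
      (simp add: truncated_vertex_algebras_def associative_graded_vertex_algebra_def
        graded_vertex_algebra_def)
  have fz: "fz_complete_algebra \<rho> (\<A> V)" if "V \<in> ?Ob" for V
    using FZ(4)[OF that] by (rule fz_complete_algebra.intro)
  have Y_car: "Y V a t \<in> car (\<A> V)" if "V \<in> ?Ob" "a \<in> car V" for V a t
  proof -
    interpret fz_complete_algebra \<rho> "\<A> V" by (rule fz[OF that(1)])
    show ?thesis using dist_carrier_car va_homD(2)[OF FZ(2)[OF that(1)] that(2)] by simp
  qed
  \<comment> \<open>The universal property of \<open>\<A> V\<close>, applied to \<open>Y W\<close>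
    after f. It makes the definite description in \<open>frenkel_zhu_map\<close> meaningful.\<close>
  have ex1: "\<exists>!\<phi>. \<phi> \<in> fz_hom (\<A> V) (\<A> W) \<and> (\<forall>a\<in>car V. \<forall>t. \<phi> (Y V a t) = Y W (f a) t)"
    if V: "V \<in> ?Ob" and W: "W \<in> ?Ob" and f: "f \<in> va_hom V W" for V W f
  proof -
    have "compose (car V) (Y W) f \<in> va_hom V (dist (\<A> W))"
      by (rule graded_va.va_hom_compose[OF va[OF V] f FZ(2)[OF W]])
    from frenkel_zhu_universal[OF frenkel_zhu[OF V] FZ(4)[OF W] this]
    show ?thesis by (simp add: compose_def)
  qed
  have Am: "Am V W f \<in> fz_hom (\<A> V) (\<A> W)" "a \<in> car V \<Longrightarrow> Am V W f (Y V a t) = Y W (f a) t"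
    if "V \<in> ?Ob" "W \<in> ?Ob" "f \<in> va_hom V W" for V W f a t
    using theI'[OF ex1[OF that]] unfolding Am_def frenkel_zhu_map_def by blast+
  \<comment> \<open>By uniqueness, the functor laws and fullness only require comparing morphisms on
    the coefficients \<open>Y V a t\<close>.\<close>
  have Am_eqI: "Am V W f = \<phi>"
    if "V \<in> ?Ob" "W \<in> ?Ob" "f \<in> va_hom V W" "\<phi> \<in> fz_hom (\<A> V) (\<A> W)"
      "\<And>a t. a \<in> car V \<Longrightarrow> \<phi> (Y V a t) = Y W (f a) t" for V W f \<phi>
    using the1_equality[OF ex1[OF that(1-3)], of \<phi>] that(4,5) unfolding Am_def frenkel_zhu_map_def
      by blast
  have Am_local: "Am V W f \<in> local_hom (\<A> V) (\<A> W)"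
    if V: "V \<in> ?Ob" and W: "W \<in> ?Ob" and f: "f \<in> va_hom V W" for V W f
  proof -
    have "(\<lambda>t. Am V W f (y t)) \<in> va_generated (dist (\<A> W)) (flds (\<A> W))" if "y \<in> flds (\<A> V)" for y
    proof -
      obtain a where a: "a \<in> car V" "y = Y V a" using \<open>y \<in> flds (\<A> V)\<close> FZ(3)[OF V] by blast
      have "(\<lambda>t. Am V W f (y t)) = Y W (f a)" using a Am(2)[OF V W f] by (simp add: fun_eq_iff)
      also have "\<dots> \<in> flds (\<A> W)" using va_homD(2)[OF f a(1)] FZ(3)[OF W] by blast
      finally show ?thesis unfolding va_generated_def by blast
    qed
    then show ?thesis using Am(1)[OF V W f] unfolding local_hom_def by blast
  qed
  have is_functor: "concrete_functor ?Ob car va_hom (local_algebras \<rho>) car local_hom \<A> Am"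
    unfolding concrete_functor_def
  proof (intro conjI ballI)
    show "\<A> V \<in> local_algebras \<rho>" if "V \<in> ?Ob" for V by (rule FZ(1)[OF that])
    show "Am V W f \<in> local_hom (\<A> V) (\<A> W)" if "V \<in> ?Ob" "W \<in> ?Ob" "f \<in> va_hom V W" for V W f
      by (rule Am_local[OF that])
    show "Am V V (\<lambda>x\<in>car V. x) = (\<lambda>x\<in>car (\<A> V). x)" if V: "V \<in> ?Ob" for V
      by (rule Am_eqI[OF V V graded_va.va_hom_id[OF va[OF V]] fz_complete_algebra.fz_hom_id[OF
        fz[OF V]]])
        (simp add: Y_car[OF V])
    fix U V W f g assume U: "U \<in> ?Ob" and V: "V \<in> ?Ob" and W: "W \<in> ?Ob"
      and f: "f \<in> va_hom U V" and g: "g \<in> va_hom V W"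
    show "Am U W (compose (car U) g f) = compose (car (\<A> U)) (Am V W g) (Am U V f)"
      by (rule Am_eqI[OF U W graded_va.va_hom_compose[OF va[OF U] f g]
            fz_complete_algebra.fz_hom_compose[OF fz[OF U] Am(1)[OF U V f] Am(1)[OF V W g]]])
        (simp add: compose_eq Y_car[OF U] Am(2)[OF U V f] Am(2)[OF V W g] va_homD(2)[OF f])
  qed
  have Y_inj: "inj_on (Y V) (car V)" if "V \<in> ?Ob" for V
    by (rule frenkel_zhu_inj[OF that frenkel_zhu[OF that] large_universe])
  have "bij_betw (Am V W) (va_hom V W) (local_hom (\<A> V) (\<A> W))" if V: "V \<in> ?Ob" and W: "W \<in> ?Ob" for V W
    unfolding bij_betw_def
  proof
    show "inj_on (Am V W) (va_hom V W)"
    proof (rule inj_onI)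
      fix f g assume f: "f \<in> va_hom V W" and g: "g \<in> va_hom V W" and eq: "Am V W f = Am V W g"
      show "f = g"
      proof (rule extensionalityI[OF va_homD(1)[OF f] va_homD(1)[OF g]])
        fix a assume a: "a \<in> car V"
        have "Y W (f a) t = Y W (g a) t" for t
          using Am(2)[OF V W f a, of t] Am(2)[OF V W g a, of t] eq by simp
        then have "Y W (f a) = Y W (g a)" by (rule ext)
        then show "f a = g a"
          using inj_onD[OF Y_inj[OF W]] va_homD(2)[OF f a] va_homD(2)[OF g a] by blast
      qed
    qed
    have "\<phi> \<in> Am V W ` va_hom V W" if \<phi>: "\<phi> \<in> local_hom (\<A> V) (\<A> W)" for \<phi>
    proof -
      have hom: "\<phi> \<in> fz_hom (\<A> V) (\<A> W)" using \<phi> by (simp add: local_hom_def)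
      interpret A: fz_complete_algebra \<rho> "\<A> V" by (rule fz[OF V])
      interpret B: fz_complete_algebra \<rho> "\<A> W" by (rule fz[OF W])
      interpret fz_morphism \<rho> "\<A> V" "\<A> W" \<phi> by unfold_locales (rule hom)
      define y where "y = (\<lambda>a\<in>car V. \<lambda>t. \<phi> (Y V a t))"
      have y: "y \<in> va_hom V (dist (\<A> W))"
        unfolding y_def by (rule va_hom_dist[OF va[OF V] FZ(2)[OF V]])
      have range: "y a \<in> Y W ` car W" if a: "a \<in> car V" for a
      proof -
        have "y a \<in> va_generated (dist (\<A> W)) (flds (\<A> W))"
          using \<phi> a FZ(3)[OF V] unfolding local_hom_def y_def by simp
        then show ?thesis
          using va_generated_image[OF va[OF W] fz[OF W] FZ(2)[OF W]] unfolding FZ(3)[OF W] by blast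
      qed
      from va_hom_lift[OF va[OF V] va[OF W] fz[OF W] FZ(2)[OF W] Y_inj[OF W] y range]
      obtain f where f: "f \<in> va_hom V W" "\<forall>a\<in>car V. Y W (f a) = y a" by blast
      have "Am V W f = \<phi>"
        by (rule Am_eqI[OF V W f(1) hom]) (simp add: f(2) y_def)
      then show ?thesis using f(1) by blast
    qed
    then show "Am V W ` va_hom V W = local_hom (\<A> V) (\<A> W)" using Am_local[OF V W] by blast
  qed
  then have "fully_faithful ?Ob va_hom local_hom \<A> Am" unfolding fully_faithful_def by blast
  with is_functor show ?thesis ..
qed

end
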